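(* Let $n\ge 4$. Up to isomorphism there are four (families of) solvable indecomposable real left Leibniz algebras of dimension $n+1$ whose nilradical is the $n$-dimensional algebra $\mathcal{L}^2$; that is, the solvable indecomposable left Leibniz algebras with codimension one nilradical $\mathcal{L}^2$ are, up to isomorphism, the following algebras with basis $e_1,\dots,e_{n+1}$, where $e_1,\dots,e_n$ span the nilradical $\mathcal{L}^2$ with its defining brackets, and the only other nonzero brackets are among those listed: (i) $l_{n+1,1}$ (depending on a parameter $a\in\mathbb{R}$): $[e_1,e_{n+1}]=e_1+(a-2)e_3$, $[e_3,e_{n+1}]=(a-1)e_3$, $[e_4,e_{n+1}]=(1-a)e_2+ae_4$, $[e_j,e_{n+1}]=(a+j-4)e_j$ $(5\le j\le n)$, $[e_{n+1},e_1]=-e_1+(2-a)e_3$, $[e_{n+1},e_2]=-ae_2$, $[e_{n+1},e_i]=(4-i-a)e_i$ $(3\le i\le n)$; $DS=[n+1,n,n-2,0]$, $LS=[n+1,n,n,\dots]$. (ii) $l_{n+1,2}$ (for $n\ge5$, $\delta=\pm1$): $[e_1,e_{n+1}]=e_1-2e_3+\delta e_5$, $[e_3,e_{n+1}]=-e_3$, $[e_4,e_{n+1}]=e_2$, $[e_j,e_{n+1}]=(j-4)e_j$ $(5\le j\le n)$, $[e_{n+1},e_1]=-e_1+2e_3-\delta e_5$, $[e_{n+1},e_i]=(4-i)e_i$ $(3\le i\le n)$; $DS=[n+1,n,n-2,0]$, $LS=[n+1,n,n,\dots]$. (iii) $l_{n+1,3}$ (for $n\ge5$, $\delta=\pm1$):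 $[e_1,e_{n+1}]=e_1+(2-n)e_3$, $[e_3,e_{n+1}]=(3-n)e_3$, $[e_4,e_{n+1}]=(n-3)e_2+(4-n)e_4$, $[e_j,e_{n+1}]=(j-n)e_j$ $(5\le j\le n-1)$, $[e_{n+1},e_{n+1}]=\delta e_n$, $[e_{n+1},e_1]=-e_1+(n-2)e_3$, $[e_{n+1},e_2]=(n-4)e_2$, $[e_{n+1},e_i]=(n-i)e_i$ $(3\le i\le n-1)$; $DS=[n+1,n,n-2,0]$, $LS=[n+1,n,n,\dots]$. (iv) $l_{n+1,4}$ (with $\epsilon\in\{0,1,-1\}$ and parameters $b_1,\dots,b_{n-5}\in\mathbb{R}$): $[e_1,e_{n+1}]=e_3$, $[e_3,e_{n+1}]=e_3+\epsilon e_5+\sum_{k=6}^n b_{k-5}e_k$, $[e_4,e_{n+1}]=-e_2+e_4+\epsilon e_6+\sum_{k=7}^n b_{k-6}e_k$, $[e_j,e_{n+1}]=e_j+\epsilon e_{j+2}+\sum_{k=j+3}^n b_{k-j-2}e_k$ $(5\le j\le n)$, $[e_{n+1},e_1]=-e_3$, $[e_{n+1},e_2]=-e_2$, $[e_{n+1},e_i]=-e_i-\epsilon e_{i+2}-\sum_{k=i+3}^n b_{k-i-2}e_k$ $(3\le i\le n)$, where every term $\epsilon e_m$ with $m>n$ is omitted; $DS=[n+1,n-1,0]$, $LS=[n+1,n-1,n-1,\dots]$.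
   Context: All algebras are finite dimensional over $\mathbb{R}$; brackets not listed are zero. A left Leibniz algebra is a vector space with a bilinear bracket satisfying $[[x,y],z]=[x,[y,z]]-[y,[x,z]]$. For a Leibniz algebra $L$: $L^0=L$, $L^{k+1}=[L^k,L]$ (lower central series) and $L^{(0)}=L$, $L^{(k+1)}=[L^{(k)},L^{(k)}]$ (derived series); $L$ is nilpotent (resp. solvable) if some $L^m=0$ (resp. $L^{(m)}=0$). $LS$ and $DS$ denote the lists of dimensions of the terms of the lower central and derived series. The nilradical of a solvable Leibniz algebra is its unique maximal nilpotent ideal. An algebra is indecomposable if it is not a direct sum of two nonzero ideals. For $n\ge4$, $\mathcal{L}^2$ is the $n$-dimensional nilpotent Leibniz algebra with basis $e_1,\dots,e_n$ and only nonzero brackets $[e_1,e_1]=e_2$, $[e_i,e_1]=e_{i+1}$ $(3\le i\le n-1)$, $[e_1,e_3]=e_2-e_4$, $[e_1,e_j]=-e_{j+1}$ $(4\le j\le n-1)$. (It is both a left and a right Leibniz algebra.)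
   Formalization: DS and LS of (i) are asserted only for a≠1, since at a=1 the derived algebra has dimension n-1, not n; the families are asserted pairwise non-isomorphic only for n≥5, since for n=4 only (i) and (iv) exist and (iv) is isomorphic to (i) with a=1. *)

theory Defs
  imports "HOL-Analysis.Analysis" "HOL-Analysis.Finite_Function_Topology"
begin

section \<open>Left Leibniz algebras on subspaces of real vector spaces\<close>

text \<open>An algebra is a carrier \<open>V\<close> inside some real vector space together with a bracket
  \<open>br\<close>; only the values of \<open>br\<close> on \<open>V\<close> matter.\<close>

definition left_leibniz_algebra :: "'a::real_vector set \<Rightarrow> ('a \<Rightarrow> 'a \<Rightarrow> 'a) \<Rightarrow> bool" where
  "left_leibniz_algebra V br \<longleftrightarrow>
     subspace V \<and> (\<exists>B. finite B \<and> V = span B) \<and>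
     (\<forall>x\<in>V. \<forall>y\<in>V. br x y \<in> V) \<and>
     (\<forall>x\<in>V. \<forall>y\<in>V. \<forall>z\<in>V. br (x + y) z = br x z + br y z \<and> br z (x + y) = br z x + br z y) \<and>
     (\<forall>c. \<forall>x\<in>V. \<forall>y\<in>V. br (c *\<^sub>R x) y = c *\<^sub>R br x y \<and> br x (c *\<^sub>R y) = c *\<^sub>R br x y) \<and>
     (\<forall>x\<in>V. \<forall>y\<in>V. \<forall>z\<in>V. br (br x y) z = br x (br y z) - br y (br x z))"

definition leibniz_isomorphic ::
    "'a::real_vector set \<Rightarrow> ('a \<Rightarrow> 'a \<Rightarrow> 'a) \<Rightarrow> 'b::real_vector set \<Rightarrow> ('b \<Rightarrow> 'b \<Rightarrow> 'b) \<Rightarrow> bool" where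
  "leibniz_isomorphic V br W br' \<longleftrightarrow>
     (\<exists>f. bij_betw f V W \<and>
          (\<forall>x\<in>V. \<forall>y\<in>V. f (x + y) = f x + f y) \<and>
          (\<forall>c. \<forall>x\<in>V. f (c *\<^sub>R x) = c *\<^sub>R f x) \<and>
          (\<forall>x\<in>V. \<forall>y\<in>V. f (br x y) = br' (f x) (f y)))"

definition bracket_span :: "('a::real_vector \<Rightarrow> 'a \<Rightarrow> 'a) \<Rightarrow> 'a set \<Rightarrow> 'a set \<Rightarrow> 'a set" where
  "bracket_span br A B = span {br x y | x y. x \<in> A \<and> y \<in> B}"

primrec lower_central :: "'a::real_vector set \<Rightarrow> ('a \<Rightarrow> 'a \<Rightarrow> 'a) \<Rightarrow> nat \<Rightarrow> 'a set" where
  "lower_central V br 0 = V"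
| "lower_central V br (Suc k) = bracket_span br (lower_central V br k) V"

primrec derived_series :: "'a::real_vector set \<Rightarrow> ('a \<Rightarrow> 'a \<Rightarrow> 'a) \<Rightarrow> nat \<Rightarrow> 'a set" where
  "derived_series V br 0 = V"
| "derived_series V br (Suc k) = bracket_span br (derived_series V br k) (derived_series V br k)"

definition nilpotent_algebra :: "'a::real_vector set \<Rightarrow> ('a \<Rightarrow> 'a \<Rightarrow> 'a) \<Rightarrow> bool" where
  "nilpotent_algebra V br \<longleftrightarrow> (\<exists>m. lower_central V br m = {0})"

definition solvable_algebra :: "'a::real_vector set \<Rightarrow> ('a \<Rightarrow> 'a \<Rightarrow> 'a) \<Rightarrow> bool" where
  "solvable_algebra V br \<longleftrightarrow> (\<exists>m. derived_series V br m = {0})"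

definition LS :: "'a::real_vector set \<Rightarrow> ('a \<Rightarrow> 'a \<Rightarrow> 'a) \<Rightarrow> nat \<Rightarrow> nat" where
  "LS V br k = dim (lower_central V br k)"

definition DS :: "'a::real_vector set \<Rightarrow> ('a \<Rightarrow> 'a \<Rightarrow> 'a) \<Rightarrow> nat \<Rightarrow> nat" where
  "DS V br k = dim (derived_series V br k)"

definition leibniz_ideal :: "'a::real_vector set \<Rightarrow> ('a \<Rightarrow> 'a \<Rightarrow> 'a) \<Rightarrow> 'a set \<Rightarrow> bool" where
  "leibniz_ideal V br I \<longleftrightarrow>
     subspace I \<and> I \<subseteq> V \<and> (\<forall>x\<in>V. \<forall>y\<in>I. br x y \<in> I \<and> br y x \<in> I)"

definition maximal_nilpotent_ideal :: "'a::real_vector set \<Rightarrow> ('a \<Rightarrow> 'a \<Rightarrow> 'a) \<Rightarrow> 'a set \<Rightarrow> bool" where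
  "maximal_nilpotent_ideal V br N \<longleftrightarrow>
     leibniz_ideal V br N \<and> nilpotent_algebra N br \<and>
     (\<forall>M. leibniz_ideal V br M \<and> nilpotent_algebra M br \<and> N \<subseteq> M \<longrightarrow> M = N)"

definition is_nilradical :: "'a::real_vector set \<Rightarrow> ('a \<Rightarrow> 'a \<Rightarrow> 'a) \<Rightarrow> 'a set \<Rightarrow> bool" where
  "is_nilradical V br N \<longleftrightarrow>
     maximal_nilpotent_ideal V br N \<and> (\<forall>M. maximal_nilpotent_ideal V br M \<longrightarrow> M = N)"

definition indecomposable_algebra :: "'a::real_vector set \<Rightarrow> ('a \<Rightarrow> 'a \<Rightarrow> 'a) \<Rightarrow> bool" where
  "indecomposable_algebra V br \<longleftrightarrow>
     \<not> (\<exists>I J. leibniz_ideal V br I \<and> leibniz_ideal V br J \<and> I \<noteq> {0} \<and> J \<noteq> {0} \<and>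
              I \<inter> J = {0} \<and> V = {x + y | x y. x \<in> I \<and> y \<in> J})"

section \<open>Algebras given by multiplication tables\<close>

text \<open>The \<open>m\<close>-dimensional space with basis \<open>ev 1, \<dots>, ev m\<close> is realised
  inside the real vector space of finitely supported functions on the naturals. A table \<open>T\<close> gives
  the brackets \<open>T i j\<close> of the basis vectors \<open>ev i\<close> and \<open>ev j\<close>.\<close>

definition ev :: "nat \<Rightarrow> (nat \<Rightarrow>\<^sub>0 real)" where
  "ev i = Poly_Mapping.single i 1"

definition coord_space :: "nat \<Rightarrow> (nat \<Rightarrow>\<^sub>0 real) set" where
  "coord_space m = span (ev ` {1..m})"

definition table_bracket ::
    "nat \<Rightarrow> (nat \<Rightarrow> nat \<Rightarrow> (nat \<Rightarrow>\<^sub>0 real)) \<Rightarrow> (nat \<Rightarrow>\<^sub>0 real) \<Rightarrow> (nat \<Rightarrow>\<^sub>0 real) \<Rightarrow> (nat \<Rightarrow>\<^sub>0 real)" where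
  "table_bracket m T x y =
     (\<Sum>i\<in>{1..m}. \<Sum>j\<in>{1..m}. (Poly_Mapping.lookup x i * Poly_Mapping.lookup y j) *\<^sub>R T i j)"

definition L2_table :: "nat \<Rightarrow> nat \<Rightarrow> nat \<Rightarrow> (nat \<Rightarrow>\<^sub>0 real)" where
  "L2_table n i j =
     (if i = 1 \<and> j = 1 then ev 2
      else if 3 \<le> i \<and> i \<le> n - 1 \<and> j = 1 then ev (i + 1)
      else if i = 1 \<and> j = 3 then ev 2 - ev 4
      else if i = 1 \<and> 4 \<le> j \<and> j \<le> n - 1 then - ev (j + 1)
      else 0)"

definition L2_bracket :: "nat \<Rightarrow> (nat \<Rightarrow>\<^sub>0 real) \<Rightarrow> (nat \<Rightarrow>\<^sub>0 real) \<Rightarrow> (nat \<Rightarrow>\<^sub>0 real)" where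
  "L2_bracket n = table_bracket n (L2_table n)"

text \<open>For \<open>a = 1\<close> the next algebra has \<open>[ev 1, ev (n+1)] = ev 1 - ev 3\<close> and
  \<open>[ev 3, ev (n+1)] = [ev (n+1), ev 3] = 0\<close>, so its derived algebra has dimension \<open>n - 1\<close>, whereas
  it is \<open>n\<close> for all other \<open>a\<close>.\<close>

definition ext1_table :: "nat \<Rightarrow> real \<Rightarrow> nat \<Rightarrow> nat \<Rightarrow> (nat \<Rightarrow>\<^sub>0 real)" where
  "ext1_table n a i j =
     (if i \<le> n \<and> j \<le> n then L2_table n i j
      else if j = n + 1 \<and> i = 1 then ev 1 + (a - 2) *\<^sub>R ev 3
      else if j = n + 1 \<and> i = 3 then (a - 1) *\<^sub>R ev 3
      else if j = n + 1 \<and> i = 4 then (1 - a) *\<^sub>R ev 2 + a *\<^sub>R ev 4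
      else if j = n + 1 \<and> 5 \<le> i \<and> i \<le> n then (a + real i - 4) *\<^sub>R ev i
      else if i = n + 1 \<and> j = 1 then - ev 1 + (2 - a) *\<^sub>R ev 3
      else if i = n + 1 \<and> j = 2 then (- a) *\<^sub>R ev 2
      else if i = n + 1 \<and> 3 \<le> j \<and> j \<le> n then (4 - real j - a) *\<^sub>R ev j
      else 0)"

definition ext2_table :: "nat \<Rightarrow> real \<Rightarrow> nat \<Rightarrow> nat \<Rightarrow> (nat \<Rightarrow>\<^sub>0 real)" where
  "ext2_table n \<delta> i j =
     (if i \<le> n \<and> j \<le> n then L2_table n i j
      else if j = n + 1 \<and> i = 1 then ev 1 - 2 *\<^sub>R ev 3 + \<delta> *\<^sub>R ev 5
      else if j = n + 1 \<and> i = 3 then - ev 3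
      else if j = n + 1 \<and> i = 4 then ev 2
      else if j = n + 1 \<and> 5 \<le> i \<and> i \<le> n then (real i - 4) *\<^sub>R ev i
      else if i = n + 1 \<and> j = 1 then - ev 1 + 2 *\<^sub>R ev 3 - \<delta> *\<^sub>R ev 5
      else if i = n + 1 \<and> 3 \<le> j \<and> j \<le> n then (4 - real j) *\<^sub>R ev j
      else 0)"

definition ext3_table :: "nat \<Rightarrow> real \<Rightarrow> nat \<Rightarrow> nat \<Rightarrow> (nat \<Rightarrow>\<^sub>0 real)" where
  "ext3_table n \<delta> i j =
     (if i \<le> n \<and> j \<le> n then L2_table n i j
      else if j = n + 1 \<and> i = 1 then ev 1 + (2 - real n) *\<^sub>R ev 3
      else if j = n + 1 \<and> i = 3 then (3 - real n) *\<^sub>R ev 3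
      else if j = n + 1 \<and> i = 4 then (real n - 3) *\<^sub>R ev 2 + (4 - real n) *\<^sub>R ev 4
      else if j = n + 1 \<and> 5 \<le> i \<and> i \<le> n - 1 then (real i - real n) *\<^sub>R ev i
      else if j = n + 1 \<and> i = n + 1 then \<delta> *\<^sub>R ev n
      else if i = n + 1 \<and> j = 1 then - ev 1 + (real n - 2) *\<^sub>R ev 3
      else if i = n + 1 \<and> j = 2 then (real n - 4) *\<^sub>R ev 2
      else if i = n + 1 \<and> 3 \<le> j \<and> j \<le> n - 1 then (real n - real j) *\<^sub>R ev j
      else 0)"

text \<open>In the next table the terms with coefficient \<open>\<epsilon>\<close> are omitted when their index exceeds
  \<open>n\<close>; the sums are empty when their lower bound exceeds \<open>n\<close>. Only the parameters
  \<open>b 1, \<dots>, b (n - 5)\<close> occur.\<close>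

definition ext4_table :: "nat \<Rightarrow> real \<Rightarrow> (nat \<Rightarrow> real) \<Rightarrow> nat \<Rightarrow> nat \<Rightarrow> (nat \<Rightarrow>\<^sub>0 real)" where
  "ext4_table n \<epsilon> b i j =
     (let \<epsilon>e = (\<lambda>m. if m \<le> n then \<epsilon> *\<^sub>R ev m else 0) in
      if i \<le> n \<and> j \<le> n then L2_table n i j
      else if j = n + 1 \<and> i = 1 then ev 3
      else if j = n + 1 \<and> i = 3 then ev 3 + \<epsilon>e 5 + (\<Sum>k\<in>{6..n}. b (k - 5) *\<^sub>R ev k)
      else if j = n + 1 \<and> i = 4 then - ev 2 + ev 4 + \<epsilon>e 6 + (\<Sum>k\<in>{7..n}. b (k - 6) *\<^sub>R ev k)
      else if j = n + 1 \<and> 5 \<le> i \<and> i \<le> n then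
        ev i + \<epsilon>e (i + 2) + (\<Sum>k\<in>{i + 3..n}. b (k - i - 2) *\<^sub>R ev k)
      else if i = n + 1 \<and> j = 1 then - ev 3
      else if i = n + 1 \<and> j = 2 then - ev 2
      else if i = n + 1 \<and> 3 \<le> j \<and> j \<le> n then
        - ev j - \<epsilon>e (j + 2) - (\<Sum>k\<in>{j + 3..n}. b (k - j - 2) *\<^sub>R ev k)
      else 0)"

definition ext1_bracket where "ext1_bracket n a = table_bracket (n + 1) (ext1_table n a)"
definition ext2_bracket where "ext2_bracket n \<delta> = table_bracket (n + 1) (ext2_table n \<delta>)"
definition ext3_bracket where "ext3_bracket n \<delta> = table_bracket (n + 1) (ext3_table n \<delta>)"
definition ext4_bracket where "ext4_bracket n \<epsilon> b = table_bracket (n + 1) (ext4_table n \<epsilon> b)"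

text \<open>The brackets on \<open>coord_space (n + 1)\<close> belonging to the four families; the second and
  third family exist only for \<open>n \<ge> 5\<close>.\<close>

definition ext1_family :: "nat \<Rightarrow> ((nat \<Rightarrow>\<^sub>0 real) \<Rightarrow> (nat \<Rightarrow>\<^sub>0 real) \<Rightarrow> (nat \<Rightarrow>\<^sub>0 real)) set" where
  "ext1_family n = {ext1_bracket n a | a. True}"

definition ext2_family :: "nat \<Rightarrow> ((nat \<Rightarrow>\<^sub>0 real) \<Rightarrow> (nat \<Rightarrow>\<^sub>0 real) \<Rightarrow> (nat \<Rightarrow>\<^sub>0 real)) set" where
  "ext2_family n = {ext2_bracket n \<delta> | \<delta>. n \<ge> 5 \<and> \<delta> \<in> {1, -1}}"

definition ext3_family :: "nat \<Rightarrow> ((nat \<Rightarrow>\<^sub>0 real) \<Rightarrow> (nat \<Rightarrow>\<^sub>0 real) \<Rightarrow> (nat \<Rightarrow>\<^sub>0 real)) set" where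
  "ext3_family n = {ext3_bracket n \<delta> | \<delta>. n \<ge> 5 \<and> \<delta> \<in> {1, -1}}"

definition ext4_family :: "nat \<Rightarrow> ((nat \<Rightarrow>\<^sub>0 real) \<Rightarrow> (nat \<Rightarrow>\<^sub>0 real) \<Rightarrow> (nat \<Rightarrow>\<^sub>0 real)) set" where
  "ext4_family n = {ext4_bracket n \<epsilon> b | \<epsilon> b. \<epsilon> \<in> {0, 1, -1}}"

section \<open>The algebras to be classified\<close>

definition indecomposable_solvable_L2_extension ::
    "nat \<Rightarrow> 'a::real_vector set \<Rightarrow> ('a \<Rightarrow> 'a \<Rightarrow> 'a) \<Rightarrow> bool" where
  "indecomposable_solvable_L2_extension n V br \<longleftrightarrow>
     left_leibniz_algebra V br \<and> dim V = n + 1 \<and>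
     solvable_algebra V br \<and> indecomposable_algebra V br \<and>
     (\<exists>N. is_nilradical V br N \<and> leibniz_isomorphic N br (coord_space n) (L2_bracket n))"

end

theory Submission
  imports Defs
begin

text \<open>Put \<open>x = e\<^sub>1 - e\<^sub>3\<close> and read \<open>e\<^sub>k\<^sub>+\<^sub>3\<close> as \<open>t\<^sup>k\<close>. Then \<open>\<L>\<^sup>2\<close> is spanned by \<open>x\<close>, the central
  element \<open>e\<^sub>2\<close> and \<open>\<real>[t]/(t\<^sup>m)\<close> with \<open>m = n - 2\<close>, and its brackets are
  \<open>[f, x] = t f\<close> and \<open>[x, f] = - t f + f(0) e\<^sub>2\<close>. Left multiplication by an element \<open>z\<close> outside
  the nilradical is a derivation: it sends \<open>x\<close> to \<open>\<alpha> x + P + p e\<^sub>2\<close> and \<open>f\<close> to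
  \<open>\<kappa> f + \<alpha> t f' + Q f + q f(0) e\<^sub>2\<close>. The sum of left and right multiplication by \<open>z\<close> maps into
  the left annihilator, the span of \<open>e\<^sub>2\<close> and \<open>t\<^sup>m\<^sup>-\<^sup>1\<close>, and so does \<open>[z, z]\<close>; the numbers
  \<open>\<sigma>\<close>, \<open>\<tau>\<close>, \<open>A\<close>, \<open>B\<close> describe these components. If \<open>\<alpha> = \<kappa> = 0\<close>, the whole algebra is nilpotent.
  Otherwise translating \<open>z\<close>, multiplying the series by a unit \<open>h\<close> and rescaling remove all
  parameters but those of the four families. If \<open>\<alpha> \<noteq> 0\<close>, the unit solving \<open>t h' = Q h\<close> (for
  \<open>\<alpha> = -1\<close>) makes the action of \<open>z\<close> on the series diagonal; \<open>A\<close> survives only if \<open>\<alpha> + \<kappa> = 0\<close>, and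
  \<open>B\<close> only if \<open>\<kappa> + (m - 1) \<alpha> = 0\<close>. If \<open>\<alpha> = 0\<close>, only \<open>Q\<close> survives.\<close>

unbundle no vec_syntax
unbundle fps_syntax

text \<open>The choice x = e_1 - e_3 comes from [e_1 - e_3, e_1 - e_3] = 0. With y the series 1, the
  element e_2 = [x, y] + [y, x] then measures the only failure of antisymmetry inside the
  nilradical, and x and y generate it, so a derivation is determined by two images. No intermediate
  algebras are built during the reduction. Space and bracket stay fixed, each change of basis is a
  new coordinate map with new parameters, and only at the end are two algebras with equal parameters
  compared. The exceptional families are resonances. Translating z by v e_2 changes A by (\<alpha> +
  \<kappa>) v, which is useless exactly when e_2 has weight zero under z; the Leibniz identity
  admits B only when t^(m-1) has weight zero. What remains there can be scaled by any nonzero number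
  through y, so the reduction always reaches \<delta> = 1. The quadratic coefficient of Q is scaled
  through x by squares only, so its sign is kept as part of \<epsilon>.\<close>

lemma fps_X_power_dvd_iff: "fps_X ^ m dvd f \<longleftrightarrow> (\<forall>k<m. f $ k = 0)"
  for f :: "real fps"
proof
  assume "fps_X ^ m dvd f"
  then show "\<forall>k<m. f $ k = 0"
    by (auto simp: dvd_def fps_X_power_mult_nth)
next
  assume "\<forall>k<m. f $ k = 0"
  then have "fps_cutoff m f = 0"
    by (simp add: fps_eq_iff)
  then have "f = fps_X ^ m * fps_shift m f"
    using fps_shift_cutoff'[of m f] by simp
  then show "fps_X ^ m dvd f" by (metis dvd_triv_left)
qed

section \<open>Coordinates by truncated power series\<close>

text \<open>\<open>\<phi> s a b f\<close> stands for \<open>s z + a x + b e\<^sub>2 + f\<close>. A power series \<open>f\<close> represents an element of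
  \<open>\<real>[t]/(t\<^sup>m)\<close>, which keeps multiplication and derivatives free of truncations.\<close>

locale coords =
  fixes m :: nat and V :: "'a::real_vector set"
    and \<phi> :: "real \<Rightarrow> real \<Rightarrow> real \<Rightarrow> real fps \<Rightarrow> 'a"
  assumes V_eq: "V = {\<phi> s a b f | s a b f. True}"
    and add: "\<phi> s a b f + \<phi> s' a' b' f' = \<phi> (s + s') (a + a') (b + b') (f + f')"
    and scale: "c *\<^sub>R \<phi> s a b f = \<phi> (c * s) (c * a) (c * b) (fps_const c * f)"
    and ker: "\<phi> s a b f = 0 \<longleftrightarrow> s = 0 \<and> a = 0 \<and> b = 0 \<and> fps_X ^ m dvd f"
    and m2: "2 \<le> m"
begin

lemma mem [simp]: "\<phi> s a b f \<in> V"
  by (auto simp: V_eq)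

lemma obtain_coords:
  assumes "v \<in> V" obtains s a b f where "v = \<phi> s a b f"
  using assms by (auto simp: V_eq)

lemma uminus: "- \<phi> s a b f = \<phi> (- s) (- a) (- b) (- f)"
  using scale[of "-1" s a b f] by (simp flip: fps_const_neg)

lemma diff: "\<phi> s a b f - \<phi> s' a' b' f' = \<phi> (s - s') (a - a') (b - b') (f - f')"
  using add[of s a b f "-s'" "-a'" "-b'" "-f'"] uminus[of s' a' b' f']
  by (metis ab_group_add_class.ab_diff_conv_add_uminus)

lemma eq_iff:
  "\<phi> s a b f = \<phi> s' a' b' f' \<longleftrightarrow> s = s' \<and> a = a' \<and> b = b' \<and> fps_X ^ m dvd f - f'"
proof -
  have "\<phi> s a b f = \<phi> s' a' b' f' \<longleftrightarrow> \<phi> s a b f - \<phi> s' a' b' f' = 0" by simp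
  then show ?thesis unfolding diff ker by auto
qed

lemma eq_nth_iff:
  "\<phi> s a b f = \<phi> s' a' b' f' \<longleftrightarrow> s = s' \<and> a = a' \<and> b = b' \<and> (\<forall>k<m. f $ k = f' $ k)"
  by (simp add: eq_iff fps_X_power_dvd_iff)

lemma zero_coords [simp]: "\<phi> 0 0 0 0 = 0"
  by (simp add: ker)

lemma subspace: "subspace V"
  unfolding subspace_def
proof (intro conjI ballI allI)
  show "0 \<in> V" using mem[of 0 0 0 0] by simp
qed (auto elim!: obtain_coords simp: add scale)

text \<open>Linearity and vanishing on monomials do not determine a map on power series. Vanishing
  on multiples of t^m closes the gap: every series is a polynomial of degree below m plus such a
  multiple.\<close>

lemma vanish_on_series:
  assumes g_add: "\<And>f f'. g (f + f') = g f + g f'"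
    and g_scale: "\<And>c f. g (fps_const c * f) = c *\<^sub>R g f"
    and g_power: "\<And>k. k < m \<Longrightarrow> g (fps_X ^ k) = 0"
    and g_dvd: "\<And>f. fps_X ^ m dvd f \<Longrightarrow> g f = 0"
  shows "g f = (0 :: 'b::real_vector)"
proof -
  have cut: "k \<le> m \<Longrightarrow> g (fps_cutoff k f) = 0" for k
  proof (induction k)
    case 0
    then show ?case using g_scale[of 0 0] by simp
  next
    case (Suc k)
    have "fps_cutoff (Suc k) f = fps_cutoff k f + fps_const (f $ k) * fps_X ^ k"
      by (rule fps_ext) (auto simp: less_Suc_eq)
    then show ?case using Suc by (simp add: g_add g_scale g_power)
  qed
  have "f = fps_cutoff m f + (f - fps_cutoff m f)" by simp
  moreover have "fps_X ^ m dvd f - fps_cutoff m f"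
    by (simp add: fps_X_power_dvd_iff)
  ultimately show ?thesis using g_add cut[of m] g_dvd by (metis add.right_neutral order_refl)
qed

definition basis_vec :: "nat \<Rightarrow> 'a" where
  "basis_vec k = (if k = 0 then \<phi> 1 0 0 0 else if k = 1 then \<phi> 0 1 0 0
     else if k = 2 then \<phi> 0 0 1 0 else \<phi> 0 0 0 (fps_X ^ (k - 3)))"

lemma finitely_spanned: "\<exists>B. finite B \<and> V = span B"
proof -
  define B where "B = basis_vec ` {..<m + 3}"
  have BV: "B \<subseteq> V" unfolding B_def basis_vec_def by auto
  have series: "\<phi> 0 0 0 f \<in> span B" for f
  proof -
    have cut: "k \<le> m \<Longrightarrow> \<phi> 0 0 0 (fps_cutoff k f) \<in> span B" for k
    proof (induction k)
      case 0
      then show ?case by (simp add: span_zero)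
    next
      case (Suc k)
      have "fps_cutoff (Suc k) f = fps_cutoff k f + fps_const (f $ k) * fps_X ^ k"
        by (rule fps_ext) (auto simp: less_Suc_eq)
      then have "\<phi> 0 0 0 (fps_cutoff (Suc k) f)
          = \<phi> 0 0 0 (fps_cutoff k f) + (f $ k) *\<^sub>R basis_vec (k + 3)"
        by (simp add: add scale basis_vec_def)
      moreover have "basis_vec (k + 3) \<in> B" using Suc by (auto simp: B_def)
      ultimately show ?case using Suc by (simp add: span_add span_scale span_base)
    qed
    have "\<phi> 0 0 0 f = \<phi> 0 0 0 (fps_cutoff m f)" by (simp add: eq_nth_iff)
    then show ?thesis using cut[of m] by simp
  qed
  have "\<phi> s a b f \<in> span B" for s a b f
  proof -
    have "\<phi> s a b f = s *\<^sub>R basis_vec 0 + a *\<^sub>R basis_vec 1 + b *\<^sub>R basis_vec 2 + \<phi> 0 0 0 f"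
      by (simp add: add scale basis_vec_def)
    moreover have "basis_vec 0 \<in> B" "basis_vec 1 \<in> B" "basis_vec 2 \<in> B"
      by (auto simp: B_def)
    ultimately show ?thesis using series by (simp add: span_add span_scale span_base)
  qed
  then have "V \<subseteq> span B" by (auto simp: V_eq)
  moreover have "span B \<subseteq> V" using BV subspace by (simp add: span_minimal)
  moreover have "finite B" by (simp add: B_def)
  ultimately show ?thesis by blast
qed

end

section \<open>The operators \<kappa> + \<alpha> t d/dt + Q on series\<close>

definition series_op :: "real \<Rightarrow> real \<Rightarrow> real fps \<Rightarrow> real fps \<Rightarrow> real fps" where
  "series_op \<alpha> \<kappa> Q f = fps_const \<kappa> * f + fps_const \<alpha> * (fps_X * fps_deriv f) + Q * f"

lemma series_op_add: "series_op \<alpha> \<kappa> Q (f + g) = series_op \<alpha> \<kappa> Q f + series_op \<alpha> \<kappa> Q g"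
  by (simp add: series_op_def algebra_simps)

lemma series_op_diff: "series_op \<alpha> \<kappa> Q (f - g) = series_op \<alpha> \<kappa> Q f - series_op \<alpha> \<kappa> Q g"
  by (simp add: series_op_def algebra_simps)

lemma series_op_scale: "series_op \<alpha> \<kappa> Q (fps_const c * f) = fps_const c * series_op \<alpha> \<kappa> Q f"
  by (simp add: series_op_def algebra_simps)

lemma series_op_scale': "series_op \<alpha> \<kappa> Q (f * fps_const c) = fps_const c * series_op \<alpha> \<kappa> Q f"
  by (simp add: series_op_def algebra_simps)

text \<open>The commutator with multiplication by t is \<alpha> t. As t f is the bracket of f with
  x, this is the derivation rule for a z that scales x by \<alpha>.\<close>

lemma series_op_X: "series_op \<alpha> \<kappa> Q (fps_X * f) = fps_X * series_op \<alpha> \<kappa> Q f + fps_const \<alpha> * (fps_X * f)"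
  by (simp add: series_op_def algebra_simps)

lemma series_op_nth:
  "series_op \<alpha> \<kappa> Q f $ k = (\<kappa> + \<alpha> * real k) * f $ k + (Q * f) $ k"
  by (cases k) (simp_all add: series_op_def algebra_simps)

lemma series_op_X_power:
  "series_op \<alpha> \<kappa> Q (fps_X ^ k) = fps_const (\<kappa> + \<alpha> * real k) * fps_X ^ k + Q * fps_X ^ k"
  by (rule fps_ext) (simp add: series_op_nth)

text \<open>The factor t in front of the derivative makes the operator preserve the ideal (t^m), so
  it descends to the quotient.\<close>

lemma series_op_dvd: "fps_X ^ m dvd f \<Longrightarrow> fps_X ^ m dvd series_op \<alpha> \<kappa> Q f"
  unfolding fps_X_power_dvd_iff series_op_nth
  by (auto simp: fps_mult_nth intro!: sum.neutral)

text \<open>The numbers \<open>\<sigma>\<close> and \<open>\<tau>\<close> are the \<open>e\<^sub>2\<close>-components of \<open>[x, z] + [z, x]\<close> and \<open>[y, z] + [z, y]\<close>,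
  where \<open>y\<close> is the series \<open>1\<close>; this is why right multiplication by \<open>z\<close> involves \<open>\<sigma> - p\<close> and \<open>\<tau> - q\<close>.\<close>

locale L2_model = coords m V \<phi>
  for m :: nat and V :: "'a::real_vector set" and \<phi> :: "real \<Rightarrow> real \<Rightarrow> real \<Rightarrow> real fps \<Rightarrow> 'a" +
  fixes br :: "'a \<Rightarrow> 'a \<Rightarrow> 'a" and \<alpha> \<kappa> :: real and P Q :: "real fps" and p q \<sigma> \<tau> A B :: real
  assumes bracket: "br (\<phi> s a b f) (\<phi> s' a' b' f') =
      \<phi> 0 (\<alpha> * (s * a' - s' * a))
        (a * f' $ 0 + s * (p * a' + (\<alpha> + \<kappa>) * b' + q * f' $ 0)
          + s' * ((\<sigma> - p) * a + (\<tau> - q) * f $ 0 + \<kappa> * f $ 1) + s * s' * A)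
        (fps_X * (fps_const a' * f - fps_const a * f')
          + fps_const s * (series_op \<alpha> \<kappa> Q f' + fps_const a' * P)
          - fps_const s' * (series_op \<alpha> \<kappa> Q f + fps_const a * P)
          + fps_const (s * s' * B) * fps_X ^ (m - 1))"
    and P0: "P $ 0 = 0" and Q0: "Q $ 0 = 0"

text \<open>In coordinates the bracket depends on the parameters alone, so passing from one
  coordinate map to the other is an isomorphism.\<close>

lemma L2_model_isomorphic:
  assumes "L2_model m V \<phi> br \<alpha> \<kappa> P Q p q \<sigma> \<tau> A B" "L2_model m W \<psi> br' \<alpha> \<kappa> P Q p q \<sigma> \<tau> A B"
  shows "leibniz_isomorphic V br W br'"
proof -
  interpret v: L2_model m V \<phi> br \<alpha> \<kappa> P Q p q \<sigma> \<tau> A B by fact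
  interpret w: L2_model m W \<psi> br' \<alpha> \<kappa> P Q p q \<sigma> \<tau> A B by fact
  \<comment> \<open>Coordinate maps are not injective in the series, so a representative is chosen.
    The value does not depend on it, because both maps identify series exactly modulo t^m.\<close>
  define g where "g v = (SOME u. \<exists>s a b f. v = \<phi> s a b f \<and> u = \<psi> s a b f)" for v
  have g: "g (\<phi> s a b f) = \<psi> s a b f" for s a b f
  proof -
    have "\<exists>s' a' b' f'. \<phi> s a b f = \<phi> s' a' b' f' \<and> g (\<phi> s a b f) = \<psi> s' a' b' f'"
      unfolding g_def by (rule someI_ex) blast
    then show ?thesis by (auto simp: v.eq_nth_iff w.eq_nth_iff)
  qed
  have "inj_on g V"
    by (rule inj_onI) (auto elim!: v.obtain_coords simp: g v.eq_iff w.eq_iff)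
  moreover have "g ` V = W"
  proof
    show "g ` V \<subseteq> W" by (auto elim!: v.obtain_coords simp: g)
    show "W \<subseteq> g ` V"
    proof
      fix w assume "w \<in> W"
      then obtain s a b f where "w = \<psi> s a b f" by (rule w.obtain_coords)
      then show "w \<in> g ` V" using g v.mem by (metis image_eqI)
    qed
  qed
  ultimately show ?thesis
    unfolding leibniz_isomorphic_def
    by (intro exI[of _ g] conjI)
      (auto simp: bij_betw_def g v.add w.add v.scale w.scale v.bracket w.bracket elim!: v.obtain_coords)
qed

text \<open>Conditions under which the model satisfies the Leibniz identity. Vanishing linear
  coefficients keep terms \<kappa> P_1 and \<kappa> Q_1 out of the e_2-component. If B is nonzero,
  [z, z] = B t^(m-1) must be annihilated by z: its weight \<kappa> + \<alpha> (m - 1) is zero, and m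
  \<ge> 3 keeps this power away from the coefficient of t that right multiplication by z sends to
  e_2.\<close>

locale L2_normal = L2_model m V \<phi> br \<alpha> \<kappa> P Q 0 0 0 0 0 B
  for m :: nat and V :: "'a::real_vector set" and \<phi> br \<alpha> \<kappa> P Q B +
  assumes P1: "P $ 1 = 0" and Q1: "Q $ 1 = 0"
    and B: "B \<noteq> 0 \<Longrightarrow> 3 \<le> m \<and> \<kappa> + \<alpha> * (real m - 1) = 0"
begin

lemma left_leibniz: "left_leibniz_algebra V br"
  unfolding left_leibniz_algebra_def
proof (intro conjI ballI allI)
  show "subspace V" by (rule subspace)
  show "\<exists>B. finite B \<and> V = span B" by (rule finitely_spanned)
  fix u v assume uv: "u \<in> V" "v \<in> V"
  then show "br u v \<in> V" by (auto elim!: obtain_coords simp: bracket)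
  fix c
  show "br (c *\<^sub>R u) v = c *\<^sub>R br u v"
    using uv by (auto elim!: obtain_coords simp: bracket scale add eq_iff series_op_scale series_op_scale' algebra_simps
        simp flip: fps_const_mult)
  show "br u (c *\<^sub>R v) = c *\<^sub>R br u v"
    using uv by (auto elim!: obtain_coords simp: bracket scale add eq_iff series_op_scale series_op_scale' algebra_simps
        simp flip: fps_const_mult)
next
  fix u v w assume uvw: "u \<in> V" "v \<in> V" "w \<in> V"
  show "br (u + v) w = br u w + br v w"
    using uvw by (auto elim!: obtain_coords simp: bracket scale add eq_iff series_op_add algebra_simps
        simp flip: fps_const_mult fps_const_add)
  show "br w (u + v) = br w u + br w v"
    using uvw by (auto elim!: obtain_coords simp: bracket scale add eq_iff series_op_add algebra_simps
        simp flip: fps_const_mult fps_const_add)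
  obtain s a b f where u: "u = \<phi> s a b f" using uvw obtain_coords by blast
  obtain s' a' b' f' where v: "v = \<phi> s' a' b' f'" using uvw obtain_coords by blast
  obtain s'' a'' b'' f'' where w: "w = \<phi> s'' a'' b'' f''" using uvw obtain_coords by blast
  let ?b = "fps_const B * fps_X ^ (m - 1)"
  let ?D = "series_op \<alpha> \<kappa> Q"
  have Xb: "fps_X ^ m dvd fps_X * ?b"
    using m2 by (auto simp: fps_X_power_dvd_iff fps_X_power_mult_nth)
  have Db: "fps_X ^ m dvd ?D ?b"
  proof -
    have "(Q * fps_X ^ (m - 1)) $ k = 0" if "k < m" for k
      using that Q0 by (simp add: fps_X_power_mult_right_nth)
    then show ?thesis using B m2
      by (auto simp: fps_X_power_dvd_iff series_op_scale series_op_nth of_nat_diff)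
  qed
  \<comment> \<open>The e_2-component sees only the coefficients 0 and 1 of the correction term;
    both are zero because B \<noteq> 0 forces m \<ge> 3.\<close>
  have b01: "B * (fps_X ^ (m - 1) :: real fps) $ 0 = 0" "B * (fps_X ^ (m - 1) :: real fps) $ Suc 0 = 0"
    using B m2 by (cases "m = 2"; auto)+
  show "br (br u v) w = br u (br v w) - br v (br u w)"
    unfolding u v w bracket diff eq_iff
  proof (intro conjI, goal_cases)
    case 1
    show ?case by simp
  next
    case 2
    show ?case by (simp add: algebra_simps)
  next
    case 3
    show ?case using b01 m2 P0 P1 Q0 Q1
      by (simp add: series_op_nth fps_mult_nth_1 algebra_simps) (auto split: if_splits)
  next
    case 4
    \<comment> \<open>As untruncated series the two sides differ. The difference is a combination of
      t b and D b for b = B t^(m-1), both divisible by t^m.\<close>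
    let ?r = "fps_const (a'' * s * s' + a * s' * s'' - a' * s * s'') * (fps_X * ?b)
       - fps_const (s * s' * s'') * ?D ?b"
    have "fps_X ^ m dvd ?r" by (intro dvd_diff dvd_mult Xb Db)
    then show ?case
      by (rule back_subst[of "\<lambda>x. fps_X ^ m dvd x"])
        (simp only: series_op_add series_op_diff series_op_X series_op_scale,
          simp add: algebra_simps flip: fps_const_add fps_const_mult fps_const_sub)
  qed
qed

end

section \<open>Algebras in normal form: nilradical and indecomposability\<close>

lemma bracket_span_subset:
  assumes "subspace S" "\<And>u v. u \<in> A \<Longrightarrow> v \<in> B \<Longrightarrow> br u v \<in> S"
  shows "bracket_span br A B \<subseteq> S"
  unfolding bracket_span_def using assms by (intro span_minimal) auto

lemma bracket_in_span: "u \<in> A \<Longrightarrow> v \<in> B \<Longrightarrow> br u v \<in> bracket_span br A B"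
  unfolding bracket_span_def by (rule span_base) auto

lemma subspace_bracket_span: "subspace (bracket_span br A B)"
  unfolding bracket_span_def by simp

context coords
begin

definition N :: "'a set" where "N = {\<phi> 0 a b f | a b f. True}"

definition Y :: "'a set" where "Y = {\<phi> 0 0 b f | b f. True}"

text \<open>A filtration that right multiplication by \<open>N\<close> pushes up one level. The
  element e_2 may stay in every level, since as a left factor it is annihilated by
  \<open>N\<close>.\<close>

definition W :: "nat \<Rightarrow> 'a set" where "W k = {\<phi> 0 0 b (fps_X ^ k * f) | b f. True}"

lemma N_mem [simp]: "\<phi> 0 a b f \<in> N"
  by (auto simp: N_def)

lemma Y_mem [simp]: "\<phi> 0 0 b f \<in> Y"
  by (auto simp: Y_def)

lemma W_mem [simp]: "\<phi> 0 0 b (fps_X ^ k * f) \<in> W k"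
  by (auto simp: W_def)

lemma obtain_N: assumes "v \<in> N" obtains a b f where "v = \<phi> 0 a b f"
  using assms by (auto simp: N_def)

lemma obtain_Y: assumes "v \<in> Y" obtains b f where "v = \<phi> 0 0 b f"
  using assms by (auto simp: Y_def)

lemma obtain_W: assumes "v \<in> W k" obtains b f where "v = \<phi> 0 0 b (fps_X ^ k * f)"
  using assms by (auto simp: W_def)

lemma subspace_N: "subspace N"
  unfolding subspace_def
proof (intro conjI ballI allI)
  show "0 \<in> N" using N_mem[of 0 0 0] by simp
qed (auto elim!: obtain_N simp: add scale)

lemma subspace_Y: "subspace Y"
  unfolding subspace_def
proof (intro conjI ballI allI)
  show "0 \<in> Y" using Y_mem[of 0 0] by simp
qed (auto elim!: obtain_Y simp: add scale)

lemma subspace_W: "subspace (W k)"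
  unfolding subspace_def
proof (intro conjI ballI allI)
  show "0 \<in> W k" using W_mem[of 0 k 0] by simp
next
  fix u v assume "u \<in> W k" "v \<in> W k"
  then show "u + v \<in> W k" by (auto elim!: obtain_W simp: add simp flip: distrib_left)
next
  fix c u assume "u \<in> W k"
  then obtain b f where "u = \<phi> 0 0 b (fps_X ^ k * f)" by (auto simp: W_def)
  then have "c *\<^sub>R u = \<phi> 0 0 (c * b) (fps_X ^ k * (fps_const c * f))"
    by (simp add: scale mult.left_commute)
  then show "c *\<^sub>R u \<in> W k" by simp
qed

text \<open>The series of a vector is determined only modulo t^m. Its constant term, which is all
  that \<open>ycoord\<close> reads, is well defined because m is positive.\<close>

definition coord_tuple :: "'a \<Rightarrow> real \<times> real \<times> real \<times> real fps" where
  "coord_tuple v = (SOME (s, a, b, f). v = \<phi> s a b f)"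

definition zcoord :: "'a \<Rightarrow> real" where
  "zcoord v = fst (coord_tuple v)"

definition xcoord :: "'a \<Rightarrow> real" where
  "xcoord v = fst (snd (coord_tuple v))"

definition ycoord :: "'a \<Rightarrow> real" where
  "ycoord v = snd (snd (snd (coord_tuple v))) $ 0"

lemma zcoord [simp]: "zcoord (\<phi> s a b f) = s"
  and xcoord [simp]: "xcoord (\<phi> s a b f) = a"
  and ycoord [simp]: "ycoord (\<phi> s a b f) = f $ 0"
proof -
  obtain s' a' b' f' where t: "coord_tuple (\<phi> s a b f) = (s', a', b', f')"
    by (metis prod_cases4)
  have "case coord_tuple (\<phi> s a b f) of (s', a', b', f') \<Rightarrow> \<phi> s a b f = \<phi> s' a' b' f'"
    unfolding coord_tuple_def by (rule someI[of _ "(s, a, b, f)"]) simp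
  then have "s' = s \<and> a' = a \<and> f' $ 0 = f $ 0"
    unfolding t eq_nth_iff using m2 by auto
  with t show "zcoord (\<phi> s a b f) = s" "xcoord (\<phi> s a b f) = a" "ycoord (\<phi> s a b f) = f $ 0"
    by (simp_all add: zcoord_def xcoord_def ycoord_def)
qed

lemma in_N_iff: "v \<in> V \<Longrightarrow> v \<in> N \<longleftrightarrow> zcoord v = 0"
  by (auto elim!: obtain_coords obtain_N)

end

context L2_normal
begin

lemma bracket_closed: "u \<in> V \<Longrightarrow> v \<in> V \<Longrightarrow> br u v \<in> V"
  using left_leibniz by (simp add: left_leibniz_algebra_def)

lemma br_add_left: "u \<in> V \<Longrightarrow> v \<in> V \<Longrightarrow> w \<in> V \<Longrightarrow> br (u + v) w = br u w + br v w"
  and br_add_right: "u \<in> V \<Longrightarrow> v \<in> V \<Longrightarrow> w \<in> V \<Longrightarrow> br w (u + v) = br w u + br w v"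
  using left_leibniz by (simp_all add: left_leibniz_algebra_def)

lemma bracket_N: "br (\<phi> 0 a b f) (\<phi> 0 a' b' f')
    = \<phi> 0 0 (a * f' $ 0) (fps_X * (fps_const a' * f - fps_const a * f'))"
  by (simp add: bracket)

lemma bracket_in_N: "u \<in> V \<Longrightarrow> v \<in> V \<Longrightarrow> br u v \<in> N"
  by (auto elim!: obtain_coords simp: bracket)

lemma ideal_N: "leibniz_ideal V br N"
  unfolding leibniz_ideal_def
proof (intro conjI ballI subspace_N)
  show "N \<subseteq> V" by (auto simp: N_def)
  then show "br u v \<in> N" "br v u \<in> N" if "u \<in> V" "v \<in> N" for u v
    using that bracket_in_N by auto
qed

lemma lower_central_N: "lower_central N br (Suc k) \<subseteq> W (Suc k)"
proof (induction k)
  case 0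
  show ?case
  proof (simp del: power_Suc, rule bracket_span_subset[OF subspace_W])
    fix u v assume "u \<in> N" "v \<in> N"
    then show "br u v \<in> W (Suc 0)"
      using W_mem[of _ 1] by (auto simp: N_def bracket_N)
  qed
next
  case (Suc k)
  show ?case
  proof (subst lower_central.simps, rule bracket_span_subset[OF subspace_W])
    fix u v assume "u \<in> lower_central N br (Suc k)" "v \<in> N"
    then have "u \<in> W (Suc k)" using Suc by blast
    then obtain b f where u: "u = \<phi> 0 0 b (fps_X ^ Suc k * f)" by (auto simp: W_def)
    obtain a' b' f' where v: "v = \<phi> 0 a' b' f'" using \<open>v \<in> N\<close> by (auto simp: N_def)
    have "br u v = \<phi> 0 0 0 (fps_X ^ Suc (Suc k) * (fps_const a' * f))"
      unfolding u v bracket_N by (simp add: algebra_simps)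
    then show "br u v \<in> W (Suc (Suc k))" by (simp only: W_mem)
  qed
qed

lemma nilpotent_N: "nilpotent_algebra N br"
proof -
  have "lower_central N br (Suc (Suc m)) \<subseteq> {0}"
  proof (subst lower_central.simps, rule bracket_span_subset)
    fix u v assume "u \<in> lower_central N br (Suc m)" "v \<in> N"
    then have "u \<in> W (Suc m)" using lower_central_N by blast
    then obtain b f where u: "u = \<phi> 0 0 b (fps_X ^ Suc m * f)" by (auto simp: W_def)
    obtain a' b' f' where v: "v = \<phi> 0 a' b' f'" using \<open>v \<in> N\<close> by (auto simp: N_def)
    have "br u v = \<phi> 0 0 0 (fps_X ^ m * (fps_const a' * fps_X ^ 2 * f))"
      unfolding u v bracket_N by (simp add: algebra_simps power2_eq_square)
    then show "br u v \<in> {0}" by (simp add: ker)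
  qed simp
  then have "lower_central N br (Suc (Suc m)) = {0}"
    using subspace_0[OF subspace_bracket_span] by auto
  then show ?thesis unfolding nilpotent_algebra_def by blast
qed

lemma solvable: "solvable_algebra V br"
proof -
  have 1: "derived_series V br 1 \<subseteq> N"
    using bracket_in_N by (simp add: bracket_span_subset subspace_N)
  have 2: "derived_series V br 2 \<subseteq> Y"
  proof (simp add: numeral_2_eq_2 del: One_nat_def, rule bracket_span_subset[OF subspace_Y])
    fix u v assume "u \<in> bracket_span br V V" "v \<in> bracket_span br V V"
    then have "u \<in> N" "v \<in> N" using 1 by auto
    then show "br u v \<in> Y" by (auto simp: N_def bracket_N)
  qed
  have "derived_series V br (Suc 2) \<subseteq> {0}"
  proof (subst derived_series.simps, rule bracket_span_subset)
    fix u v assume "u \<in> derived_series V br 2" "v \<in> derived_series V br 2"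
    then have "u \<in> Y" "v \<in> Y" using 2 by auto
    then show "br u v \<in> {0}" by (auto simp: Y_def bracket_N)
  qed simp
  then have "derived_series V br (Suc 2) = {0}"
    using subspace_0[OF subspace_bracket_span] unfolding derived_series.simps(2)[of V br 2] by blast
  then show ?thesis unfolding solvable_algebra_def by blast
qed

lemma zcoord_bracket [simp]: "u \<in> V \<Longrightarrow> v \<in> V \<Longrightarrow> zcoord (br u v) = 0"
  using bracket_in_N[of u v] bracket_closed by (simp add: in_N_iff)

end

text \<open>A linear functional on which left multiplication by z has weight -1. It lets one
  argument serve both types of normal forms: \<open>xcoord\<close> is taken for \<alpha> = -1, and
  \<open>ycoord\<close> for \<alpha> = 0 and \<kappa> = -1.\<close>

locale L2_weight = L2_normal +
  fixes \<theta> :: "'a \<Rightarrow> real" and w :: 'a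
  assumes \<theta>_add: "u \<in> V \<Longrightarrow> v \<in> V \<Longrightarrow> \<theta> (u + v) = \<theta> u + \<theta> v"
    and \<theta>_bracket: "u \<in> V \<Longrightarrow> v \<in> V \<Longrightarrow> \<theta> (br u v) = zcoord v * \<theta> u - zcoord u * \<theta> v"
    and w: "w \<in> V" "zcoord w = 0" "\<theta> w = 1"
    and \<theta>_z: "\<theta> (\<phi> 1 0 0 0) = 0"
begin

lemma \<theta>_zero: "\<theta> 0 = 0"
  using \<theta>_add[of 0 0] mem[of 0 0 0 0] by simp

text \<open>An ideal with a member t outside \<open>N\<close> contains [w, t], on which \<theta> is
  nonzero. Each further bracket with t multiplies \<theta> by \<open>zcoord t\<close>, so no term of
  the lower central series of the ideal is zero.\<close>

lemma nilpotent_ideal_subset: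
  assumes M: "leibniz_ideal V br M" "nilpotent_algebra M br"
  shows "M \<subseteq> N"
proof (rule ccontr)
  assume "\<not> M \<subseteq> N"
  moreover have MV: "M \<subseteq> V" using M by (simp add: leibniz_ideal_def)
  ultimately obtain t where t: "t \<in> M" "t \<in> V" "zcoord t \<noteq> 0"
    using in_N_iff by blast
  have "\<exists>v\<in>V. v \<in> lower_central M br k \<and> zcoord v = 0 \<and> \<theta> v \<noteq> 0" for k
  proof (induction k)
    case 0
    have "br w t \<in> M" using M t w by (simp add: leibniz_ideal_def)
    then show ?case using t w bracket_closed
      by (intro bexI[of _ "br w t"]) (auto simp: \<theta>_bracket)
  next
    case (Suc k)
    then obtain v where v: "v \<in> V" "v \<in> lower_central M br k" "zcoord v = 0" "\<theta> v \<noteq> 0" by blast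
    then have "br v t \<in> lower_central M br (Suc k)"
      using t by (simp add: bracket_in_span)
    then show ?case using t v bracket_closed
      by (intro bexI[of _ "br v t"]) (auto simp: \<theta>_bracket)
  qed
  moreover obtain k where "lower_central M br k = {0}"
    using M by (auto simp: nilpotent_algebra_def)
  ultimately show False using \<theta>_zero by (metis singletonD)
qed

lemma nilradical: "is_nilradical V br N"
proof -
  have "maximal_nilpotent_ideal V br N"
    unfolding maximal_nilpotent_ideal_def
    using ideal_N nilpotent_N nilpotent_ideal_subset by blast
  then show ?thesis
    unfolding is_nilradical_def maximal_nilpotent_ideal_def
    using nilpotent_ideal_subset by blast
qed

text \<open>On the quotient of \<open>V\<close> by the common kernel of \<open>zcoord\<close> and \<open>\<theta>\<close> the bracket is that of the
  nonabelian Lie algebra of dimension two, which is indecomposable.\<close>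

lemma direct_sum_kernel:
  assumes I: "leibniz_ideal V br I" and J: "leibniz_ideal V br J"
    and IJ: "I \<inter> J = {0}" and VIJ: "V = {x + y | x y. x \<in> I \<and> y \<in> J}"
  shows "(\<forall>j\<in>J. zcoord j = 0 \<and> \<theta> j = 0) \<and> (\<exists>i\<in>I. zcoord i = 1 \<and> \<theta> i = 0) \<and> (\<exists>i\<in>I. zcoord i = 0 \<and> \<theta> i = 1) \<or>
    (\<forall>i\<in>I. zcoord i = 0 \<and> \<theta> i = 0) \<and> (\<exists>j\<in>J. zcoord j = 1 \<and> \<theta> j = 0) \<and> (\<exists>j\<in>J. zcoord j = 0 \<and> \<theta> j = 1)"
proof -
  have IV: "I \<subseteq> V" and JV: "J \<subseteq> V" using I J by (auto simp: leibniz_ideal_def)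
  \<comment> \<open>Products of members of I and J lie in the intersection, so their \<theta> is
    zero: in the plane, images of I and of J are always parallel. As they jointly span the plane,
    one of the two images must be zero.\<close>
  have par: "zcoord j * \<theta> i = zcoord i * \<theta> j" if "i \<in> I" "j \<in> J" for i j
  proof -
    have "br i j \<in> I \<inter> J" using I J that IV JV by (auto simp: leibniz_ideal_def)
    then have "br i j = 0" using IJ by auto
    then show ?thesis using \<theta>_bracket[of i j] that IV JV \<theta>_zero by auto
  qed
  have zadd: "zcoord (u + v) = zcoord u + zcoord v" if "u \<in> V" "v \<in> V" for u v
    using that by (auto elim!: obtain_coords simp: add)
  have "\<phi> 1 0 0 0 \<in> V" by simp
  then obtain i1 j1 where 1: "i1 \<in> I" "j1 \<in> J" "\<phi> 1 0 0 0 = i1 + j1"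
    using VIJ by auto
  obtain i2 j2 where 2: "i2 \<in> I" "j2 \<in> J" "w = i2 + j2"
    using VIJ w by auto
  have e1: "zcoord i1 + zcoord j1 = 1" "\<theta> i1 + \<theta> j1 = 0"
    using zadd[of i1 j1] \<theta>_add[of i1 j1] 1(1,2) IV JV unfolding 1(3)[symmetric] \<theta>_z by auto
  have e2: "zcoord i2 + zcoord j2 = 0" "\<theta> i2 + \<theta> j2 = 1"
    using zadd[of i2 j2] \<theta>_add[of i2 j2] 2(1,2) w IV JV unfolding 2(3)[symmetric] by auto
  have a: "\<theta> i1 = 0" "\<theta> j1 = 0"
  proof -
    have "\<theta> j1 = - \<theta> i1" "zcoord j1 = 1 - zcoord i1" using e1 by linarith+
    moreover from this have "\<theta> i1 = 0"
      using par[OF 1(1,2)] by (simp add: left_diff_distrib)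
    ultimately show "\<theta> i1 = 0" "\<theta> j1 = 0" by simp_all
  qed
  have b: "zcoord i2 = 0" "zcoord j2 = 0"
  proof -
    have "\<theta> j2 = 1 - \<theta> i2" "zcoord j2 = - zcoord i2" using e2 by linarith+
    moreover from this have "zcoord i2 = 0"
      using par[OF 2(1,2)] by (simp add: right_diff_distrib)
    ultimately show "zcoord i2 = 0" "zcoord j2 = 0" by simp_all
  qed
  have c: "zcoord j1 * \<theta> i2 = 0" "zcoord i1 * \<theta> j2 = 0"
    using par[OF 2(1) 1(2)] par[OF 1(1) 2(2)] a b by simp_all
  show ?thesis
  proof (cases "zcoord j1 = 0")
    case True
    then have "zcoord i1 = 1" "\<theta> i2 = 1" using e1 e2 c by auto
    moreover from this have "\<forall>j\<in>J. zcoord j = 0 \<and> \<theta> j = 0"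
      using par[OF 1(1)] par[OF 2(1)] a b by auto
    ultimately show ?thesis using 1 2 a b by blast
  next
    case False
    then have "\<theta> j2 = 1" "zcoord j1 = 1" using e1 e2 c by auto
    moreover from this have "\<forall>i\<in>I. zcoord i = 0 \<and> \<theta> i = 0"
      using par[OF _ 1(2)] par[OF _ 2(2)] a b by auto
    ultimately show ?thesis using 1 2 a b by blast
  qed
qed

text \<open>The summands play symmetric roles, so it suffices to treat the case that J is the one in
  the common kernel of \<open>zcoord\<close> and \<theta>; I then contains preimages of both basis
  vectors of the plane.\<close>

lemma indecomposableI:
  assumes "\<And>I J. \<lbrakk>leibniz_ideal V br I; leibniz_ideal V br J; I \<inter> J = {0};
      V = {x + y | x y. x \<in> I \<and> y \<in> J}; \<And>j. j \<in> J \<Longrightarrow> zcoord j = 0 \<and> \<theta> j = 0;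
      \<exists>i\<in>I. zcoord i = 1 \<and> \<theta> i = 0; \<exists>i\<in>I. zcoord i = 0 \<and> \<theta> i = 1\<rbrakk> \<Longrightarrow> J \<subseteq> {0}"
  shows "indecomposable_algebra V br"
  unfolding indecomposable_algebra_def
proof (intro notI, elim exE conjE)
  fix I J assume H: "leibniz_ideal V br I" "leibniz_ideal V br J" "I \<noteq> {0}" "J \<noteq> {0}"
    "I \<inter> J = {0}" "V = {x + y | x y. x \<in> I \<and> y \<in> J}"
  have "{x + y | x y. x \<in> I \<and> y \<in> J} = {x + y | x y. x \<in> J \<and> y \<in> I}"
    by (metis (no_types, lifting) add.commute)
  then have H': "J \<inter> I = {0}" "V = {x + y | x y. x \<in> J \<and> y \<in> I}"
    using H(5,6) by blast+
  have "0 \<in> I" "0 \<in> J" using H by (auto simp: leibniz_ideal_def subspace_0)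
  moreover have "J \<subseteq> {0} \<or> I \<subseteq> {0}"
    using direct_sum_kernel[OF H(1,2,5,6)] assms[OF H(1,2,5,6)] assms[OF H(2,1) H'] by blast
  ultimately show False using H(3,4) by blast
qed

end

section \<open>The two types of normal forms\<close>

context L2_normal
begin

lemma bracket_x: "br (\<phi> 0 0 0 f) (\<phi> 0 1 0 0) = \<phi> 0 0 0 (fps_X * f)"
  by (simp add: bracket)

lemma bracket_xy: "br (\<phi> 0 1 0 0) (\<phi> 0 0 0 1) + br (\<phi> 0 0 0 1) (\<phi> 0 1 0 0) = \<phi> 0 0 1 0"
  by (simp add: bracket add)

text \<open>The multiples of t are brackets with x, and e_2 is the symmetrised product of x and the
  series 1.\<close>

lemma W_subset_bracket_span:
  assumes "\<And>f. \<phi> 0 0 0 f \<in> A" "\<phi> 0 1 0 0 \<in> A" "\<And>f. \<phi> 0 0 0 f \<in> C" "\<phi> 0 1 0 0 \<in> C"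
  shows "W 1 \<subseteq> bracket_span br A C"
proof
  fix v assume "v \<in> W 1"
  then obtain b f where "v = \<phi> 0 0 b (fps_X ^ 1 * f)" by (rule obtain_W)
  then have v: "v = \<phi> 0 0 b (fps_X * f)" by simp
  have "v = b *\<^sub>R (br (\<phi> 0 1 0 0) (\<phi> 0 0 0 1) + br (\<phi> 0 0 0 1) (\<phi> 0 1 0 0))
      + br (\<phi> 0 0 0 f) (\<phi> 0 1 0 0)"
    unfolding bracket_xy by (simp add: v bracket_x add scale)
  then show "v \<in> bracket_span br A C"
    using assms by (auto intro!: subspace_add subspace_scale subspace_bracket_span bracket_in_span)
qed

lemma derived_N: "bracket_span br N N = W 1"
proof
  show "bracket_span br N N \<subseteq> W 1"
    using W_mem[of _ 1] by (intro bracket_span_subset subspace_W) (auto elim!: obtain_N simp: bracket_N)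
  show "W 1 \<subseteq> bracket_span br N N" by (rule W_subset_bracket_span) auto
qed

lemma derived_Y: "A \<subseteq> Y \<Longrightarrow> bracket_span br A A = {0}"
proof
  show "A \<subseteq> Y \<Longrightarrow> bracket_span br A A \<subseteq> {0}"
  proof (intro bracket_span_subset)
    fix u v assume "A \<subseteq> Y" "u \<in> A" "v \<in> A"
    then have "u \<in> Y" "v \<in> Y" by auto
    then show "br u v \<in> {0}" by (auto elim!: obtain_Y simp: bracket_N)
  qed simp
qed (simp add: subspace_0 subspace_bracket_span)

lemma W_Y: "W k \<subseteq> Y"
  by (auto elim!: obtain_W)

end

locale L2_rank_one = L2_normal m V \<phi> br "-1" \<kappa> P Q B
  for m :: nat and V :: "'a::real_vector set" and \<phi> br \<kappa> P Q B
begin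

sublocale L2_weight m V \<phi> br "-1" \<kappa> P Q B xcoord "\<phi> 0 1 0 0"
  by unfold_locales (auto elim!: obtain_coords simp: add bracket)

text \<open>J lies in \<open>Y\<close>, where products vanish, and I and J annihilate each other, so
  every product in V is a product of I-components. Hence I contains \<open>W 1\<close>. On the other
  hand J is annihilated by a member of I with x-component 1, which forces its constant terms to
  vanish. So J lies in \<open>W 1\<close>, thus in I, and is zero.\<close>

lemma indecomposable: "indecomposable_algebra V br"
proof (rule indecomposableI)
  fix I J
  assume I: "leibniz_ideal V br I" and J: "leibniz_ideal V br J"
    and IJ: "I \<inter> J = {0}" and VIJ: "V = {x + y | x y. x \<in> I \<and> y \<in> J}"
    and zx: "\<And>j. j \<in> J \<Longrightarrow> zcoord j = 0 \<and> xcoord j = 0"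
    and "\<exists>i\<in>I. zcoord i = 0 \<and> xcoord i = 1"
  have IV: "I \<subseteq> V" and JV: "J \<subseteq> V" using I J by (auto simp: leibniz_ideal_def)
  have J_coords: "\<exists>b f. j = \<phi> 0 0 b f" if "j \<in> J" for j
    using zx[OF that] that JV obtain_coords[of j] by (metis subsetD xcoord zcoord)
  obtain i where "i \<in> I" "zcoord i = 0" "xcoord i = 1" using \<open>\<exists>i\<in>I. _\<close> by blast
  then obtain bi fi where i: "\<phi> 0 1 bi fi \<in> I"
    using IV obtain_coords[of i] by (metis subsetD xcoord zcoord)
  have zero: "br u v = 0" "br v u = 0" if "u \<in> I" "v \<in> J" for u v
  proof -
    have "u \<in> V" "v \<in> V" using that IV JV by auto
    then have "br u v \<in> I \<inter> J" "br v u \<in> I \<inter> J"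
      using I J that by (auto simp: leibniz_ideal_def)
    then show "br u v = 0" "br v u = 0" using IJ by auto
  qed
  have JJ: "br u v = 0" if "u \<in> J" "v \<in> J" for u v
    using J_coords[OF that(1)] J_coords[OF that(2)] by (auto simp: bracket_N)
  have VI: "br u v \<in> I" if uv: "u \<in> V" "v \<in> V" for u v
  proof -
    obtain u1 u2 v1 v2 where *: "u1 \<in> I" "u2 \<in> J" "u = u1 + u2" "v1 \<in> I" "v2 \<in> J" "v = v1 + v2"
      using uv VIJ by blast
    then have in_V: "u1 \<in> V" "u2 \<in> V" "v1 \<in> V" "v2 \<in> V" using IV JV by auto
    then have "br u v = br u1 v1"
      using * zero JJ subspace_add[OF subspace] by (simp add: br_add_left br_add_right)
    then show ?thesis using I * in_V by (auto simp: leibniz_ideal_def)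
  qed
  have WI: "W 1 \<subseteq> I"
  proof -
    have "W 1 \<subseteq> bracket_span br V V" by (rule W_subset_bracket_span) auto
    also have "\<dots> \<subseteq> I" using I VI by (intro bracket_span_subset) (auto simp: leibniz_ideal_def)
    finally show ?thesis .
  qed
  show "J \<subseteq> {0}"
  proof
    fix j assume j: "j \<in> J"
    obtain b f where jf: "j = \<phi> 0 0 b f" using J_coords[OF j] by blast
    have "\<phi> 0 0 0 (fps_X * f) = 0" using zero(2)[OF i j] by (simp add: jf bracket_N)
    then have "fps_X ^ m dvd fps_X * f" by (simp add: ker)
    then have "(fps_X * f) $ 1 = 0"
      using m2 unfolding fps_X_power_dvd_iff by (metis Suc_1 Suc_le_lessD)
    then have "f $ 0 = 0" by simp
    then have "j = \<phi> 0 0 b (fps_X ^ 1 * fps_shift 1 f)"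
      unfolding jf eq_nth_iff by simp
    then have "j \<in> W 1" by (simp only: W_mem)
    then show "j \<in> {0}" using WI IJ j by blast
  qed
qed

lemma z_bracket_x: "br (\<phi> 0 1 0 0) (\<phi> 1 0 0 0) = \<phi> 0 1 0 (- P)"
  by (simp add: bracket series_op_def)

text \<open>Right multiplication by z sends the series 1 to -\<kappa> - Q, so 1 is recovered by
  dividing by \<kappa>. The left factors need only range over \<open>N\<close>, which serves the
  lower central series as well as the derived one.\<close>

lemma N_subset_bracket_span:
  assumes "\<kappa> \<noteq> 0" "\<And>a b f. \<phi> 0 a b f \<in> A" "\<And>s a b f. \<phi> s a b f \<in> C"
  shows "N \<subseteq> bracket_span br A C"
proof
  let ?S = "bracket_span br A C"
  have sub: "subspace ?S" by (rule subspace_bracket_span)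
  have W: "W 1 \<subseteq> ?S" using assms by (intro W_subset_bracket_span) auto
  have series: "\<phi> 0 0 b f \<in> ?S" if "f $ 0 = 0" for b f
  proof -
    have "\<phi> 0 0 b f = \<phi> 0 0 b (fps_X ^ 1 * fps_shift 1 f)"
      using that unfolding eq_nth_iff by simp
    then show ?thesis using W W_mem[of b 1 "fps_shift 1 f"] by auto
  qed
  have x: "\<phi> 0 1 0 0 \<in> ?S"
  proof -
    have "\<phi> 0 1 0 0 = br (\<phi> 0 1 0 0) (\<phi> 1 0 0 0) + \<phi> 0 0 0 P"
      by (simp add: z_bracket_x add)
    then show ?thesis
      using sub assms series[of P 0] P0 by (metis bracket_in_span subspace_add)
  qed
  have y: "\<phi> 0 0 0 1 \<in> ?S"
  proof -
    have "\<phi> 0 0 0 1 = (1 / \<kappa>) *\<^sub>R (\<phi> 0 0 0 (- Q) - br (\<phi> 0 0 0 1) (\<phi> 1 0 0 0))"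
      using \<open>\<kappa> \<noteq> 0\<close> by (simp add: bracket diff scale series_op_def)
    moreover have "\<phi> 0 0 0 (- Q) \<in> ?S" using series[of "- Q" 0] Q0 by simp
    ultimately show ?thesis
      using sub assms by (metis bracket_in_span subspace_diff subspace_scale)
  qed
  fix v assume "v \<in> N"
  then obtain a b f where v: "v = \<phi> 0 a b f" by (rule obtain_N)
  have "v = a *\<^sub>R \<phi> 0 1 0 0 + (f $ 0) *\<^sub>R \<phi> 0 0 0 1 + \<phi> 0 0 b (f - fps_const (f $ 0))"
    by (simp add: v add scale)
  moreover have "\<phi> 0 0 b (f - fps_const (f $ 0)) \<in> ?S" using series by simp
  ultimately show "v \<in> ?S"
    using sub x y by (simp add: subspace_add subspace_scale)
qed

lemma bracket_span_VV: "\<kappa> \<noteq> 0 \<Longrightarrow> bracket_span br V V = N"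
  using N_subset_bracket_span[of V V] bracket_in_N
  by (intro equalityI bracket_span_subset subspace_N) auto

lemma bracket_span_NV: "\<kappa> \<noteq> 0 \<Longrightarrow> bracket_span br N V = N"
  using N_subset_bracket_span[of N V] bracket_in_N
  by (intro equalityI bracket_span_subset subspace_N) (auto elim!: obtain_N)

lemma derived_series_values:
  assumes "\<kappa> \<noteq> 0"
  shows "map (derived_series V br) [0..<4] = [V, N, W 1, {0}]"
  using assms by (simp add: upt_rec bracket_span_VV derived_N derived_Y W_Y)

lemma lower_central_values:
  assumes "\<kappa> \<noteq> 0" "1 \<le> k"
  shows "lower_central V br k = N"
  using assms(2)
proof (induction k rule: dec_induct)
  case base
  then show ?case using assms by (simp add: bracket_span_VV)
qed (use assms in \<open>simp add: bracket_span_NV\<close>)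

end

locale L2_rank_zero = L2_normal m V \<phi> br 0 "-1" P Q B
  for m :: nat and V :: "'a::real_vector set" and \<phi> br P Q B
begin

lemma B_eq_0: "B = 0" using B by auto

sublocale L2_weight m V \<phi> br 0 "-1" P Q B ycoord "\<phi> 0 0 0 1"
  by unfold_locales (use P0 Q0 in \<open>auto elim!: obtain_coords simp: add bracket series_op_nth B_eq_0\<close>)

text \<open>A member of I with constant term 1 annihilates J, which removes the x-components of J. A
  member of I with z-component 1 acts on what remains as -1 plus an operator raising the order in t,
  hence injectively.\<close>

lemma indecomposable: "indecomposable_algebra V br"
proof (rule indecomposableI)
  fix I J
  assume I: "leibniz_ideal V br I" and J: "leibniz_ideal V br J" and IJ: "I \<inter> J = {0}"
    and zy: "\<And>j. j \<in> J \<Longrightarrow> zcoord j = 0 \<and> ycoord j = 0"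
    and ex: "\<exists>i\<in>I. zcoord i = 1 \<and> ycoord i = 0" "\<exists>i\<in>I. zcoord i = 0 \<and> ycoord i = 1"
  have IV: "I \<subseteq> V" and JV: "J \<subseteq> V" using I J by (auto simp: leibniz_ideal_def)
  obtain a1 b1 f1 where i1: "\<phi> 1 a1 b1 f1 \<in> I"
    using ex(1) IV obtain_coords by (metis subsetD zcoord)
  obtain a2 b2 f2 where i2: "\<phi> 0 a2 b2 f2 \<in> I" "f2 $ 0 = 1"
    using ex(2) IV obtain_coords by (metis subsetD zcoord ycoord)
  have zero: "br u v = 0" "br v u = 0" if "u \<in> I" "v \<in> J" for u v
  proof -
    have "u \<in> V" "v \<in> V" using that IV JV by auto
    then have "br u v \<in> I \<inter> J" "br v u \<in> I \<inter> J"
      using I J that by (auto simp: leibniz_ideal_def)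
    then show "br u v = 0" "br v u = 0" using IJ by auto
  qed
  show "J \<subseteq> {0}"
  proof
    fix j assume j: "j \<in> J"
    then obtain a b f where jf: "j = \<phi> 0 a b f" "f $ 0 = 0"
      using zy[OF j] JV obtain_coords[of j] by (metis subsetD ycoord zcoord)
    have "\<forall>k<m. (fps_X * (fps_const a * f2 - fps_const a2 * f)) $ k = 0"
      using zero(1)[OF i2(1) j] unfolding jf bracket_N ker fps_X_power_dvd_iff by blast
    then have "(fps_X * (fps_const a * f2 - fps_const a2 * f)) $ 1 = 0"
      using m2 by (metis Suc_1 Suc_le_lessD)
    then have a: "a = 0" using i2 jf by simp
    have "br (\<phi> 1 a1 b1 f1) j = 0" by (rule zero(1)[OF i1 j])
    then have E: "b = 0" "\<forall>k<m. (series_op 0 (-1) Q f - fps_const a1 * (fps_X * f)) $ k = 0"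
      unfolding jf bracket a ker fps_X_power_dvd_iff by (auto simp: jf algebra_simps)
    have "f $ k = 0" if "k < m" for k
      using that
    proof (induction k rule: less_induct)
      case (less k)
      have "(Q * f) $ k = 0"
        unfolding fps_mult_nth
      proof (rule sum.neutral, rule ballI)
        fix i assume "i \<in> {0..k}"
        then show "Q $ i * f $ (k - i) = 0"
          using less Q0 by (cases "i = 0") auto
      qed
      moreover have "(fps_X * f) $ k = 0" using less by simp
      ultimately show ?case using E(2) less by (auto simp: series_op_nth)
    qed
    then show "j \<in> {0}" by (simp add: jf a E(1) ker fps_X_power_dvd_iff)
  qed
qed

text \<open>With only \<open>Y\<close> available on the left, e_2 cannot be the symmetrised product
  of x and 1. It comes instead from right multiplication by z, which adds \<kappa> times the
  coefficient of t to the e_2-component.\<close>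

lemma Y_subset_bracket_span:
  assumes "\<And>b f. \<phi> 0 0 b f \<in> A" "\<And>s a b f. \<phi> s a b f \<in> C"
  shows "Y \<subseteq> bracket_span br A C"
proof
  let ?S = "bracket_span br A C"
  have sub: "subspace ?S" by (rule subspace_bracket_span)
  have Xf: "\<phi> 0 0 0 f \<in> ?S" if "f $ 0 = 0" for f
  proof -
    have "\<phi> 0 0 0 f = br (\<phi> 0 0 0 (fps_shift 1 f)) (\<phi> 0 1 0 0)"
      using that unfolding bracket_x eq_nth_iff by simp
    then show ?thesis using assms by (simp add: bracket_in_span)
  qed
  have e2: "\<phi> 0 0 1 0 \<in> ?S"
  proof -
    have "\<phi> 0 0 1 0 = \<phi> 0 0 0 (fps_X - Q * fps_X) - br (\<phi> 0 0 0 fps_X) (\<phi> 1 0 0 0)"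
      by (simp add: bracket diff series_op_def flip: fps_const_neg)
    moreover have "\<phi> 0 0 0 (fps_X - Q * fps_X) \<in> ?S" by (rule Xf) simp
    ultimately show ?thesis using sub assms by (metis bracket_in_span subspace_diff)
  qed
  have y: "\<phi> 0 0 0 1 \<in> ?S"
  proof -
    have "\<phi> 0 0 0 1 = \<phi> 0 0 0 Q + br (\<phi> 0 0 0 1) (\<phi> 1 0 0 0)"
      by (simp add: bracket add series_op_def flip: fps_const_neg)
    moreover have "\<phi> 0 0 0 Q \<in> ?S" by (rule Xf) (rule Q0)
    ultimately show ?thesis using sub assms by (metis bracket_in_span subspace_add)
  qed
  fix v assume "v \<in> Y"
  then obtain b f where v: "v = \<phi> 0 0 b f" by (rule obtain_Y)
  have "v = b *\<^sub>R \<phi> 0 0 1 0 + (f $ 0) *\<^sub>R \<phi> 0 0 0 1 + \<phi> 0 0 0 (f - fps_const (f $ 0))"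
    by (simp add: v add scale)
  moreover have "\<phi> 0 0 0 (f - fps_const (f $ 0)) \<in> ?S" using Xf by simp
  ultimately show "v \<in> ?S"
    using sub e2 y by (simp add: subspace_add subspace_scale)
qed

lemma bracket_in_Y: "u \<in> V \<Longrightarrow> v \<in> V \<Longrightarrow> br u v \<in> Y"
  by (auto elim!: obtain_coords simp: bracket)

lemma bracket_span_VV: "bracket_span br V V = Y"
  using Y_subset_bracket_span[of V V] bracket_in_Y
  by (intro equalityI bracket_span_subset subspace_Y) auto

lemma bracket_span_YV: "bracket_span br Y V = Y"
  using Y_subset_bracket_span[of Y V] bracket_in_Y
  by (intro equalityI bracket_span_subset subspace_Y) (auto elim!: obtain_Y)

lemma derived_series_values: "map (derived_series V br) [0..<3] = [V, Y, {0}]"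
  by (simp add: upt_rec bracket_span_VV derived_Y)

lemma lower_central_values:
  assumes "1 \<le> k"
  shows "lower_central V br k = Y"
  using assms
  by (induction k rule: dec_induct) (simp_all add: bracket_span_VV bracket_span_YV)

end

section \<open>The multiplication tables in series coordinates\<close>

lemma lookup_scaleR [simp]: "Poly_Mapping.lookup (c *\<^sub>R v) i = c * Poly_Mapping.lookup v i"
  for v :: "'i \<Rightarrow>\<^sub>0 real"
proof -
  have "finite {i. c *\<^sub>R Poly_Mapping.lookup v i \<noteq> 0}"
    by (rule finite_subset[OF _ finite_lookup[of v]]) auto
  then show ?thesis by (simp add: scaleR_poly_mapping_def Abs_poly_mapping_inverse)
qed

lemma lookup_ev: "Poly_Mapping.lookup (ev i) j = (if i = j then 1 else 0)"
  by (simp add: ev_def lookup_single)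

lemma ev_expansion:
  assumes "finite S" "\<And>i. i \<notin> S \<Longrightarrow> Poly_Mapping.lookup v i = 0"
  shows "v = (\<Sum>i\<in>S. Poly_Mapping.lookup v i *\<^sub>R ev i)"
  by (rule poly_mapping_eqI) (use assms in \<open>auto simp: lookup_sum lookup_ev if_distrib sum.delta cong: if_cong\<close>)

lemma span_ev:
  assumes "finite S"
  shows "span (ev ` S) = {v. \<forall>i. i \<notin> S \<longrightarrow> Poly_Mapping.lookup v i = 0}" (is "_ = ?R")
proof
  have "subspace ?R" by (auto simp: subspace_def lookup_add)
  moreover have "ev ` S \<subseteq> ?R" by (auto simp: lookup_ev)
  ultimately show "span (ev ` S) \<subseteq> ?R" by (simp add: span_minimal)
  show "?R \<subseteq> span (ev ` S)"
  proof
    fix v assume "v \<in> ?R"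
    then have "v = (\<Sum>i\<in>S. Poly_Mapping.lookup v i *\<^sub>R ev i)"
      using assms by (intro ev_expansion) auto
    then show "v \<in> span (ev ` S)"
      by (metis (no_types, lifting) image_eqI span_base span_scale span_sum)
  qed
qed

lemma inj_ev: "inj_on ev S"
  by (rule inj_onI) (metis lookup_ev zero_neq_one)

lemma dim_ev:
  assumes "finite S"
  shows "dim (ev ` S) = card S"
proof -
  have "independent (ev ` S)"
  proof (rule independent_if_scalars_zero)
    show "finite (ev ` S)" using assms by simp
    fix c x assume 0: "(\<Sum>x\<in>ev ` S. c x *\<^sub>R x) = 0" and "x \<in> ev ` S"
    then obtain i where i: "x = ev i" "i \<in> S" by auto
    have "Poly_Mapping.lookup (\<Sum>j\<in>S. c (ev j) *\<^sub>R ev j) i = 0"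
      using 0 by (simp add: sum.reindex inj_ev)
    then show "c x = 0" using i assms
      by (simp add: lookup_sum lookup_ev if_distrib cong: if_cong)
  qed
  then show ?thesis
    by (simp add: dim_eq_card_independent card_image inj_ev)
qed

lemma mem_coord_space: "v \<in> coord_space k \<longleftrightarrow> (\<forall>i. i \<notin> {1..k} \<longrightarrow> Poly_Mapping.lookup v i = 0)"
  unfolding coord_space_def by (simp add: span_ev)

section \<open>Series coordinates on the span of e_1, ..., e_(n+1)\<close>

definition coord_vec :: "nat \<Rightarrow> real \<Rightarrow> real \<Rightarrow> real \<Rightarrow> real fps \<Rightarrow> (nat \<Rightarrow>\<^sub>0 real)" where
  "coord_vec n s a b f =
     s *\<^sub>R ev (n + 1) + a *\<^sub>R (ev 1 - ev 3) + b *\<^sub>R ev 2 + (\<Sum>k<n - 2. (f $ k) *\<^sub>R ev (k + 3))"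

lemma lookup_coord_vec:
  assumes "4 \<le> n"
  shows "Poly_Mapping.lookup (coord_vec n s a b f) i =
    (if i = 0 then 0 else if i = 1 then a else if i = 2 then b else if i = 3 then f $ 0 - a
     else if i \<le> n then f $ (i - 3) else if i = n + 1 then s else 0)"
proof -
  have "(\<Sum>k<n - 2. (f $ k) * (if k + 3 = i then 1 else 0)) = (if 3 \<le> i \<and> i \<le> n then f $ (i - 3) else 0)"
  proof (cases "3 \<le> i")
    case True
    then have "k + 3 = i \<longleftrightarrow> k = i - 3" for k by auto
    with True assms show ?thesis by (auto simp: if_distrib cong: if_cong)
  qed auto
  then show ?thesis
    using assms
    by (auto simp: coord_vec_def lookup_add lookup_minus lookup_sum lookup_ev)
qed

lemma coords_coord_vec:
  assumes "4 \<le> n"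
  shows "coords (n - 2) (coord_space (n + 1)) (coord_vec n)"
proof
  note lk = lookup_coord_vec[OF assms]
  show "coord_space (n + 1) = {coord_vec n s a b f | s a b f. True}" (is "_ = ?R")
  proof
    show "?R \<subseteq> coord_space (n + 1)" using assms by (auto simp: mem_coord_space lk)
    show "coord_space (n + 1) \<subseteq> ?R"
    proof
      fix v assume v: "v \<in> coord_space (n + 1)"
      let ?l = "Poly_Mapping.lookup v"
      have "v = coord_vec n (?l (n + 1)) (?l 1) (?l 2) (Abs_fps (\<lambda>k. if k = 0 then ?l 3 + ?l 1 else ?l (k + 3)))"
        using v by (intro poly_mapping_eqI) (auto simp: mem_coord_space lk)
      then show "v \<in> ?R" by blast
    qed
  qed
  fix s a b f s' a' b' f' c
  show "coord_vec n s a b f + coord_vec n s' a' b' f' = coord_vec n (s + s') (a + a') (b + b') (f + f')"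
    by (rule poly_mapping_eqI) (auto simp: lookup_add lk)
  show "c *\<^sub>R coord_vec n s a b f = coord_vec n (c * s) (c * a) (c * b) (fps_const c * f)"
    by (rule poly_mapping_eqI) (auto simp: lk algebra_simps)
  show "coord_vec n s a b f = 0 \<longleftrightarrow> s = 0 \<and> a = 0 \<and> b = 0 \<and> fps_X ^ (n - 2) dvd f"
  proof
    assume "coord_vec n s a b f = 0"
    then have 0: "Poly_Mapping.lookup (coord_vec n s a b f) i = 0" for i by simp
    have 1: "s = 0" "a = 0" "b = 0" using 0[of "n + 1"] 0[of 1] 0[of 2] assms by (auto simp: lk)
    moreover have "f $ k = 0" if "k < n - 2" for k
      using 0[of "k + 3"] that 1 assms by (auto simp: lk split: if_splits)
    ultimately show "s = 0 \<and> a = 0 \<and> b = 0 \<and> fps_X ^ (n - 2) dvd f"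
      by (simp add: fps_X_power_dvd_iff)
  next
    assume "s = 0 \<and> a = 0 \<and> b = 0 \<and> fps_X ^ (n - 2) dvd f"
    then show "coord_vec n s a b f = 0"
      using assms by (intro poly_mapping_eqI) (auto simp: lk fps_X_power_dvd_iff)
  qed
  show "2 \<le> n - 2" using assms by simp
qed

text \<open>The truncated representative of the series coordinate. Since e_1 = x + e_3, the
  coefficient of e_1 is added to the constant term.\<close>

definition coord_series :: "nat \<Rightarrow> (nat \<Rightarrow>\<^sub>0 real) \<Rightarrow> real fps" where
  "coord_series n v = Abs_fps (\<lambda>k. if n - 2 \<le> k then 0
     else if k = 0 then Poly_Mapping.lookup v 3 + Poly_Mapping.lookup v 1
     else Poly_Mapping.lookup v (k + 3))"

lemma coord_series_add: "coord_series n (u + v) = coord_series n u + coord_series n v"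
  by (rule fps_ext) (simp add: coord_series_def lookup_add)

lemma coord_series_scale: "coord_series n (c *\<^sub>R u) = fps_const c * coord_series n u"
  by (rule fps_ext) (simp add: coord_series_def algebra_simps)

lemma coord_series_ev:
  assumes "4 \<le> n"
  shows "coord_series n (ev i) = (if i = 1 then 1 else if 3 \<le> i \<and> i \<le> n then fps_X ^ (i - 3) else 0)"
  by (rule fps_ext) (use assms in \<open>auto simp: coord_series_def lookup_ev\<close>)

lemma coord_series_coord_vec:
  assumes "4 \<le> n"
  shows "coord_series n (coord_vec n s a b f) = fps_cutoff (n - 2) f"
  by (rule fps_ext) (use assms in \<open>auto simp: coord_series_def lookup_coord_vec\<close>)

text \<open>The bracket of \<open>L2_normal\<close> as a bilinear function of vectors instead of
  coordinates, so that comparing it with a multiplication table reduces to basis vectors.\<close>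

definition normal_bracket :: "nat \<Rightarrow> real \<Rightarrow> real \<Rightarrow> real fps \<Rightarrow> real fps \<Rightarrow> real \<Rightarrow>
    (nat \<Rightarrow>\<^sub>0 real) \<Rightarrow> (nat \<Rightarrow>\<^sub>0 real) \<Rightarrow> (nat \<Rightarrow>\<^sub>0 real)" where
  "normal_bracket n \<alpha> \<kappa> P Q B u v =
    (let s = Poly_Mapping.lookup u (n + 1); a = Poly_Mapping.lookup u 1; f = coord_series n u;
       s' = Poly_Mapping.lookup v (n + 1); a' = Poly_Mapping.lookup v 1;
       b' = Poly_Mapping.lookup v 2; f' = coord_series n v in
     coord_vec n 0 (\<alpha> * (s * a' - s' * a))
        (a * f' $ 0 + s * ((\<alpha> + \<kappa>) * b') + s' * (\<kappa> * f $ 1))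
        (fps_X * (fps_const a' * f - fps_const a * f')
          + fps_const s * (series_op \<alpha> \<kappa> Q f' + fps_const a' * P)
          - fps_const s' * (series_op \<alpha> \<kappa> Q f + fps_const a * P)
          + fps_const (s * s' * B) * fps_X ^ (n - 3)))"

context
  fixes n :: nat and \<alpha> \<kappa> B :: real and P Q :: "real fps"
  assumes n: "4 \<le> n"
begin

interpretation coords "n - 2" "coord_space (n + 1)" "coord_vec n"
  by (rule coords_coord_vec[OF n])

abbreviation "nb \<equiv> normal_bracket n \<alpha> \<kappa> P Q B"

lemma normal_bracket_add_left: "nb (u + v) w = nb u w + nb v w"
  unfolding normal_bracket_def Let_def add
  by (rule arg_cong4[where f = "coord_vec n"])
    (simp_all add: lookup_add coord_series_add series_op_add algebra_simps flip: fps_const_add fps_const_mult)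

lemma normal_bracket_add_right: "nb w (u + v) = nb w u + nb w v"
  unfolding normal_bracket_def Let_def add
  by (rule arg_cong4[where f = "coord_vec n"])
    (simp_all add: lookup_add coord_series_add series_op_add algebra_simps flip: fps_const_add fps_const_mult)

lemma normal_bracket_scale_left: "nb (c *\<^sub>R u) w = c *\<^sub>R nb u w"
  unfolding normal_bracket_def Let_def scale
  by (rule arg_cong4[where f = "coord_vec n"])
    (simp_all add: coord_series_scale series_op_scale algebra_simps flip: fps_const_mult)

lemma normal_bracket_scale_right: "nb w (c *\<^sub>R u) = c *\<^sub>R nb w u"
  unfolding normal_bracket_def Let_def scale
  by (rule arg_cong4[where f = "coord_vec n"])
    (simp_all add: coord_series_scale series_op_scale algebra_simps flip: fps_const_mult)

lemma normal_bracket_sum_left: "nb (sum g S) w = (\<Sum>i\<in>S. nb (g i) w)"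
  by (induction S rule: infinite_finite_induct)
    (use normal_bracket_scale_left[of 0] in \<open>simp_all add: normal_bracket_add_left\<close>)

lemma normal_bracket_sum_right: "nb w (sum g S) = (\<Sum>i\<in>S. nb w (g i))"
  by (induction S rule: infinite_finite_induct)
    (use normal_bracket_scale_right[of _ 0] in \<open>simp_all add: normal_bracket_add_right\<close>)

lemma table_bracket_eq_normal_bracket:
  assumes T: "\<And>i j. i \<in> {1..n + 1} \<Longrightarrow> j \<in> {1..n + 1} \<Longrightarrow> nb (ev i) (ev j) = T i j"
    and uv: "u \<in> coord_space (n + 1)" "v \<in> coord_space (n + 1)"
  shows "table_bracket (n + 1) T u v = nb u v"
proof -
  have "nb u v = nb (\<Sum>i\<in>{1..n + 1}. Poly_Mapping.lookup u i *\<^sub>R ev i)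
      (\<Sum>j\<in>{1..n + 1}. Poly_Mapping.lookup v j *\<^sub>R ev j)"
    using uv by (subst (1 2) ev_expansion[of "{1..n + 1}"]) (auto simp: mem_coord_space)
  also have "\<dots> = (\<Sum>i\<in>{1..n + 1}. \<Sum>j\<in>{1..n + 1}.
      (Poly_Mapping.lookup u i * Poly_Mapping.lookup v j) *\<^sub>R nb (ev i) (ev j))"
    by (simp only: normal_bracket_sum_left normal_bracket_scale_left)
      (simp only: normal_bracket_sum_right normal_bracket_scale_right scaleR_sum_right scaleR_scaleR)
  finally show ?thesis by (simp add: table_bracket_def T)
qed

lemma L2_normal_table_bracket:
  assumes T: "\<And>i j. i \<in> {1..n + 1} \<Longrightarrow> j \<in> {1..n + 1} \<Longrightarrow> nb (ev i) (ev j) = T i j"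
    and PQ: "P $ 0 = 0" "P $ 1 = 0" "Q $ 0 = 0" "Q $ 1 = 0"
    and B: "B \<noteq> 0 \<Longrightarrow> 5 \<le> n \<and> \<kappa> + \<alpha> * (real n - 3) = 0"
  shows "L2_normal (n - 2) (coord_space (n + 1)) (coord_vec n) (table_bracket (n + 1) T) \<alpha> \<kappa> P Q B"
proof unfold_locales
  fix s a b f s' a' b' f'
  have e: "n - 2 - 1 = n - 3" by simp
  have cut: "(Q * fps_cutoff (n - 2) f) $ k = (Q * f) $ k" if "k < n - 2" for k f
    using that by (rule fps_cutoff_right_mult_nth)
  have "table_bracket (n + 1) T (coord_vec n s a b f) (coord_vec n s' a' b' f')
      = nb (coord_vec n s a b f) (coord_vec n s' a' b' f')"
    by (rule table_bracket_eq_normal_bracket[OF T mem mem])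
  then show "table_bracket (n + 1) T (coord_vec n s a b f) (coord_vec n s' a' b' f') =
      coord_vec n 0 (\<alpha> * (s * a' - s' * a))
        (a * f' $ 0 + s * (0 * a' + (\<alpha> + \<kappa>) * b' + 0 * f' $ 0)
          + s' * ((0 - 0) * a + (0 - 0) * f $ 0 + \<kappa> * f $ 1) + s * s' * 0)
        (fps_X * (fps_const a' * f - fps_const a * f')
          + fps_const s * (series_op \<alpha> \<kappa> Q f' + fps_const a' * P)
          - fps_const s' * (series_op \<alpha> \<kappa> Q f + fps_const a * P)
          + fps_const (s * s' * B) * fps_X ^ (n - 2 - 1))"
    using n unfolding normal_bracket_def Let_def
    by (auto simp: eq_nth_iff coord_series_coord_vec lookup_coord_vec series_op_nth cut e)
qed (use PQ B n in \<open>auto simp: of_nat_diff\<close>)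

end

section \<open>Brackets of basis vectors\<close>

context
  fixes n :: nat and \<alpha> \<kappa> B :: real and P Q :: "real fps"
  assumes n: "4 \<le> n"
begin

lemma normal_bracket_ev_L2:
  assumes "i \<in> {1..n}" "j \<in> {1..n}"
  shows "normal_bracket n \<alpha> \<kappa> P Q B (ev i) (ev j) = L2_table n i j"
proof -
  have "normal_bracket n \<alpha> \<kappa> P Q B (ev i) (ev j) =
    coord_vec n 0 0 (if i = 1 \<and> (j = 1 \<or> j = 3) then 1 else 0)
      (fps_X * ((if j = 1 then coord_series n (ev i) else 0) - (if i = 1 then coord_series n (ev j) else 0)))"
    using assms n by (auto simp: normal_bracket_def Let_def lookup_ev coord_series_ev)
  also have "\<dots> = L2_table n i j"
  proof -
    interpret coords "n - 2" "coord_space (n + 1)" "coord_vec n"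
      by (rule coords_coord_vec[OF n])
    have e2: "coord_vec n 0 0 1 0 = ev 2" by (simp add: coord_vec_def)
    have X: "coord_vec n 0 0 0 (fps_X * fps_X ^ k) = (if k + 4 \<le> n then ev (k + 4) else 0)" for k
      using n by (intro poly_mapping_eqI) (auto simp: lookup_coord_vec lookup_ev)
    have X1: "coord_vec n 0 0 1 (- (fps_X * fps_X ^ k)) = ev 2 - (if k + 4 \<le> n then ev (k + 4) else 0)" for k
      by (simp add: diff flip: e2 X)
    have X0: "coord_vec n 0 0 0 (- (fps_X * fps_X ^ k)) = - (if k + 4 \<le> n then ev (k + 4) else 0)" for k
      by (simp only: uminus minus_zero flip: X)
    have index: "k = 1 \<or> k = 2 \<or> (\<exists>l. k = l + 3)" if "k \<in> {1..n}" for k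
      using that by (cases "3 \<le> k") (auto intro!: exI[of _ "k - 3"])
    show ?thesis
      using index[OF assms(1)] index[OF assms(2)] n assms
      by (elim disjE exE) (simp_all add: L2_table_def coord_series_ev e2 X X1 X0 X1[of 0, simplified] add.commute, auto)
  qed
  finally show ?thesis .
qed

text \<open>The entry for i = 1 mixes the actions on x and on the series 1 because e_1 = x + e_3.
  The entry for i = 4 belongs to the series t, the only monomial that right multiplication by z
  sends partly to e_2.\<close>

lemma normal_bracket_ev_right:
  assumes "i \<in> {1..n}"
  shows "normal_bracket n \<alpha> \<kappa> P Q B (ev i) (ev (n + 1)) =
    (if i = 1 then coord_vec n 0 (- \<alpha>) 0 (- (fps_const \<kappa> + Q + P))
     else if i = 2 then coord_vec n 0 0 0 0
     else coord_vec n 0 0 (if i = 4 then \<kappa> else 0)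
       (- (fps_const (\<kappa> + \<alpha> * real (i - 3)) * fps_X ^ (i - 3) + Q * fps_X ^ (i - 3))))"
  using assms n
  by (auto simp: normal_bracket_def Let_def lookup_ev coord_series_ev series_op_X_power)
    (auto simp: series_op_def)

lemma normal_bracket_ev_left:
  assumes "i \<in> {1..n}"
  shows "normal_bracket n \<alpha> \<kappa> P Q B (ev (n + 1)) (ev i) =
    (if i = 1 then coord_vec n 0 \<alpha> 0 (fps_const \<kappa> + Q + P)
     else if i = 2 then coord_vec n 0 0 (\<alpha> + \<kappa>) 0
     else coord_vec n 0 0 0
       (fps_const (\<kappa> + \<alpha> * real (i - 3)) * fps_X ^ (i - 3) + Q * fps_X ^ (i - 3)))"
  using assms n
  by (auto simp: normal_bracket_def Let_def lookup_ev coord_series_ev series_op_X_power)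
    (auto simp: series_op_def)

lemma normal_bracket_ev_last:
  shows "normal_bracket n \<alpha> \<kappa> P Q B (ev (n + 1)) (ev (n + 1)) = coord_vec n 0 0 0 (fps_const B * fps_X ^ (n - 3))"
  using n by (auto simp: normal_bracket_def Let_def lookup_ev coord_series_ev series_op_def)

end

lemma lookup_sum_ev:
  "Poly_Mapping.lookup (\<Sum>k\<in>{l..n}. c k *\<^sub>R ev k) i = (if l \<le> i \<and> i \<le> n then c i else 0)"
  by (simp add: lookup_sum lookup_ev if_distrib cong: if_cong)

text \<open>Only the row and the column of e_(n+1) differ between the families. The index k + 3
  makes the basis vector the monomial t^k.\<close>

lemma L2_normal_tableI:
  assumes n: "4 \<le> n"
    and PQ: "P $ 0 = 0" "P $ 1 = 0" "Q $ 0 = 0" "Q $ 1 = 0"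
    and B: "B \<noteq> 0 \<Longrightarrow> 5 \<le> n \<and> \<kappa> + \<alpha> * (real n - 3) = 0"
    and L2: "\<And>i j. i \<le> n \<Longrightarrow> j \<le> n \<Longrightarrow> T i j = L2_table n i j"
    and right: "T 1 (n + 1) = coord_vec n 0 (- \<alpha>) 0 (- (fps_const \<kappa> + Q + P))"
      "T 2 (n + 1) = 0"
      "\<And>k. k + 3 \<le> n \<Longrightarrow> T (k + 3) (n + 1) = coord_vec n 0 0 (if k = 1 then \<kappa> else 0)
        (- (fps_const (\<kappa> + \<alpha> * real k) * fps_X ^ k + Q * fps_X ^ k))"
    and left: "T (n + 1) 1 = coord_vec n 0 \<alpha> 0 (fps_const \<kappa> + Q + P)"
      "T (n + 1) 2 = (\<alpha> + \<kappa>) *\<^sub>R ev 2"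
      "\<And>k. k + 3 \<le> n \<Longrightarrow> T (n + 1) (k + 3) = coord_vec n 0 0 0
        (fps_const (\<kappa> + \<alpha> * real k) * fps_X ^ k + Q * fps_X ^ k)"
    and last: "T (n + 1) (n + 1) = B *\<^sub>R ev n"
  shows "L2_normal (n - 2) (coord_space (n + 1)) (coord_vec n) (table_bracket (n + 1) T) \<alpha> \<kappa> P Q B"
proof (rule L2_normal_table_bracket[OF n _ PQ B])
  interpret coords "n - 2" "coord_space (n + 1)" "coord_vec n"
    by (rule coords_coord_vec[OF n])
  fix i j assume ij: "i \<in> {1..n + 1}" "j \<in> {1..n + 1}"
  have e2: "coord_vec n 0 0 c 0 = c *\<^sub>R ev 2" for c
    by (simp add: coord_vec_def)
  have en: "coord_vec n 0 0 0 (fps_const B * fps_X ^ (n - 3)) = B *\<^sub>R ev n"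
    using n by (intro poly_mapping_eqI) (auto simp: lookup_coord_vec lookup_ev)
  have index: "k = 1 \<or> k = 2 \<or> (\<exists>l. k = l + 3 \<and> l + 3 \<le> n)" if "k \<in> {1..n}" for k
    using that by (cases "3 \<le> k") (auto intro!: exI[of _ "k - 3"])
  have R: "normal_bracket n \<alpha> \<kappa> P Q B (ev k) (ev (n + 1)) = T k (n + 1)" if "k \<in> {1..n}" for k
    using index[OF that] that right by (auto simp only: normal_bracket_ev_right[OF n that]) auto
  have L: "normal_bracket n \<alpha> \<kappa> P Q B (ev (n + 1)) (ev k) = T (n + 1) k" if "k \<in> {1..n}" for k
    using index[OF that] that left by (auto simp only: normal_bracket_ev_left[OF n that] e2) auto
  consider "i \<in> {1..n}" "j \<in> {1..n}" | "i \<in> {1..n}" "j = n + 1"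
    | "i = n + 1" "j \<in> {1..n}" | "i = n + 1" "j = n + 1"
    using ij by fastforce
  then show "normal_bracket n \<alpha> \<kappa> P Q B (ev i) (ev j) = T i j"
    by cases (simp_all only: normal_bracket_ev_L2[OF n] L2 R L
        normal_bracket_ev_last[OF n] en last atLeastAtMost_iff)
qed

section \<open>The four families in normal form\<close>

lemma L2_normal_ext1:
  assumes n: "4 \<le> n"
  shows "L2_normal (n - 2) (coord_space (n + 1)) (coord_vec n) (ext1_bracket n a)
    (- 1) (1 - a) 0 0 0"
  unfolding ext1_bracket_def
proof (rule L2_normal_tableI)
  note entry = lookup_coord_vec lookup_add lookup_minus lookup_ev ext1_table_def
  show "4 \<le> n" using n by simp
  show "ext1_table n a 1 (n + 1) = coord_vec n 0 (- (- 1)) 0 (- (fps_const (1 - a) + 0 + 0))"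
    "ext1_table n a (n + 1) 1 = coord_vec n 0 (- 1) 0 (fps_const (1 - a) + 0 + 0)"
    using n by (intro poly_mapping_eqI; auto simp: entry)+
  fix k assume k: "k + 3 \<le> n"
  have "k = 0 \<or> k = 1 \<or> 2 \<le> k" by linarith
  then show "ext1_table n a (k + 3) (n + 1) = coord_vec n 0 0 (if k = 1 then (1 - a) else 0)
        (- (fps_const ((1 - a) + (- 1) * real k) * fps_X ^ k + 0 * fps_X ^ k))"
    using n k by (elim disjE; intro poly_mapping_eqI; auto simp: entry)
  from \<open>k = 0 \<or> k = 1 \<or> 2 \<le> k\<close>
  show "ext1_table n a (n + 1) (k + 3) = coord_vec n 0 0 0
        (fps_const ((1 - a) + (- 1) * real k) * fps_X ^ k + 0 * fps_X ^ k)"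
    using n k by (elim disjE; intro poly_mapping_eqI; auto simp: entry)
qed (use n in \<open>auto simp: ext1_table_def\<close>)

text \<open>At \<kappa> = 1 the element e_2 has weight \<alpha> + \<kappa> = 0 under z. The term P =
  -\<delta> t^2 is what becomes of an e_2-component of [z, z] once z is translated by a multiple of
  t.\<close>

lemma L2_normal_ext2:
  assumes n: "5 \<le> n"
  shows "L2_normal (n - 2) (coord_space (n + 1)) (coord_vec n) (ext2_bracket n \<delta>)
    (- 1) 1 (- (fps_const \<delta> * fps_X ^ 2)) 0 0"
  unfolding ext2_bracket_def
proof (rule L2_normal_tableI)
  note entry = lookup_coord_vec lookup_add lookup_minus lookup_ev ext2_table_def
  show "4 \<le> n" using n by simp
  show "ext2_table n \<delta> 1 (n + 1) = coord_vec n 0 (- (- 1)) 0 (- (fps_const 1 + 0 + (- (fps_const \<delta> * fps_X ^ 2))))"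
    "ext2_table n \<delta> (n + 1) 1 = coord_vec n 0 (- 1) 0 (fps_const 1 + 0 + (- (fps_const \<delta> * fps_X ^ 2)))"
    using n by (intro poly_mapping_eqI; auto simp: entry)+
  fix k assume k: "k + 3 \<le> n"
  have "k = 0 \<or> k = 1 \<or> 2 \<le> k" by linarith
  then show "ext2_table n \<delta> (k + 3) (n + 1) = coord_vec n 0 0 (if k = 1 then 1 else 0)
        (- (fps_const (1 + (- 1) * real k) * fps_X ^ k + 0 * fps_X ^ k))"
    using n k by (elim disjE; intro poly_mapping_eqI; auto simp: entry)
  from \<open>k = 0 \<or> k = 1 \<or> 2 \<le> k\<close>
  show "ext2_table n \<delta> (n + 1) (k + 3) = coord_vec n 0 0 0
        (fps_const (1 + (- 1) * real k) * fps_X ^ k + 0 * fps_X ^ k)"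
    using n k by (elim disjE; intro poly_mapping_eqI; auto simp: entry)
qed (use n in \<open>auto simp: ext2_table_def\<close>)

text \<open>\<kappa> = n - 3 is the value at which t^(n-3), that is e_n, has weight zero under z, so
  that [z, z] may be a multiple of it.\<close>

lemma L2_normal_ext3:
  assumes n: "5 \<le> n"
  shows "L2_normal (n - 2) (coord_space (n + 1)) (coord_vec n) (ext3_bracket n \<delta>)
    (- 1) (real n - 3) 0 0 \<delta>"
  unfolding ext3_bracket_def
proof (rule L2_normal_tableI)
  note entry = lookup_coord_vec lookup_add lookup_minus lookup_ev ext3_table_def
  show "4 \<le> n" using n by simp
  show "ext3_table n \<delta> 1 (n + 1) = coord_vec n 0 (- (- 1)) 0 (- (fps_const (real n - 3) + 0 + 0))"
    "ext3_table n \<delta> (n + 1) 1 = coord_vec n 0 (- 1) 0 (fps_const (real n - 3) + 0 + 0)"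
    using n by (intro poly_mapping_eqI; auto simp: entry)+
  fix k assume k: "k + 3 \<le> n"
  have "k = 0 \<or> k = 1 \<or> 2 \<le> k" by linarith
  then show "ext3_table n \<delta> (k + 3) (n + 1) = coord_vec n 0 0 (if k = 1 then (real n - 3) else 0)
        (- (fps_const ((real n - 3) + (- 1) * real k) * fps_X ^ k + 0 * fps_X ^ k))"
    using n k by (elim disjE; intro poly_mapping_eqI; auto simp: entry)
  from \<open>k = 0 \<or> k = 1 \<or> 2 \<le> k\<close>
  show "ext3_table n \<delta> (n + 1) (k + 3) = coord_vec n 0 0 0
        (fps_const ((real n - 3) + (- 1) * real k) * fps_X ^ k + 0 * fps_X ^ k)"
    using n k by (elim disjE; intro poly_mapping_eqI; auto simp: entry)
qed (use n in \<open>auto simp: ext3_table_def\<close>)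

text \<open>The sign arises because the table shows \<epsilon> and b with a plus in right
  multiplication by e_(n+1), whereas Q describes left multiplication.\<close>

definition ext4_series :: "real \<Rightarrow> (nat \<Rightarrow> real) \<Rightarrow> real fps" where
  "ext4_series \<epsilon> b = - Abs_fps (\<lambda>k. if k < 2 then 0 else if k = 2 then \<epsilon> else b (k - 2))"

lemma ext4_series_nth [simp]:
  "ext4_series \<epsilon> b $ 0 = 0" "ext4_series \<epsilon> b $ Suc 0 = 0" "ext4_series \<epsilon> b $ 2 = - \<epsilon>"
  "ext4_series \<epsilon> b $ (k + 3) = - b (k + 1)"
  by (simp_all add: ext4_series_def)

lemma ext4_series_shift:
  assumes "4 \<le> n" "k + 3 \<le> n"
  shows "coord_vec n 0 0 0 (fps_X ^ k - ext4_series \<epsilon> b * fps_X ^ k) =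
    ev (k + 3) + (if k + 5 \<le> n then \<epsilon> *\<^sub>R ev (k + 5) else 0) + (\<Sum>l\<in>{k + 6..n}. b (l - k - 5) *\<^sub>R ev l)"
    (is "?l = ?r")
proof (rule poly_mapping_eqI)
  fix l :: nat
  consider "l < 3" | j where "l = j + 3" by (metis le_add_diff_inverse2 not_less)
  then show "Poly_Mapping.lookup ?l l = Poly_Mapping.lookup ?r l"
  proof cases
    case 1
    then show ?thesis using assms
      by (cases "l = 0"; cases "l = 1"; cases "l = 2")
        (auto simp: lookup_coord_vec lookup_add lookup_ev lookup_sum_ev)
  next
    case (2 j)
    consider "j < k" | "j = k" | "j = k + 1" | "j = k + 2" | i where "j = k + (i + 3)"
    proof -
      have "j < k \<or> j = k \<or> j = k + 1 \<or> j = k + 2 \<or> j = k + (j - k - 3 + 3)" by linarith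
      then show thesis using that by blast
    qed
    then show ?thesis
      using assms
      by cases (simp_all add: 2 lookup_coord_vec lookup_add lookup_ev lookup_sum_ev fps_X_power_mult_right_nth
          ext4_series_def)
  qed
qed

text \<open>P = -Q lets Q cancel in the brackets of e_1 = x + e_3 with e_(n+1), which leaves only
  e_3 and -e_3 there.\<close>

lemma L2_normal_ext4:
  assumes n: "4 \<le> n"
  shows "L2_normal (n - 2) (coord_space (n + 1)) (coord_vec n) (ext4_bracket n \<epsilon> b)
    0 (- 1) (- ext4_series \<epsilon> b) (ext4_series \<epsilon> b) 0"
  unfolding ext4_bracket_def
proof (rule L2_normal_tableI)
  interpret coords "n - 2" "coord_space (n + 1)" "coord_vec n"
    by (rule coords_coord_vec[OF n])
  note entry = lookup_coord_vec lookup_add lookup_minus lookup_ev ext4_table_def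
  show "4 \<le> n" using n by simp
  show "ext4_table n \<epsilon> b 1 (n + 1) = coord_vec n 0 (- 0) 0 (- (fps_const (- 1) + ext4_series \<epsilon> b + - ext4_series \<epsilon> b))"
    "ext4_table n \<epsilon> b (n + 1) 1 = coord_vec n 0 0 0 (fps_const (- 1) + ext4_series \<epsilon> b + - ext4_series \<epsilon> b)"
    using n by (intro poly_mapping_eqI; auto simp: entry)+
  fix k assume k: "k + 3 \<le> n"
  have e2: "coord_vec n 0 0 c 0 = c *\<^sub>R ev 2" for c
    by (simp add: coord_vec_def)
  have T: "ext4_table n \<epsilon> b (k + 3) (n + 1) = (if k = 1 then - ev 2 else 0)
      + coord_vec n 0 0 0 (fps_X ^ k - ext4_series \<epsilon> b * fps_X ^ k)"
    "ext4_table n \<epsilon> b (n + 1) (k + 3) = - coord_vec n 0 0 0 (fps_X ^ k - ext4_series \<epsilon> b * fps_X ^ k)"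
    using k unfolding ext4_series_shift[OF n k] by (auto simp: ext4_table_def Let_def add.commute)
  show "ext4_table n \<epsilon> b (k + 3) (n + 1) = coord_vec n 0 0 (if k = 1 then - 1 else 0)
        (- (fps_const (- 1 + 0 * real k) * fps_X ^ k + ext4_series \<epsilon> b * fps_X ^ k))"
  proof -
    have "(if k = 1 then - ev 2 else 0) = coord_vec n 0 0 (if k = 1 then - 1 else 0) 0"
      unfolding e2 by simp
    then show ?thesis unfolding T by (simp add: add flip: fps_const_neg)
  qed
  show "ext4_table n \<epsilon> b (n + 1) (k + 3) = coord_vec n 0 0 0
        (fps_const (- 1 + 0 * real k) * fps_X ^ k + ext4_series \<epsilon> b * fps_X ^ k)"
    unfolding T by (simp add: uminus flip: fps_const_neg)
qed (use n in \<open>auto simp: ext4_table_def\<close>)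

section \<open>Invariants separating the families\<close>

lemma leibniz_isomorphic_sym:
  assumes V: "left_leibniz_algebra V br" and iso: "leibniz_isomorphic V br W br'"
  shows "leibniz_isomorphic W br' V br"
proof -
  obtain g where g: "bij_betw g V W" "\<And>x y. x \<in> V \<Longrightarrow> y \<in> V \<Longrightarrow> g (x + y) = g x + g y"
    "\<And>c x. x \<in> V \<Longrightarrow> g (c *\<^sub>R x) = c *\<^sub>R g x"
    "\<And>x y. x \<in> V \<Longrightarrow> y \<in> V \<Longrightarrow> g (br x y) = br' (g x) (g y)"
    using iso unfolding leibniz_isomorphic_def by blast
  have sub: "subspace V" and cl: "\<And>x y. x \<in> V \<Longrightarrow> y \<in> V \<Longrightarrow> br x y \<in> V"
    using V by (auto simp: left_leibniz_algebra_def)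
  define h where "h = inv_into V g"
  have hV: "h w \<in> V" and gh: "g (h w) = w" if "w \<in> W" for w
    using that g(1) by (auto simp: h_def bij_betw_def inv_into_into f_inv_into_f)
  have hg: "h (g v) = v" if "v \<in> V" for v
    using that g(1) by (auto simp: h_def bij_betw_def)
  have hI: "h w = v" if "v \<in> V" "w = g v" for v w using that hg by simp
  show ?thesis
    unfolding leibniz_isomorphic_def
  proof (intro exI[of _ h] conjI ballI allI)
    show "bij_betw h W V" unfolding h_def using g(1) by (rule bij_betw_inv_into)
  next
    fix x y assume "x \<in> W" "y \<in> W"
    then show "h (x + y) = h x + h y" "h (br' x y) = br (h x) (h y)"
      by (auto intro!: hI subspace_add[OF sub] cl simp: g hV gh)
  next
    fix c x assume "x \<in> W"
    then show "h (c *\<^sub>R x) = c *\<^sub>R h x"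
      by (auto intro!: hI subspace_scale[OF sub] simp: g hV gh)
  qed
qed

section \<open>Three properties invariant under isomorphism\<close>

definition metabelian :: "'a::real_vector set \<Rightarrow> ('a \<Rightarrow> 'a \<Rightarrow> 'a) \<Rightarrow> bool" where
  "metabelian V br \<longleftrightarrow> (\<forall>u\<in>V. \<forall>v\<in>V. \<forall>u'\<in>V. \<forall>v'\<in>V. br (br u v) (br u' v') = 0)"

text \<open>Separates the third family, where it fails, from the first two.\<close>

definition has_isotropic_weight :: "'a::real_vector set \<Rightarrow> ('a \<Rightarrow> 'a \<Rightarrow> 'a) \<Rightarrow> bool" where
  "has_isotropic_weight V br \<longleftrightarrow> (\<exists>Z\<in>V. \<exists>U\<in>V. br Z Z = 0 \<and> br Z U = U \<and> U \<noteq> 0)"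

text \<open>Separates the first family from the second. The last condition prevents X from lying in
  \<open>Y\<close>, so Z has eigenvalue -1 on a vector with nonzero x-component.\<close>

definition has_isotropic_generator :: "'a::real_vector set \<Rightarrow> ('a \<Rightarrow> 'a \<Rightarrow> 'a) \<Rightarrow> bool" where
  "has_isotropic_generator V br \<longleftrightarrow>
     (\<exists>Z\<in>V. \<exists>X\<in>V. \<exists>U\<in>V. br Z Z = 0 \<and> br Z X = - X \<and> br (br U X) X \<noteq> 0)"

lemma leibniz_isomorphic_invariants:
  assumes V: "left_leibniz_algebra V br" and iso: "leibniz_isomorphic V br W br'"
  shows "metabelian W br' \<Longrightarrow> metabelian V br"
    and "has_isotropic_weight V br \<Longrightarrow> has_isotropic_weight W br'"
    and "has_isotropic_generator V br \<Longrightarrow> has_isotropic_generator W br'"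
proof -
  obtain g where g: "bij_betw g V W" "\<And>x y. x \<in> V \<Longrightarrow> y \<in> V \<Longrightarrow> g (x + y) = g x + g y"
    "\<And>c x. x \<in> V \<Longrightarrow> g (c *\<^sub>R x) = c *\<^sub>R g x"
    "\<And>x y. x \<in> V \<Longrightarrow> y \<in> V \<Longrightarrow> g (br x y) = br' (g x) (g y)"
    using iso unfolding leibniz_isomorphic_def by blast
  have sub: "subspace V" and cl: "\<And>x y. x \<in> V \<Longrightarrow> y \<in> V \<Longrightarrow> br x y \<in> V"
    using V by (auto simp: left_leibniz_algebra_def)
  have V0: "0 \<in> V" using sub by (rule subspace_0)
  have g0: "g 0 = 0" using g(3)[OF V0, of 0] by simp
  have gm: "g (- x) = - g x" if "x \<in> V" for x using g(3)[OF that, of "-1"] by simp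
  have gW: "g v \<in> W" if "v \<in> V" for v using that g(1) by (auto simp: bij_betw_def)
  have inj: "g x = 0 \<longleftrightarrow> x = 0" if "x \<in> V" for x
    using that g(1) V0 g0 by (metis bij_betw_imp_inj_on inj_onD)
  show "metabelian W br' \<Longrightarrow> metabelian V br"
    unfolding metabelian_def
  proof (intro ballI)
    fix u v u' v' assume H: "\<forall>u\<in>W. \<forall>v\<in>W. \<forall>u'\<in>W. \<forall>v'\<in>W. br' (br' u v) (br' u' v') = 0"
      and uv: "u \<in> V" "v \<in> V" "u' \<in> V" "v' \<in> V"
    have "g (br (br u v) (br u' v')) = br' (br' (g u) (g v)) (br' (g u') (g v'))"
      using uv by (simp only: g(4) cl)
    also have "\<dots> = 0" using H gW uv by blast
    finally have "g (br (br u v) (br u' v')) = 0" .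
    then show "br (br u v) (br u' v') = 0" using inj[OF cl[OF cl cl]] uv by simp
  qed
  show "has_isotropic_weight V br \<Longrightarrow> has_isotropic_weight W br'"
    unfolding has_isotropic_weight_def
  proof (elim bexE conjE)
    fix Z U assume *: "Z \<in> V" "U \<in> V" "br Z Z = 0" "br Z U = U" "U \<noteq> 0"
    then have "br' (g Z) (g Z) = 0" "br' (g Z) (g U) = g U" "g U \<noteq> 0"
      using g(4)[of Z Z] g(4)[of Z U] g0 inj by auto
    then show "\<exists>Z\<in>W. \<exists>U\<in>W. br' Z Z = 0 \<and> br' Z U = U \<and> U \<noteq> 0"
      using * gW by blast
  qed
  show "has_isotropic_generator V br \<Longrightarrow> has_isotropic_generator W br'"
    unfolding has_isotropic_generator_def
  proof (elim bexE conjE)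
    fix Z X U assume *: "Z \<in> V" "X \<in> V" "U \<in> V" "br Z Z = 0" "br Z X = - X" "br (br U X) X \<noteq> 0"
    then have "br' (g Z) (g Z) = 0" "br' (g Z) (g X) = - g X" "br' (br' (g U) (g X)) (g X) \<noteq> 0"
      using g(4)[of Z Z] g(4)[of Z X] g(4)[of U X] g(4)[of "br U X" X] g0 gm[of X] cl
        inj[of "br (br U X) X"] by auto
    then show "\<exists>Z\<in>W. \<exists>X\<in>W. \<exists>U\<in>W. br' Z Z = 0 \<and> br' Z X = - X \<and> br' (br' U X) X \<noteq> 0"
      using * gW by blast
  qed
qed

context L2_rank_one
begin

text \<open>The witness is the product of [1, x] = t and [z, x] = -x + P. It does not need 1 itself
  to be a bracket, so it covers \<kappa> = 0 as well.\<close>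

lemma not_metabelian:
  assumes "3 \<le> m"
  shows "\<not> metabelian V br"
proof -
  have "br (br (\<phi> 0 0 0 1) (\<phi> 0 1 0 0)) (br (\<phi> 1 0 0 0) (\<phi> 0 1 0 0)) = \<phi> 0 0 0 (- (fps_X ^ 2))"
    by (simp add: bracket series_op_def power2_eq_square algebra_simps flip: fps_const_neg)
  also have "\<dots> \<noteq> 0" using assms unfolding ker fps_X_power_dvd_iff by auto
  finally show ?thesis unfolding metabelian_def using mem by blast
qed

lemma has_isotropic_weight_x:
  assumes "P = 0" "B = 0"
  shows "has_isotropic_weight V br"
  unfolding has_isotropic_weight_def
proof (intro bexI conjI)
  show "br (\<phi> (- 1) 0 0 0) (\<phi> (- 1) 0 0 0) = 0"
    using assms by (simp add: bracket series_op_def)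
  show "br (\<phi> (- 1) 0 0 0) (\<phi> 0 1 0 0) = \<phi> 0 1 0 0"
    using assms by (simp add: bracket series_op_def)
  show "\<phi> 0 1 0 0 \<noteq> 0" by (simp add: ker)
qed auto

text \<open>Serves the second family: P \<noteq> 0 spoils x as an eigenvector of z, but \<kappa> = 1
  makes the series 1 one.\<close>

lemma has_isotropic_weight_y:
  assumes "\<kappa> = 1" "Q = 0" "B = 0"
  shows "has_isotropic_weight V br"
  unfolding has_isotropic_weight_def
proof (intro bexI conjI)
  show "br (\<phi> 1 0 0 0) (\<phi> 1 0 0 0) = 0"
    using assms by (simp add: bracket series_op_def)
  show "br (\<phi> 1 0 0 0) (\<phi> 0 0 0 1) = \<phi> 0 0 0 1"
    using assms by (simp add: bracket series_op_def)
  show "\<phi> 0 0 0 1 \<noteq> 0" using m2 by (auto simp: ker fps_X_power_dvd_iff)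
qed auto

text \<open>The coefficient of t^(m-1) in [Z, Z] is B times the square of the z-component of Z. So Z
  lies in \<open>N\<close>, where left multiplication is nilpotent and has no eigenvalue 1.\<close>

lemma no_isotropic_weight:
  assumes "B \<noteq> 0"
  shows "\<not> has_isotropic_weight V br"
proof
  assume "has_isotropic_weight V br"
  then obtain Z U where H: "Z \<in> V" "U \<in> V" "br Z Z = 0" "br Z U = U" "U \<noteq> 0"
    unfolding has_isotropic_weight_def by blast
  obtain s a b f where Z: "Z = \<phi> s a b f" using H obtain_coords by blast
  obtain s' a' b' f' where U: "U = \<phi> s' a' b' f'" using H obtain_coords by blast
  have "fps_X ^ m dvd fps_const (s * s * B) * (fps_X ^ (m - 1) :: real fps)"
    using H(3) by (simp add: Z bracket ker)
  then have "(fps_const (s * s * B) * fps_X ^ (m - 1)) $ (m - 1) = (0 :: real)"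
    using m2 unfolding fps_X_power_dvd_iff by (metis One_nat_def Suc_1 Suc_le_lessD diff_less zero_less_one less_trans)
  then have s: "s = 0" using \<open>B \<noteq> 0\<close> by simp
  have U': "s' = 0 \<and> a' = 0 \<and> b' = a * f' $ 0 \<and> (\<forall>k<m. f' $ k = - (a * (fps_X * f') $ k))"
    using H(4) by (auto simp: Z U s bracket eq_nth_iff)
  have "f' $ k = 0" if "k < m" for k
    using that
  proof (induction k)
    case 0
    then show ?case using U' by (metis fps_X_mult_nth mult_zero_right neg_equal_0_iff_equal)
  next
    case (Suc k)
    then have "(fps_X * f') $ Suc k = 0" by simp
    then show ?case using U' Suc by (metis mult_zero_right neg_equal_0_iff_equal)
  qed
  then have "U = 0" using U' m2 by (auto simp: U ker fps_X_power_dvd_iff)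
  then show False using H by simp
qed

lemma has_isotropic_generator:
  assumes "3 \<le> m" "P = 0" "B = 0"
  shows "has_isotropic_generator V br"
  unfolding has_isotropic_generator_def
proof (intro bexI conjI)
  show "br (\<phi> 1 0 0 0) (\<phi> 1 0 0 0) = 0"
    using assms by (simp add: bracket series_op_def)
  show "br (\<phi> 1 0 0 0) (\<phi> 0 1 0 0) = - \<phi> 0 1 0 0"
    using assms by (simp add: bracket series_op_def uminus)
  show "br (br (\<phi> 0 0 0 1) (\<phi> 0 1 0 0)) (\<phi> 0 1 0 0) \<noteq> 0"
    using assms by (auto simp: bracket_x ker fps_X_power_dvd_iff intro!: exI[of _ 2])
qed auto

text \<open>Write Z = z + u x + v e_2 + g. The eigenvector equation yields g_1 + u g_0 + d = 0,
  whereas the e_2-component of [Z, Z] = 0 yields g_1 + u g_0 = 0.\<close>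

lemma no_isotropic_generator:
  assumes m3: "3 \<le> m" and \<kappa>: "\<kappa> = 1" and P: "P = fps_const d * fps_X ^ 2" "d \<noteq> 0"
    and Q: "Q = 0" and B0: "B = 0"
  shows "\<not> has_isotropic_generator V br"
proof
  assume "has_isotropic_generator V br"
  then obtain Z X U where H: "Z \<in> V" "X \<in> V" "U \<in> V" "br Z Z = 0" "br Z X = - X"
    "br (br U X) X \<noteq> 0"
    unfolding has_isotropic_generator_def by blast
  obtain c u v g where Z: "Z = \<phi> c u v g" using H obtain_coords by blast
  obtain s a b f where X: "X = \<phi> s a b f" using H obtain_coords by blast
  obtain s' a' b' f' where U: "U = \<phi> s' a' b' f'" using H obtain_coords by blast
  have s: "s = 0" using H(5) by (simp add: Z X bracket uminus eq_iff)
  have ca: "c * a = a" using H(5) by (simp add: Z X s bracket uminus eq_iff)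
  \<comment> \<open>Otherwise both X and [U, X] lie in \<open>Y\<close>, where products
    vanish.\<close>
  have "a \<noteq> 0"
  proof
    assume "a = 0"
    then have "br (br U X) X = 0"
      by (simp add: U X s bracket)
    then show False using H by simp
  qed
  then have c: "c = 1" using ca by simp
  have ZX: "\<forall>k<m. (fps_X * (fps_const a * g - fps_const u * f)
      + (series_op (- 1) 1 0 f + fps_const a * P)) $ k = - (f $ k)"
    using H(5) unfolding Z X s c \<kappa> Q B0 by (simp add: bracket uminus eq_nth_iff B0 Q \<kappa>)
  have "f $ 0 = 0" using ZX[rule_format, of 0] m3 by (simp add: series_op_nth P)
  moreover from this have "f $ 1 = - (a * g $ 0)"
    using ZX[rule_format, of 1] m3 by (simp add: series_op_nth P algebra_simps)
  \<comment> \<open>In degree k the operator multiplies f_k by 1 - k, which equals the eigenvalue -1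
    for k = 2. So f_2 cancels and the equation restricts the other data.\<close>
  moreover have "a * g $ 1 - u * f $ 1 + a * d = 0"
    using ZX[rule_format, of 2] m3 by (simp add: series_op_nth P algebra_simps numeral_2_eq_2)
  ultimately have "a * (g $ 1 + u * g $ 0 + d) = 0" by (simp add: algebra_simps)
  then have "g $ 1 + u * g $ 0 + d = 0" using \<open>a \<noteq> 0\<close> by simp
  moreover have "u * g $ 0 + g $ 1 = 0"
    using H(4) unfolding Z c by (simp add: bracket ker \<kappa>)
  ultimately show False using P by simp
qed

end

lemma (in L2_rank_zero) metabelian: "metabelian V br"
  unfolding metabelian_def
proof (intro ballI)
  fix u v u' v' assume "u \<in> V" "v \<in> V" "u' \<in> V" "v' \<in> V"
  then have "br u v \<in> Y" "br u' v' \<in> Y" by (simp_all only: bracket_in_Y)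
  then show "br (br u v) (br u' v') = 0"
    by (auto elim!: obtain_Y simp: bracket_N)
qed

section \<open>Nilradical and derived terms as spans of basis vectors\<close>

lemma coords_N_eq:
  assumes "4 \<le> n" shows "coords.N (coord_vec n) = coord_space n"
proof -
  interpret coords "n - 2" "coord_space (n + 1)" "coord_vec n" by (rule coords_coord_vec[OF assms])
  show ?thesis
  proof
    show "N \<subseteq> coord_space n"
      using assms by (auto elim!: obtain_N simp: mem_coord_space lookup_coord_vec)
    show "coord_space n \<subseteq> N"
    proof
      fix v assume v: "v \<in> coord_space n"
      then have "v \<in> coord_space (n + 1)" by (auto simp: mem_coord_space)
      then obtain s a b f where c: "v = coord_vec n s a b f" by (rule obtain_coords)
      have "Poly_Mapping.lookup v (n + 1) = 0" using v by (simp add: mem_coord_space)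
      then have "s = 0" using assms by (simp add: c lookup_coord_vec)
      then show "v \<in> N" by (simp add: c)
    qed
  qed
qed

lemma coords_Y_eq:
  assumes "4 \<le> n" shows "coords.Y (coord_vec n) = span (ev ` {2..n})"
proof -
  interpret coords "n - 2" "coord_space (n + 1)" "coord_vec n" by (rule coords_coord_vec[OF assms])
  show ?thesis
  proof
    show "Y \<subseteq> span (ev ` {2..n})"
      using assms by (auto elim!: obtain_Y simp: span_ev lookup_coord_vec)
    show "span (ev ` {2..n}) \<subseteq> Y"
    proof
      fix v assume v: "v \<in> span (ev ` {2..n})"
      then have "v \<in> N" unfolding coords_N_eq[OF assms] by (auto simp: mem_coord_space span_ev)
      then obtain a b f where c: "v = coord_vec n 0 a b f" by (rule obtain_N)
      have "Poly_Mapping.lookup v 1 = 0" using v by (simp add: span_ev)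
      then have "a = 0" using assms by (simp add: c lookup_coord_vec)
      then show "v \<in> Y" by (simp add: c)
    qed
  qed
qed

lemma coords_W_eq:
  assumes "4 \<le> n" shows "coords.W (coord_vec n) 1 = span (ev ` insert 2 {4..n})"
proof -
  interpret coords "n - 2" "coord_space (n + 1)" "coord_vec n" by (rule coords_coord_vec[OF assms])
  show ?thesis
  proof
    show "W 1 \<subseteq> span (ev ` insert 2 {4..n})"
    proof
      fix v assume "v \<in> W 1"
      then obtain b f where "v = coord_vec n 0 0 b (fps_X ^ 1 * f)" by (rule obtain_W)
      then show "v \<in> span (ev ` insert 2 {4..n})"
        using assms by (auto simp: span_ev lookup_coord_vec simp del: image_insert)
    qed
    show "span (ev ` insert 2 {4..n}) \<subseteq> W 1"
    proof
      fix v assume v: "v \<in> span (ev ` insert 2 {4..n})"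
      then have "v \<in> Y" unfolding coords_Y_eq[OF assms] using assms
        by (auto simp: span_ev simp del: image_insert)
      then obtain b f where c: "v = coord_vec n 0 0 b f" by (rule obtain_Y)
      have "Poly_Mapping.lookup v 3 = 0" using v by (simp add: span_ev del: image_insert)
      then have "f $ 0 = 0" using assms by (simp add: c lookup_coord_vec)
      then have "v = coord_vec n 0 0 b (fps_X ^ 1 * fps_shift 1 f)"
        unfolding c eq_nth_iff by simp
      then show "v \<in> W 1" by (simp only: W_mem)
    qed
  qed
qed

lemma dim_coord_space: "dim (coord_space k) = k"
  unfolding coord_space_def by (simp add: dim_ev)

lemma table_bracket_restrict:
  assumes "\<And>i j. i \<le> n \<Longrightarrow> j \<le> n \<Longrightarrow> T i j = L2_table n i j"
    and "x \<in> coord_space n" "y \<in> coord_space n"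
  shows "table_bracket (n + 1) T x y = L2_bracket n x y"
proof -
  have *: "Poly_Mapping.lookup x (Suc n) = 0" "Poly_Mapping.lookup y (Suc n) = 0"
    using assms by (auto simp: mem_coord_space)
  show ?thesis
    unfolding table_bracket_def L2_bracket_def
    by (simp add: *, intro sum.cong refl) (simp add: assms(1))
qed

section \<open>The four families are extensions of the required kind\<close>

lemma L2_extensionI:
  assumes n: "4 \<le> n" and norm: "L2_normal (n - 2) (coord_space (n + 1)) (coord_vec n) br \<alpha> \<kappa> P Q B"
    and nil: "is_nilradical (coord_space (n + 1)) br (coords.N (coord_vec n))"
    and ind: "indecomposable_algebra (coord_space (n + 1)) br"
    and L2: "\<And>x y. x \<in> coord_space n \<Longrightarrow> y \<in> coord_space n \<Longrightarrow> br x y = L2_bracket n x y"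
  shows "indecomposable_solvable_L2_extension n (coord_space (n + 1)) br \<and>
    is_nilradical (coord_space (n + 1)) br (coord_space n) \<and>
    (\<forall>x\<in>coord_space n. \<forall>y\<in>coord_space n. br x y = L2_bracket n x y)"
proof -
  interpret L2_normal "n - 2" "coord_space (n + 1)" "coord_vec n" br \<alpha> \<kappa> P Q B by (rule norm)
  have nil': "is_nilradical (coord_space (n + 1)) br (coord_space n)"
    using nil by (simp only: coords_N_eq[OF n])
  have "leibniz_isomorphic (coord_space n) br (coord_space n) (L2_bracket n)"
    unfolding leibniz_isomorphic_def by (intro exI[of _ "\<lambda>x. x"]) (auto simp: bij_betw_def L2)
  then show ?thesis
    using nil' ind left_leibniz solvable L2
    unfolding indecomposable_solvable_L2_extension_def by (auto simp: dim_coord_space)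
qed

lemma rank_one_ext1:
  "4 \<le> n \<Longrightarrow> L2_rank_one (n - 2) (coord_space (n + 1)) (coord_vec n) (ext1_bracket n a) (1 - a) 0 0 0"
  unfolding L2_rank_one_def by (rule L2_normal_ext1)

lemma rank_one_ext2:
  "5 \<le> n \<Longrightarrow> L2_rank_one (n - 2) (coord_space (n + 1)) (coord_vec n) (ext2_bracket n \<delta>)
    1 (- (fps_const \<delta> * fps_X ^ 2)) 0 0"
  unfolding L2_rank_one_def by (rule L2_normal_ext2)

lemma rank_one_ext3:
  "5 \<le> n \<Longrightarrow> L2_rank_one (n - 2) (coord_space (n + 1)) (coord_vec n) (ext3_bracket n \<delta>) (real n - 3) 0 0 \<delta>"
  unfolding L2_rank_one_def by (rule L2_normal_ext3)

lemma rank_zero_ext4: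
  "4 \<le> n \<Longrightarrow> L2_rank_zero (n - 2) (coord_space (n + 1)) (coord_vec n) (ext4_bracket n \<epsilon> b)
    (- ext4_series \<epsilon> b) (ext4_series \<epsilon> b) 0"
  unfolding L2_rank_zero_def by (rule L2_normal_ext4)

lemma rank_one_extension:
  assumes n: "4 \<le> n" and r: "L2_rank_one (n - 2) (coord_space (n + 1)) (coord_vec n) br \<kappa> P Q B"
    and L2: "\<And>x y. x \<in> coord_space n \<Longrightarrow> y \<in> coord_space n \<Longrightarrow> br x y = L2_bracket n x y"
  shows "indecomposable_solvable_L2_extension n (coord_space (n + 1)) br \<and>
    is_nilradical (coord_space (n + 1)) br (coord_space n) \<and>
    (\<forall>x\<in>coord_space n. \<forall>y\<in>coord_space n. br x y = L2_bracket n x y)"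
proof -
  interpret L2_rank_one "n - 2" "coord_space (n + 1)" "coord_vec n" br \<kappa> P Q B by (rule r)
  show ?thesis
    by (rule L2_extensionI[OF n L2_normal_axioms nilradical indecomposable L2])
qed

lemma ext_families_extension:
  assumes n: "4 \<le> n"
    and br: "br \<in> ext1_family n \<union> ext2_family n \<union> ext3_family n \<union> ext4_family n"
  shows "indecomposable_solvable_L2_extension n (coord_space (n + 1)) br \<and>
    is_nilradical (coord_space (n + 1)) br (coord_space n) \<and>
    (\<forall>x\<in>coord_space n. \<forall>y\<in>coord_space n. br x y = L2_bracket n x y)"
proof -
  consider a where "br = ext1_bracket n a" | \<delta> where "5 \<le> n" "br = ext2_bracket n \<delta>"
    | \<delta> where "5 \<le> n" "br = ext3_bracket n \<delta>" | \<epsilon> b where "br = ext4_bracket n \<epsilon> b"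
    using br unfolding ext1_family_def ext2_family_def ext3_family_def ext4_family_def by blast
  then show ?thesis
  proof cases
    case (1 a)
    show ?thesis unfolding 1
      by (rule rank_one_extension[OF n rank_one_ext1[OF n]], unfold ext1_bracket_def,
          rule table_bracket_restrict) (auto simp: ext1_table_def)
  next
    case (2 \<delta>)
    show ?thesis unfolding 2
      by (rule rank_one_extension[OF n rank_one_ext2[OF 2(1)]], unfold ext2_bracket_def,
          rule table_bracket_restrict) (auto simp: ext2_table_def)
  next
    case (3 \<delta>)
    show ?thesis unfolding 3
      by (rule rank_one_extension[OF n rank_one_ext3[OF 3(1)]], unfold ext3_bracket_def,
          rule table_bracket_restrict) (auto simp: ext3_table_def)
  next
    case (4 \<epsilon> b)
    interpret L2_rank_zero "n - 2" "coord_space (n + 1)" "coord_vec n" "ext4_bracket n \<epsilon> b"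
      "- ext4_series \<epsilon> b" "ext4_series \<epsilon> b" 0 by (rule rank_zero_ext4[OF n])
    show ?thesis unfolding 4
      by (rule L2_extensionI[OF n L2_normal_axioms nilradical indecomposable], unfold ext4_bracket_def,
          rule table_bracket_restrict) (auto simp: ext4_table_def)
  qed
qed

section \<open>Dimensions of the derived and lower central series\<close>

lemma dim_zero_space: "dim {0 :: 'a::real_vector} = 0"
  using dim_eq_card_independent[OF independent_empty] dim_span[of "{} :: 'a set"] by simp

lemma rank_one_DS_LS:
  assumes n: "4 \<le> n" and r: "L2_rank_one (n - 2) (coord_space (n + 1)) (coord_vec n) br \<kappa> P Q B"
    and \<kappa>: "\<kappa> \<noteq> 0"
  shows "map (DS (coord_space (n + 1)) br) [0..<4] = [n + 1, n, n - 2, 0] \<and>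
    LS (coord_space (n + 1)) br 0 = n + 1 \<and> (\<forall>k\<ge>1. LS (coord_space (n + 1)) br k = n)"
proof -
  interpret L2_rank_one "n - 2" "coord_space (n + 1)" "coord_vec n" br \<kappa> P Q B by (rule r)
  have "map (DS (coord_space (n + 1)) br) [0..<4]
      = map dim (map (derived_series (coord_space (n + 1)) br) [0..<4])"
    by (simp add: DS_def)
  also have "\<dots> = [n + 1, n, n - 2, 0]"
    unfolding derived_series_values[OF \<kappa>] coords_N_eq[OF n] coords_W_eq[OF n]
    using n by (simp add: dim_coord_space dim_ev dim_zero_space Suc_diff_le numeral_eq_Suc del: image_insert)
  finally show ?thesis
    using lower_central_values[OF \<kappa>] by (simp add: LS_def dim_coord_space coords_N_eq[OF n])
qed

lemma rank_zero_DS_LS: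
  assumes n: "4 \<le> n" and r: "L2_rank_zero (n - 2) (coord_space (n + 1)) (coord_vec n) br P Q B"
  shows "map (DS (coord_space (n + 1)) br) [0..<3] = [n + 1, n - 1, 0] \<and>
    LS (coord_space (n + 1)) br 0 = n + 1 \<and> (\<forall>k\<ge>1. LS (coord_space (n + 1)) br k = n - 1)"
proof -
  interpret L2_rank_zero "n - 2" "coord_space (n + 1)" "coord_vec n" br P Q B by (rule r)
  have "map (DS (coord_space (n + 1)) br) [0..<3]
      = map dim (map (derived_series (coord_space (n + 1)) br) [0..<3])"
    by (simp add: DS_def)
  also have "\<dots> = [n + 1, n - 1, 0]"
    unfolding derived_series_values coords_Y_eq[OF n]
    using n by (simp add: dim_coord_space dim_ev dim_zero_space)
  finally show ?thesis
    using lower_central_values n by (simp add: LS_def dim_coord_space coords_Y_eq dim_ev)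
qed

section \<open>Values of the invariants on the families\<close>

lemma ext1_invariants:
  assumes n: "5 \<le> n" and br: "br \<in> ext1_family n"
  shows "left_leibniz_algebra (coord_space (n + 1)) br" "\<not> metabelian (coord_space (n + 1)) br"
    "has_isotropic_weight (coord_space (n + 1)) br" "has_isotropic_generator (coord_space (n + 1)) br"
proof -
  obtain a where a: "br = ext1_bracket n a" using br by (auto simp: ext1_family_def)
  interpret L2_rank_one "n - 2" "coord_space (n + 1)" "coord_vec n" br "1 - a" 0 0 0
    unfolding a by (rule rank_one_ext1) (use n in simp)
  show "left_leibniz_algebra (coord_space (n + 1)) br" "\<not> metabelian (coord_space (n + 1)) br"
    "has_isotropic_weight (coord_space (n + 1)) br" "has_isotropic_generator (coord_space (n + 1)) br"
    using n left_leibniz not_metabelian has_isotropic_weight_x has_isotropic_generator by auto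
qed

lemma ext2_invariants:
  assumes n: "5 \<le> n" and br: "br \<in> ext2_family n"
  shows "left_leibniz_algebra (coord_space (n + 1)) br" "\<not> metabelian (coord_space (n + 1)) br"
    "has_isotropic_weight (coord_space (n + 1)) br" "\<not> has_isotropic_generator (coord_space (n + 1)) br"
proof -
  obtain \<delta> where \<delta>: "br = ext2_bracket n \<delta>" "\<delta> \<noteq> 0" using br by (auto simp: ext2_family_def)
  interpret L2_rank_one "n - 2" "coord_space (n + 1)" "coord_vec n" br 1 "- (fps_const \<delta> * fps_X ^ 2)" 0 0
    unfolding \<delta> by (rule rank_one_ext2) (rule n)
  show "left_leibniz_algebra (coord_space (n + 1)) br" "\<not> metabelian (coord_space (n + 1)) br"
    "has_isotropic_weight (coord_space (n + 1)) br"
    using n left_leibniz not_metabelian has_isotropic_weight_y by auto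
  show "\<not> has_isotropic_generator (coord_space (n + 1)) br"
    by (rule no_isotropic_generator[of "- \<delta>"]) (use n \<delta> in \<open>auto simp flip: fps_const_neg\<close>)
qed

lemma ext3_invariants:
  assumes n: "5 \<le> n" and br: "br \<in> ext3_family n"
  shows "left_leibniz_algebra (coord_space (n + 1)) br" "\<not> metabelian (coord_space (n + 1)) br"
    "\<not> has_isotropic_weight (coord_space (n + 1)) br"
proof -
  obtain \<delta> where \<delta>: "br = ext3_bracket n \<delta>" "\<delta> \<noteq> 0" using br by (auto simp: ext3_family_def)
  interpret L2_rank_one "n - 2" "coord_space (n + 1)" "coord_vec n" br "real n - 3" 0 0 \<delta>
    unfolding \<delta> by (rule rank_one_ext3) (rule n)
  show "left_leibniz_algebra (coord_space (n + 1)) br" "\<not> metabelian (coord_space (n + 1)) br"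
    "\<not> has_isotropic_weight (coord_space (n + 1)) br"
    using n left_leibniz not_metabelian no_isotropic_weight \<delta> by auto
qed

lemma ext4_invariants:
  assumes n: "5 \<le> n" and br: "br \<in> ext4_family n"
  shows "left_leibniz_algebra (coord_space (n + 1)) br" "metabelian (coord_space (n + 1)) br"
proof -
  obtain \<epsilon> b where e: "br = ext4_bracket n \<epsilon> b" using br by (auto simp: ext4_family_def)
  interpret L2_rank_zero "n - 2" "coord_space (n + 1)" "coord_vec n" br
      "- ext4_series \<epsilon> b" "ext4_series \<epsilon> b" 0
    unfolding e by (rule rank_zero_ext4) (use n in simp)
  show "left_leibniz_algebra (coord_space (n + 1)) br" "metabelian (coord_space (n + 1)) br"
    using left_leibniz metabelian by auto
qed

lemma ext_families_not_isomorphic: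
  assumes n: "5 \<le> n" and ij: "i < 4" "j < 4" "i \<noteq> j"
    and br: "br \<in> [ext1_family n, ext2_family n, ext3_family n, ext4_family n] ! i"
    and br': "br' \<in> [ext1_family n, ext2_family n, ext3_family n, ext4_family n] ! j"
  shows "\<not> leibniz_isomorphic (coord_space (n + 1)) br (coord_space (n + 1)) br'"
proof
  let ?V = "coord_space (n + 1)"
  assume iso: "leibniz_isomorphic ?V br ?V br'"
  note invs = ext1_invariants[OF n] ext2_invariants[OF n] ext3_invariants[OF n] ext4_invariants[OF n]
  have fam: "k = 0 \<and> b \<in> ext1_family n \<or> k = 1 \<and> b \<in> ext2_family n \<or>
      k = 2 \<and> b \<in> ext3_family n \<or> k = 3 \<and> b \<in> ext4_family n"
    if "k < 4" "b \<in> [ext1_family n, ext2_family n, ext3_family n, ext4_family n] ! k" for k b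
  proof -
    have "k = 0 \<or> k = 1 \<or> k = 2 \<or> k = 3" using \<open>k < 4\<close> by linarith
    then show ?thesis using that(2) by auto
  qed
  have L: "left_leibniz_algebra ?V br" "left_leibniz_algebra ?V br'"
    using fam[OF ij(1) br] fam[OF ij(2) br'] invs by blast+
  have iso': "leibniz_isomorphic ?V br' ?V br" by (rule leibniz_isomorphic_sym[OF L(1) iso])
  have "metabelian ?V br \<longleftrightarrow> metabelian ?V br'"
    "has_isotropic_weight ?V br \<longleftrightarrow> has_isotropic_weight ?V br'"
    "has_isotropic_generator ?V br \<longleftrightarrow> has_isotropic_generator ?V br'"
    using leibniz_isomorphic_invariants[OF L(1) iso] leibniz_isomorphic_invariants[OF L(2) iso']
    by blast+
  then show False
    using fam[OF ij(1) br] fam[OF ij(2) br'] ij(3)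
      ext1_invariants[OF n] ext2_invariants[OF n] ext3_invariants[OF n] ext4_invariants[OF n]
    by blast
qed

lemma ext_families_series:
  assumes n: "4 \<le> n"
  shows "a \<noteq> 1 \<Longrightarrow> map (DS (coord_space (n + 1)) (ext1_bracket n a)) [0..<4] = [n + 1, n, n - 2, 0] \<and>
        LS (coord_space (n + 1)) (ext1_bracket n a) 0 = n + 1 \<and>
        (\<forall>k\<ge>1. LS (coord_space (n + 1)) (ext1_bracket n a) k = n)"
    and "br \<in> ext2_family n \<union> ext3_family n \<Longrightarrow>
        map (DS (coord_space (n + 1)) br) [0..<4] = [n + 1, n, n - 2, 0] \<and>
        LS (coord_space (n + 1)) br 0 = n + 1 \<and>
        (\<forall>k\<ge>1. LS (coord_space (n + 1)) br k = n)"
    and "br \<in> ext4_family n \<Longrightarrow>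
        map (DS (coord_space (n + 1)) br) [0..<3] = [n + 1, n - 1, 0] \<and>
        LS (coord_space (n + 1)) br 0 = n + 1 \<and>
        (\<forall>k\<ge>1. LS (coord_space (n + 1)) br k = n - 1)"
proof -
  show "a \<noteq> 1 \<Longrightarrow> map (DS (coord_space (n + 1)) (ext1_bracket n a)) [0..<4] = [n + 1, n, n - 2, 0] \<and>
        LS (coord_space (n + 1)) (ext1_bracket n a) 0 = n + 1 \<and>
        (\<forall>k\<ge>1. LS (coord_space (n + 1)) (ext1_bracket n a) k = n)"
    by (rule rank_one_DS_LS[OF n rank_one_ext1[OF n]]) simp
  show "map (DS (coord_space (n + 1)) br) [0..<4] = [n + 1, n, n - 2, 0] \<and>
        LS (coord_space (n + 1)) br 0 = n + 1 \<and>
        (\<forall>k\<ge>1. LS (coord_space (n + 1)) br k = n)"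
    if br: "br \<in> ext2_family n \<union> ext3_family n"
  proof -
    consider \<delta> where "5 \<le> n" "br = ext2_bracket n \<delta>" | \<delta> where "5 \<le> n" "br = ext3_bracket n \<delta>"
      using br unfolding ext2_family_def ext3_family_def by blast
    then show ?thesis
    proof cases
      case (1 \<delta>)
      show ?thesis unfolding 1 by (rule rank_one_DS_LS[OF n rank_one_ext2[OF 1(1)]]) simp
    next
      case (2 \<delta>)
      show ?thesis unfolding 2 by (rule rank_one_DS_LS[OF n rank_one_ext3[OF 2(1)]]) (use 2 in simp)
    qed
  qed
  show "map (DS (coord_space (n + 1)) br) [0..<3] = [n + 1, n - 1, 0] \<and>
        LS (coord_space (n + 1)) br 0 = n + 1 \<and>
        (\<forall>k\<ge>1. LS (coord_space (n + 1)) br k = n - 1)"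
    if "br \<in> ext4_family n"
    using that by (auto simp only: ext4_family_def mem_Collect_eq rank_zero_DS_LS[OF n rank_zero_ext4[OF n]])
qed

section \<open>The structure of a one-dimensional extension\<close>

locale L2_ideal_extension = coords m V \<phi>
  for m :: nat and V :: "'a::real_vector set" and \<phi> :: "real \<Rightarrow> real \<Rightarrow> real \<Rightarrow> real fps \<Rightarrow> 'a" +
  fixes br :: "'a \<Rightarrow> 'a \<Rightarrow> 'a"
  assumes leibniz: "left_leibniz_algebra V br"
    and ideal_N: "leibniz_ideal V br N"
    and bracket_N: "br (\<phi> 0 a b f) (\<phi> 0 a' b' f')
      = \<phi> 0 0 (a * f' $ 0) (fps_X * (fps_const a' * f - fps_const a * f'))"
begin

lemma closed [simp]: "u \<in> V \<Longrightarrow> v \<in> V \<Longrightarrow> br u v \<in> V"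
  and br_add_left: "u \<in> V \<Longrightarrow> v \<in> V \<Longrightarrow> w \<in> V \<Longrightarrow> br (u + v) w = br u w + br v w"
  and br_add_right: "u \<in> V \<Longrightarrow> v \<in> V \<Longrightarrow> w \<in> V \<Longrightarrow> br w (u + v) = br w u + br w v"
  and br_scale_left: "u \<in> V \<Longrightarrow> v \<in> V \<Longrightarrow> br (c *\<^sub>R u) v = c *\<^sub>R br u v"
  and br_scale_right: "u \<in> V \<Longrightarrow> v \<in> V \<Longrightarrow> br u (c *\<^sub>R v) = c *\<^sub>R br u v"
  and leib: "u \<in> V \<Longrightarrow> v \<in> V \<Longrightarrow> w \<in> V \<Longrightarrow> br (br u v) w = br u (br v w) - br v (br u w)"
  using leibniz by (auto simp: left_leibniz_algebra_def)

lemma br_zero_right: "u \<in> V \<Longrightarrow> br u 0 = 0"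
  using br_scale_right[of u u 0] by simp

lemma N_closed: "u \<in> V \<Longrightarrow> v \<in> N \<Longrightarrow> br u v \<in> N" "u \<in> V \<Longrightarrow> v \<in> N \<Longrightarrow> br v u \<in> N"
  using ideal_N by (auto simp: leibniz_ideal_def)

abbreviation z where "z \<equiv> \<phi> 1 0 0 0"
abbreviation x where "x \<equiv> \<phi> 0 1 0 0"
abbreviation y where "y \<equiv> \<phi> 0 0 0 1"
abbreviation e2 where "e2 \<equiv> \<phi> 0 0 1 0"

lemma derivation: "u \<in> V \<Longrightarrow> v \<in> V \<Longrightarrow> br z (br u v) = br (br z u) v + br u (br z v)"
  using leib[of z u v] by simp

lemma bracket_zz_left: "u \<in> V \<Longrightarrow> br (br z z) u = 0"
  using leib[of z z u] by simp

lemma symmetric_left_annihilator: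
  "u \<in> V \<Longrightarrow> v \<in> V \<Longrightarrow> br (br u z + br z u) v = 0"
  using leib[of u z v] leib[of z u v] by (simp add: br_add_left)

text \<open>Bracketing with x multiplies the series by t, so only its top coefficient can survive;
  bracketing with y reads off the x-component.\<close>

lemma left_annihilator:
  assumes "w \<in> N" and "\<And>v. v \<in> N \<Longrightarrow> br w v = 0"
  obtains b c where "w = \<phi> 0 0 b (fps_const c * fps_X ^ (m - 1))"
proof -
  obtain a b f where w: "w = \<phi> 0 a b f" using assms(1) by (rule obtain_N)
  have "br w x = 0" "br w y = 0" using assms(2) by auto
  then have *: "\<forall>k<m. (fps_X * f) $ k = 0" "a = 0"
    unfolding w bracket_N ker fps_X_power_dvd_iff by auto
  have "f $ k = 0" if "k < m" "k \<noteq> m - 1" for k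
    using *(1)[rule_format, of "Suc k"] that by simp
  then have "w = \<phi> 0 0 b (fps_const (f $ (m - 1)) * fps_X ^ (m - 1))"
    unfolding w eq_nth_iff using *(2) by auto
  then show ?thesis by (rule that)
qed

text \<open>Left annihilators within \<open>N\<close> are also annihilated from the left. This
  allows [v, z] to be replaced by -[z, v] whenever it stands to the right of a member of
  \<open>N\<close>.\<close>

lemma right_annihilator: "v \<in> N \<Longrightarrow> br v (\<phi> 0 0 b (fps_const c * fps_X ^ (m - 1))) = 0"
  using m2 by (auto elim!: obtain_N simp: bracket_N ker fps_X_power_dvd_iff)

text \<open>[[z, z], z] is zero, and its z-component is the square of the z-component of [z, z].
  Hence [z, z] lies in \<open>N\<close>, where left annihilators are known.\<close>

lemma bracket_zz:
  obtains A B where "br z z = \<phi> 0 0 A (fps_const B * fps_X ^ (m - 1))"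
proof -
  obtain s a b f where zz: "br z z = \<phi> s a b f"
    using closed[of z z] obtain_coords by (metis mem)
  have "br (\<phi> 0 a b f) z \<in> N" by (rule N_closed) auto
  then obtain a' b' f' where n: "br (\<phi> 0 a b f) z = \<phi> 0 a' b' f'" by (rule obtain_N)
  have "br z z = s *\<^sub>R z + \<phi> 0 a b f" by (simp add: zz scale add)
  then have "br (br z z) z = s *\<^sub>R br z z + br (\<phi> 0 a b f) z"
    by (simp add: br_add_left br_scale_left subspace_scale[OF subspace])
  then have "\<phi> (s * s) (s * a + a') (s * b + b') (fps_const s * f + f') = 0"
    using bracket_zz_left[of z] by (simp add: zz scale n add)
  then have "s = 0" by (simp add: ker)
  then have "br z z \<in> N" by (simp add: zz)
  then show ?thesis
    using left_annihilator that bracket_zz_left by (metis ideal_N leibniz_ideal_def subsetD)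
qed

text \<open>A derivation is determined by its values on x and y, because [t^k, x] = t^(k+1) and e_2
  = [x, y] + [y, x]. Applied to [x, x] = 0 the derivation rule gives P(0) = 0, and applied to [y, y]
  = 0 it shows that y has no x-component in its image.\<close>

lemma left_multiplication:
  obtains \<alpha> \<kappa> P Q p q where "P $ 0 = 0" "Q $ 0 = 0"
    "\<And>a b f. br z (\<phi> 0 a b f) = \<phi> 0 (\<alpha> * a) (p * a + (\<alpha> + \<kappa>) * b + q * f $ 0)
      (series_op \<alpha> \<kappa> Q f + fps_const a * P)"
proof -
  have "br z x \<in> N" "br z y \<in> N" by (rule N_closed; simp)+
  then obtain \<alpha> p P \<gamma> q R where zx: "br z x = \<phi> 0 \<alpha> p P" and zy: "br z y = \<phi> 0 \<gamma> q R"
    by (metis obtain_N)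
  have P0: "P $ 0 = 0"
  proof -
    have "br (br z x) x + br x (br z x) = 0"
      using derivation[of x x] by (simp add: bracket_N br_zero_right)
    then show ?thesis by (simp add: zx bracket_N add ker)
  qed
  have \<gamma>: "\<gamma> = 0"
  proof -
    have "br (br z y) y + br y (br z y) = 0"
      using derivation[of y y] by (simp add: bracket_N br_zero_right)
    then show ?thesis by (simp add: zy bracket_N add ker)
  qed
  define \<kappa> where "\<kappa> = R $ 0"
  define Q where "Q = R - fps_const \<kappa>"
  have R: "R = Q + fps_const \<kappa>" and Q0: "Q $ 0 = 0" by (simp_all add: Q_def \<kappa>_def)
  have ze2: "br z e2 = \<phi> 0 0 (\<alpha> + \<kappa>) 0"
  proof -
    have "e2 = br x y + br y x" by (simp add: bracket_N add)
    then have "br z e2 = br (br z x) y + br x (br z y) + (br (br z y) x + br y (br z x))"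
      by (simp only: br_add_right derivation closed mem)
    then show ?thesis by (simp add: zx zy \<gamma> bracket_N add \<kappa>_def P0 algebra_simps flip: fps_const_neg)
  qed
  have zX: "br z (\<phi> 0 0 0 (fps_X ^ k)) = \<phi> 0 0 (if k = 0 then q else 0) (series_op \<alpha> \<kappa> Q (fps_X ^ k))" for k
  proof (induction k)
    case 0
    then show ?case by (simp add: zy \<gamma> R series_op_def add.commute)
  next
    case (Suc k)
    have "\<phi> 0 0 0 (fps_X ^ Suc k) = br (\<phi> 0 0 0 (fps_X ^ k)) x"
      by (simp add: bracket_N)
    then have "br z (\<phi> 0 0 0 (fps_X ^ Suc k)) = br (br z (\<phi> 0 0 0 (fps_X ^ k))) x
        + br (\<phi> 0 0 0 (fps_X ^ k)) (br z x)"
      by (simp only: derivation mem)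
    then show ?case
      unfolding Suc zx power_Suc series_op_X by (simp add: bracket_N add mult.left_commute)
  qed
  have zf: "br z (\<phi> 0 0 0 f) = \<phi> 0 0 (q * f $ 0) (series_op \<alpha> \<kappa> Q f)" for f
  proof -
    have "br z (\<phi> 0 0 0 f) - \<phi> 0 0 (q * f $ 0) (series_op \<alpha> \<kappa> Q f) = 0"
    proof (rule vanish_on_series[where g = "\<lambda>f. br z (\<phi> 0 0 0 f) - \<phi> 0 0 (q * f $ 0) (series_op \<alpha> \<kappa> Q f)"])
      show "br z (\<phi> 0 0 0 (f + f')) - \<phi> 0 0 (q * (f + f') $ 0) (series_op \<alpha> \<kappa> Q (f + f')) =
         br z (\<phi> 0 0 0 f) - \<phi> 0 0 (q * f $ 0) (series_op \<alpha> \<kappa> Q f) +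
         (br z (\<phi> 0 0 0 f') - \<phi> 0 0 (q * f' $ 0) (series_op \<alpha> \<kappa> Q f'))" for f f'
        using br_add_right[of "\<phi> 0 0 0 f" "\<phi> 0 0 0 f'" z]
          add[of 0 0 "q * f $ 0" "series_op \<alpha> \<kappa> Q f" 0 0 "q * f' $ 0" "series_op \<alpha> \<kappa> Q f'"]
        by (simp add: add series_op_add algebra_simps)
      show "br z (\<phi> 0 0 0 (fps_const c * f)) - \<phi> 0 0 (q * (fps_const c * f) $ 0)
          (series_op \<alpha> \<kappa> Q (fps_const c * f)) =
         c *\<^sub>R (br z (\<phi> 0 0 0 f) - \<phi> 0 0 (q * f $ 0) (series_op \<alpha> \<kappa> Q f))" for c f
        using br_scale_right[of z "\<phi> 0 0 0 f" c] scale[of c 0 0 "q * f $ 0" "series_op \<alpha> \<kappa> Q f"]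
        by (simp add: scale series_op_scale series_op_scale' scaleR_diff_right algebra_simps)
      show "br z (\<phi> 0 0 0 (fps_X ^ k)) - \<phi> 0 0 (q * fps_X ^ k $ 0) (series_op \<alpha> \<kappa> Q (fps_X ^ k)) = 0" for k
        by (simp add: zX)
      show "br z (\<phi> 0 0 0 f) - \<phi> 0 0 (q * f $ 0) (series_op \<alpha> \<kappa> Q f) = 0" if "fps_X ^ m dvd f" for f
      proof -
        have "\<phi> 0 0 0 f = 0" using that by (simp add: ker)
        then have "br z (\<phi> 0 0 0 f) = 0" by (simp only: br_zero_right mem)
        moreover have "f $ 0 = 0" using that m2 by (auto simp: fps_X_power_dvd_iff)
        then have "\<phi> 0 0 (q * f $ 0) (series_op \<alpha> \<kappa> Q f) = 0"
          using series_op_dvd[OF that] by (simp add: ker)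
        ultimately show ?thesis by (simp only: diff_self)
      qed
    qed
    then show ?thesis by simp
  qed
  have "br z (\<phi> 0 a b f) = \<phi> 0 (\<alpha> * a) (p * a + (\<alpha> + \<kappa>) * b + q * f $ 0)
      (series_op \<alpha> \<kappa> Q f + fps_const a * P)" for a b f
  proof -
    have "\<phi> 0 a b f = a *\<^sub>R x + b *\<^sub>R e2 + \<phi> 0 0 0 f" by (simp add: add scale)
    then have "br z (\<phi> 0 a b f) = a *\<^sub>R br z x + b *\<^sub>R br z e2 + br z (\<phi> 0 0 0 f)"
      by (simp only: br_add_right br_scale_right mem subspace_add[OF subspace] subspace_scale[OF subspace])
    then show ?thesis by (simp add: zx ze2 zf add scale algebra_simps)
  qed
  then show ?thesis by (rule that[OF P0 Q0])
qed

lemma symmetric_part_annihilates: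
  assumes "u \<in> N" shows "\<exists>b c. br u z + br z u = \<phi> 0 0 b (fps_const c * fps_X ^ (m - 1))"
proof -
  have "u \<in> V" using assms by (auto elim: obtain_N)
  have "br u z + br z u \<in> N" using assms by (intro subspace_add subspace_N N_closed) auto
  moreover have "br (br u z + br z u) v = 0" if "v \<in> N" for v
    using symmetric_left_annihilator \<open>u \<in> V\<close> that by (auto elim: obtain_N)
  ultimately show ?thesis using left_annihilator by metis
qed

text \<open>The Leibniz identity expands [[u, v], z] into brackets with [v, z] and [u, z] on the
  right, where they may be replaced by -[z, v] and -[z, u]. On products the symmetrised action of z
  thus depends on left multiplication alone.\<close>

lemma symmetric_part_bracket:
  assumes "u \<in> N" "v \<in> N"
  shows "br (br u v) z + br z (br u v) = br (br z u) v + br v (br z u)"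
proof -
  have uv: "u \<in> V" "v \<in> V" using assms by (auto elim: obtain_N)
  have rz: "br u' (br v' z) = - br u' (br z v')" if "u' \<in> N" "v' \<in> N" for u' v'
  proof -
    have "u' \<in> V" "v' \<in> V" using that by (auto elim: obtain_N)
    moreover have "br u' (br v' z + br z v') = 0"
      using symmetric_part_annihilates[OF that(2)] right_annihilator[OF that(1)] by auto
    ultimately show ?thesis by (simp add: br_add_right eq_neg_iff_add_eq_0)
  qed
  show ?thesis
    using leib[of u v z] derivation[of u v] uv rz assms by simp
qed

text \<open>Right multiplication by z is the symmetrised action S minus left multiplication. S is
  computed on e_2 and on multiples of t, which come from products, so only its values on x and y are
  free; their components along t^(m-1) are \<sigma>' and \<tau>'.\<close>

lemma bracket_structure:
  obtains \<alpha> \<kappa> P Q p q \<sigma> \<tau> \<sigma>' \<tau>' A B where "P $ 0 = 0" "Q $ 0 = 0"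
    "\<And>s a b f s' a' b' f'. br (\<phi> s a b f) (\<phi> s' a' b' f') =
      \<phi> 0 (\<alpha> * (s * a' - s' * a))
        (a * f' $ 0 + s * (p * a' + (\<alpha> + \<kappa>) * b' + q * f' $ 0)
          + s' * ((\<sigma> - p) * a + (\<tau> - q) * f $ 0 + \<kappa> * f $ 1) + s * s' * A)
        (fps_X * (fps_const a' * f - fps_const a * f')
          + fps_const s * (series_op \<alpha> \<kappa> Q f' + fps_const a' * P)
          - fps_const s' * (series_op \<alpha> \<kappa> Q f + fps_const a * P)
          + fps_const (s * s' * B + s' * (\<sigma>' * a + \<tau>' * f $ 0)) * fps_X ^ (m - 1))"
proof -
  obtain \<alpha> \<kappa> P Q p q where PQ: "P $ 0 = 0" "Q $ 0 = 0" and
    L: "\<And>a b f. br z (\<phi> 0 a b f) = \<phi> 0 (\<alpha> * a) (p * a + (\<alpha> + \<kappa>) * b + q * f $ 0)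
      (series_op \<alpha> \<kappa> Q f + fps_const a * P)"
    by (rule left_multiplication) blast
  obtain A B where zz: "br z z = \<phi> 0 0 A (fps_const B * fps_X ^ (m - 1))" by (rule bracket_zz)
  define S where "S u = br u z + br z u" for u
  obtain \<sigma> \<sigma>' where Sx: "S x = \<phi> 0 0 \<sigma> (fps_const \<sigma>' * fps_X ^ (m - 1))"
    using symmetric_part_annihilates[of x] by (auto simp: S_def)
  obtain \<tau> \<tau>' where Sy: "S y = \<phi> 0 0 \<tau> (fps_const \<tau>' * fps_X ^ (m - 1))"
    using symmetric_part_annihilates[of y] by (auto simp: S_def)
  have S_add: "S (u + v) = S u + S v" if "u \<in> V" "v \<in> V" for u v
    using that by (simp add: S_def br_add_left br_add_right)
  have S_scale: "S (c *\<^sub>R u) = c *\<^sub>R S u" if "u \<in> V" for u c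
    using that by (simp add: S_def br_scale_left br_scale_right scaleR_add_right)
  have S_bracket: "S (br (\<phi> 0 a b f) (\<phi> 0 a' b' f')) = \<phi> 0 0 (\<alpha> * a * f' $ 0 + a' * (\<kappa> * f $ 0)) 0"
    for a b f a' b' f'
    unfolding S_def symmetric_part_bracket[OF N_mem N_mem]
    by (simp add: L bracket_N add series_op_nth PQ flip: distrib_left)
  have Se2: "S e2 = \<phi> 0 0 (\<alpha> + \<kappa>) 0"
  proof -
    have "e2 = br x y + br y x" by (simp add: bracket_N add)
    then have "S e2 = S (br x y) + S (br y x)" by (simp only: S_add closed mem)
    then show ?thesis by (simp only: S_bracket) (simp add: add)
  qed
  have SX: "S (\<phi> 0 0 0 (fps_X * f)) = \<phi> 0 0 (\<kappa> * f $ 0) 0" for f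
    using S_bracket[of 0 0 f 1 0 0] by (simp add: bracket_N)
  have S: "S (\<phi> 0 a b f) = \<phi> 0 0 (\<sigma> * a + (\<alpha> + \<kappa>) * b + \<tau> * f $ 0 + \<kappa> * f $ 1)
      (fps_const (\<sigma>' * a + \<tau>' * f $ 0) * fps_X ^ (m - 1))" for a b f
  proof -
    have "\<phi> 0 a b f = a *\<^sub>R x + b *\<^sub>R e2 + (f $ 0) *\<^sub>R y + \<phi> 0 0 0 (fps_X * fps_shift 1 f)"
      by (simp add: add scale eq_nth_iff)
    then have "S (\<phi> 0 a b f) = a *\<^sub>R S x + b *\<^sub>R S e2 + (f $ 0) *\<^sub>R S y + S (\<phi> 0 0 0 (fps_X * fps_shift 1 f))"
      by (simp only: S_add S_scale mem subspace_add[OF subspace] subspace_scale[OF subspace])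
    then show ?thesis
      by (simp add: Sx Sy Se2 SX add scale eq_nth_iff algebra_simps)
  qed
  have R: "br (\<phi> 0 a b f) z = S (\<phi> 0 a b f) - br z (\<phi> 0 a b f)" for a b f
    by (simp add: S_def)
  have "br (\<phi> s a b f) (\<phi> s' a' b' f') =
      \<phi> 0 (\<alpha> * (s * a' - s' * a))
        (a * f' $ 0 + s * (p * a' + (\<alpha> + \<kappa>) * b' + q * f' $ 0)
          + s' * ((\<sigma> - p) * a + (\<tau> - q) * f $ 0 + \<kappa> * f $ 1) + s * s' * A)
        (fps_X * (fps_const a' * f - fps_const a * f')
          + fps_const s * (series_op \<alpha> \<kappa> Q f' + fps_const a' * P)
          - fps_const s' * (series_op \<alpha> \<kappa> Q f + fps_const a * P)
          + fps_const (s * s' * B + s' * (\<sigma>' * a + \<tau>' * f $ 0)) * fps_X ^ (m - 1))" for s a b f s' a' b' f'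
  proof -
    have "\<phi> s a b f = s *\<^sub>R z + \<phi> 0 a b f" "\<phi> s' a' b' f' = s' *\<^sub>R z + \<phi> 0 a' b' f'"
      by (simp_all add: add scale)
    then have "br (\<phi> s a b f) (\<phi> s' a' b' f') = s *\<^sub>R (s' *\<^sub>R br z z + br z (\<phi> 0 a' b' f'))
      + (s' *\<^sub>R br (\<phi> 0 a b f) z + br (\<phi> 0 a b f) (\<phi> 0 a' b' f'))"
      by (simp only: br_add_left br_add_right br_scale_left br_scale_right mem
          subspace_add[OF subspace] subspace_scale[OF subspace]) (simp add: algebra_simps)
    then show ?thesis
      unfolding R S L zz bracket_N
      by (simp add: add scale diff eq_nth_iff algebra_simps)
  qed
  then show ?thesis by (rule that[OF PQ])
qed

lemma model_or_nilpotent: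
  obtains (nilpotent) "nilpotent_algebra V br"
    | (model) \<alpha> \<kappa> P Q p q \<sigma> \<tau> A B where "L2_model m V \<phi> br \<alpha> \<kappa> P Q p q \<sigma> \<tau> A B" "\<alpha> \<noteq> 0 \<or> \<kappa> \<noteq> 0"
proof -
  obtain \<alpha> \<kappa> P Q p q \<sigma> \<tau> \<sigma>' \<tau>' A B where PQ: "P $ 0 = 0" "Q $ 0 = 0" and
    bracket: "\<And>s a b f s' a' b' f'. br (\<phi> s a b f) (\<phi> s' a' b' f') =
      \<phi> 0 (\<alpha> * (s * a' - s' * a))
        (a * f' $ 0 + s * (p * a' + (\<alpha> + \<kappa>) * b' + q * f' $ 0)
          + s' * ((\<sigma> - p) * a + (\<tau> - q) * f $ 0 + \<kappa> * f $ 1) + s * s' * A)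
        (fps_X * (fps_const a' * f - fps_const a * f')
          + fps_const s * (series_op \<alpha> \<kappa> Q f' + fps_const a' * P)
          - fps_const s' * (series_op \<alpha> \<kappa> Q f + fps_const a * P)
          + fps_const (s * s' * B + s' * (\<sigma>' * a + \<tau>' * f $ 0)) * fps_X ^ (m - 1))"
    by (rule bracket_structure) blast
  have m1: "m - 1 < m" "m - 1 \<noteq> 0" using m2 by auto
  show ?thesis
  proof (cases "\<alpha> = 0 \<and> \<kappa> = 0")
    case True
    have Q: "Q = fps_X * fps_shift 1 Q" using PQ by (simp add: fps_eq_iff)
    \<comment> \<open>With both weights zero one bracket removes z, x and the constant term, and
      every further bracket raises the order in t.\<close>
    have lower: "lower_central V br (Suc k) \<subseteq> W (Suc k)" for k
    proof (induction k)
      case 0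
      show ?case
      proof (subst lower_central.simps, rule bracket_span_subset[OF subspace_W])
        fix u v assume uv: "u \<in> lower_central V br 0" "v \<in> V"
        then have "br u v \<in> V" by simp
        then obtain s a b f where c: "br u v = \<phi> s a b f" by (rule obtain_coords)
        have "zcoord (br u v) = 0 \<and> xcoord (br u v) = 0 \<and> ycoord (br u v) = 0"
          using uv m1 PQ True by (auto elim!: obtain_coords simp: bracket series_op_nth)
        then have "s = 0 \<and> a = 0 \<and> f $ 0 = 0" by (simp add: c)
        then have "br u v = \<phi> 0 0 b (fps_X ^ 1 * fps_shift 1 f)"
          unfolding c eq_nth_iff by simp
        then show "br u v \<in> W (Suc 0)" by (simp only: W_mem One_nat_def)
      qed
    next
      case (Suc k)
      show ?case
      proof (subst lower_central.simps, rule bracket_span_subset[OF subspace_W])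
        fix u v assume "u \<in> lower_central V br (Suc k)" and v: "v \<in> V"
        then have "u \<in> W (Suc k)" using Suc by blast
        then obtain b f where u: "u = \<phi> 0 0 b (fps_X ^ Suc k * f)" by (rule obtain_W)
        obtain s' a' b' f' where v: "v = \<phi> s' a' b' f'" using v by (rule obtain_coords)
        have "br u v = \<phi> 0 0 (s' * \<kappa> * (fps_X ^ Suc k * f) $ 1)
            (fps_X * (fps_const a' * (fps_X ^ Suc k * f)) - fps_const s' * (Q * (fps_X ^ Suc k * f)))"
          unfolding u v using True by (simp add: bracket series_op_def)
        also have "fps_X * (fps_const a' * (fps_X ^ Suc k * f)) - fps_const s' * (Q * (fps_X ^ Suc k * f))
            = fps_X ^ Suc (Suc k) * (fps_const a' * f - fps_const s' * fps_shift 1 Q * f)"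
          by (subst Q) (simp add: algebra_simps)
        finally show "br u v \<in> W (Suc (Suc k))" by (simp only: W_mem)
      qed
    qed
    have "lower_central V br (Suc (Suc m)) \<subseteq> {0}"
    proof (subst lower_central.simps, rule bracket_span_subset)
      fix u v assume "u \<in> lower_central V br (Suc m)" and v: "v \<in> V"
      then have "u \<in> W (Suc m)" using lower by blast
      then obtain b f where u: "u = \<phi> 0 0 b (fps_X ^ Suc m * f)" by (rule obtain_W)
      have "fps_X ^ m dvd fps_X ^ Suc m * f" by (intro dvd_mult2 le_imp_power_dvd) simp
      then have "u = \<phi> 0 0 b 0" unfolding u eq_iff by simp
      then show "br u v \<in> {0}"
        using v True by (auto elim!: obtain_coords simp: bracket series_op_def)
    qed simp
    then have "lower_central V br (Suc (Suc m)) = {0}"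
      using subspace_0[OF subspace_bracket_span] by auto
    then show ?thesis using nilpotent unfolding nilpotent_algebra_def by blast
  next
    case False
    have QX: "(Q * fps_X ^ (m - Suc 0)) $ (m - Suc 0) = 0"
      "(Q * (fps_const c * fps_X ^ (m - Suc 0))) $ (m - Suc 0) = 0" for c
      using PQ by (simp_all add: fps_X_power_mult_right_nth flip: mult.assoc)
    have sx: "br x z + br z x = \<phi> 0 0 \<sigma> (fps_const \<sigma>' * fps_X ^ (m - 1))"
      and sy: "br y z + br z y = \<phi> 0 0 \<tau> (fps_const \<tau>' * fps_X ^ (m - 1))"
      by (simp_all add: bracket add)
    have LA: "c * (\<kappa> + \<alpha> * real (m - 1)) = 0" if "br (\<phi> 0 0 b (fps_const c * fps_X ^ (m - 1))) z = 0" for b c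
    proof -
      have "\<forall>k<m. series_op \<alpha> \<kappa> Q (fps_const c * fps_X ^ (m - 1)) $ k = 0"
        using that m1 unfolding bracket ker fps_X_power_dvd_iff by simp
      then have "series_op \<alpha> \<kappa> Q (fps_const c * fps_X ^ (m - 1)) $ (m - 1) = 0"
        using m1 by blast
      then show ?thesis by (simp add: series_op_scale series_op_nth QX)
    qed
    have 1: "\<sigma>' * (\<kappa> + \<alpha> * real (m - 1)) = 0" "\<tau>' * (\<kappa> + \<alpha> * real (m - 1)) = 0"
      using LA[of \<sigma> \<sigma>'] LA[of \<tau> \<tau>'] symmetric_left_annihilator[of x z] symmetric_left_annihilator[of y z]
      by (simp_all add: sx sy)
    have top: "f $ (m - 1) = g $ (m - 1)" if "\<phi> s a b f = \<phi> s' a' b' g" for s a b f s' a' b' g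
      using that m1 by (simp add: eq_nth_iff)
    have "br (br z x) z = br z (br x z) - br x (br z z)" "br (br z y) z = br z (br y z) - br y (br z z)"
      using leib[of z x z] leib[of z y z] by simp_all
    note this[unfolded bracket diff, THEN top]
    then have 2: "\<alpha> * \<sigma>' = \<sigma>' * (\<kappa> + \<alpha> * real (m - 1))" "\<kappa> * \<tau>' = \<tau>' * (\<kappa> + \<alpha> * real (m - 1))"
      using m1 m2 PQ by (simp_all add: series_op_nth QX algebra_simps)
    \<comment> \<open>Together the equations give \<alpha> \<sigma>' = 0 and \<kappa> \<tau>' = 0.
      If the weight in front vanishes, the other one does not, and then the first pair of equations
      applies; for \<tau>' this uses m \<noteq> 1.\<close>
    have 3: "\<sigma>' = 0" "\<tau>' = 0"
      using 1 2 False m1 by auto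
    show ?thesis
      by (rule model[of \<alpha> \<kappa> P Q p q \<sigma> \<tau> A B], unfold_locales)
        (use PQ False bracket in \<open>auto simp: 3\<close>)
  qed
qed

end

section \<open>Reduction to the normal forms\<close>

lemma series_op_zero [simp]: "series_op \<alpha> \<kappa> Q 0 = 0"
  by (simp add: series_op_def)

text \<open>These are the e_2-components of the Leibniz identity for z, x, z and for z, y, z, and
  the vanishing of [[z, z], z]. Adding multiples of e_2 to x and y offers one constant each for the
  pairs p, \<sigma> and q, \<tau>; the relations make that enough.\<close>

lemma (in L2_model) constraints:
  assumes "left_leibniz_algebra V br"
  shows "\<kappa> * P $ 1 + p * (\<alpha> + \<kappa>) = \<kappa> * \<sigma>"
    and "\<kappa> * Q $ 1 + q * (\<alpha> + \<kappa>) = \<alpha> * \<tau>"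
    and "B * (\<kappa> + \<alpha> * (real m - 1)) = 0"
    and "m = 2 \<Longrightarrow> \<kappa> * B = 0"
proof -
  have leib: "br (br u v) w = br u (br v w) - br v (br u w)" if "u \<in> V" "v \<in> V" "w \<in> V" for u v w
    using assms that by (simp add: left_leibniz_algebra_def)
  have m1: "m - 1 \<noteq> 0" "m - 1 < m" using m2 by auto
  have comp: "b = b'" if "\<phi> s a b f = \<phi> s' a' b' f'" for s a b f s' a' b' f'
    using that by (simp add: eq_iff)
  have lx: "br (br (\<phi> 1 0 0 0) (\<phi> 0 1 0 0)) (\<phi> 1 0 0 0)
      = br (\<phi> 1 0 0 0) (br (\<phi> 0 1 0 0) (\<phi> 1 0 0 0)) - br (\<phi> 0 1 0 0) (br (\<phi> 1 0 0 0) (\<phi> 1 0 0 0))"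
    and ly: "br (br (\<phi> 1 0 0 0) (\<phi> 0 0 0 1)) (\<phi> 1 0 0 0)
      = br (\<phi> 1 0 0 0) (br (\<phi> 0 0 0 1) (\<phi> 1 0 0 0)) - br (\<phi> 0 0 0 1) (br (\<phi> 1 0 0 0) (\<phi> 1 0 0 0))"
    by (rule leib; simp)+
  show "\<kappa> * P $ 1 + p * (\<alpha> + \<kappa>) = \<kappa> * \<sigma>"
    using comp[OF lx[unfolded bracket diff]] m1 P0 Q0 by (simp add: algebra_simps)
  show "\<kappa> * Q $ 1 + q * (\<alpha> + \<kappa>) = \<alpha> * \<tau>"
    using comp[OF ly[unfolded bracket diff]] m1 P0 Q0 by (simp add: series_op_nth algebra_simps)
  have zz: "br (\<phi> 1 0 0 0) (\<phi> 1 0 0 0) = \<phi> 0 0 A (fps_const B * fps_X ^ (m - 1))"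
    by (simp add: bracket series_op_def)
  have "br (\<phi> 0 0 A (fps_const B * fps_X ^ (m - 1))) (\<phi> 1 0 0 0) = 0"
    unfolding zz[symmetric] using leib[of "\<phi> 1 0 0 0" "\<phi> 1 0 0 0" "\<phi> 1 0 0 0"] by simp
  then have *: "\<kappa> * (B * (fps_X ^ (m - 1) :: real fps) $ 1) = 0"
    "\<forall>k<m. series_op \<alpha> \<kappa> Q (fps_const B * fps_X ^ (m - 1)) $ k = 0"
    using m1 unfolding bracket ker fps_X_power_dvd_iff by auto
  then have "series_op \<alpha> \<kappa> Q (fps_const B * fps_X ^ (m - 1)) $ (m - 1) = 0" using m1 by blast
  then show "B * (\<kappa> + \<alpha> * (real m - 1)) = 0"
    using Q0 m2 by (simp add: series_op_scale series_op_nth fps_X_power_mult_right_nth of_nat_diff)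
  show "m = 2 \<Longrightarrow> \<kappa> * B = 0" using *(1) by simp
qed

text \<open>All substitutions used are block triangular: the z-coordinate stands alone, x and the
  series may depend on it, and e_2 on everything. Injectivity can therefore be checked block by
  block.\<close>

lemma coords_reparametrise:
  assumes c: "coords m V \<phi>"
    and \<psi>: "\<And>s a b f. \<psi> s a b f = \<phi> (S s) (F1 s a) (F2 s a b f) (F3 s f)"
    and lin: "\<And>s s'. S (s + s') = S s + S s'" "\<And>c s. S (c * s) = c * S s"
      "\<And>s s' a a'. F1 (s + s') (a + a') = F1 s a + F1 s' a'" "\<And>c s a. F1 (c * s) (c * a) = c * F1 s a"
      "\<And>s s' a a' b b' f f'. F2 (s + s') (a + a') (b + b') (f + f') = F2 s a b f + F2 s' a' b' f'"
      "\<And>c s a b f. F2 (c * s) (c * a) (c * b) (fps_const c * f) = c * F2 s a b f"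
      "\<And>s s' f f'. F3 (s + s') (f + f') = F3 s f + F3 s' f'"
      "\<And>c s f. F3 (c * s) (fps_const c * f) = fps_const c * F3 s f"
    and surj: "\<And>s a b f. \<exists>s' a' b' f'. s = S s' \<and> a = F1 s' a' \<and> b = F2 s' a' b' f' \<and> f = F3 s' f'"
    and inj: "\<And>s. S s = 0 \<Longrightarrow> s = 0" "\<And>a. F1 0 a = 0 \<Longrightarrow> a = 0"
      "\<And>b f. fps_X ^ m dvd f \<Longrightarrow> F2 0 0 b f = 0 \<longleftrightarrow> b = 0" "\<And>f. fps_X ^ m dvd F3 0 f \<longleftrightarrow> fps_X ^ m dvd f"
  shows "coords m V \<psi>"
proof -
  interpret coords m V \<phi> by (rule c)
  have z: "S 0 = 0" "F1 0 0 = 0" "F2 0 0 0 0 = 0" using lin(2)[of 0 0] lin(4)[of 0 0 0] lin(6)[of 0 0 0 0 0] by simp_all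
  show ?thesis
  proof
    show "V = {\<psi> s a b f | s a b f. True}"
    proof
      show "V \<subseteq> {\<psi> s a b f | s a b f. True}"
      proof
        fix v assume "v \<in> V"
        then obtain s a b f where v: "v = \<phi> s a b f" by (rule obtain_coords)
        obtain s' a' b' f' where "s = S s'" "a = F1 s' a'" "b = F2 s' a' b' f'" "f = F3 s' f'"
          using surj by metis
        then have "v = \<psi> s' a' b' f'" by (simp add: v \<psi>)
        then show "v \<in> {\<psi> s a b f | s a b f. True}" by blast
      qed
    qed (auto simp: \<psi>)
    show "\<psi> s a b f = 0 \<longleftrightarrow> s = 0 \<and> a = 0 \<and> b = 0 \<and> fps_X ^ m dvd f" for s a b f
      unfolding \<psi> ker
    proof
      assume *: "S s = 0 \<and> F1 s a = 0 \<and> F2 s a b f = 0 \<and> fps_X ^ m dvd F3 s f"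
      then have "s = 0" using inj(1) by blast
      moreover from this * have "a = 0" using inj(2) by blast
      moreover from calculation * have "fps_X ^ m dvd f" using inj(4) by blast
      moreover from calculation * have "b = 0" using inj(3) by blast
      ultimately show "s = 0 \<and> a = 0 \<and> b = 0 \<and> fps_X ^ m dvd f" by blast
    next
      assume "s = 0 \<and> a = 0 \<and> b = 0 \<and> fps_X ^ m dvd f"
      then show "S s = 0 \<and> F1 s a = 0 \<and> F2 s a b f = 0 \<and> fps_X ^ m dvd F3 s f"
        using inj(3)[of f 0] inj(4)[of f] z by blast
    qed
  qed (simp_all add: \<psi> add scale lin m2)
qed

section \<open>Effect of elementary changes of basis on the parameters\<close>

lemma L2_model_scale_z:
  assumes "L2_model m V \<phi> br \<alpha> \<kappa> P Q p q \<sigma> \<tau> A B" "c \<noteq> 0"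
  shows "L2_model m V (\<lambda>s a b f. \<phi> (c * s) a b f) br (c * \<alpha>) (c * \<kappa>) (fps_const c * P) (fps_const c * Q)
    (c * p) (c * q) (c * \<sigma>) (c * \<tau>) (c * c * A) (c * c * B)"
proof -
  interpret L2_model m V \<phi> br \<alpha> \<kappa> P Q p q \<sigma> \<tau> A B by fact
  have op: "series_op (c * \<alpha>) (c * \<kappa>) (fps_const c * Q) f = fps_const c * series_op \<alpha> \<kappa> Q f" for f
    by (simp add: series_op_def algebra_simps flip: fps_const_mult)
  interpret new: coords m V "\<lambda>s a b f. \<phi> (c * s) a b f"
    by (rule coords_reparametrise[OF coords_axioms, where S = "\<lambda>s. c * s" and ?F1.0 = "\<lambda>s a. a"
          and ?F2.0 = "\<lambda>s a b f. b" and ?F3.0 = "\<lambda>s f. f"])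
      (use assms in \<open>auto simp: algebra_simps intro!: exI[of _ "_ / c"]\<close>)
  show ?thesis
  proof
    fix s a b f s' a' b' f'
    show "br (\<phi> (c * s) a b f) (\<phi> (c * s') a' b' f') =
      \<phi> (c * 0) (c * \<alpha> * (s * a' - s' * a))
        (a * f' $ 0 + s * (c * p * a' + (c * \<alpha> + c * \<kappa>) * b' + c * q * f' $ 0)
          + s' * ((c * \<sigma> - c * p) * a + (c * \<tau> - c * q) * f $ 0 + c * \<kappa> * f $ 1) + s * s' * (c * c * A))
        (fps_X * (fps_const a' * f - fps_const a * f')
          + fps_const s * (series_op (c * \<alpha>) (c * \<kappa>) (fps_const c * Q) f' + fps_const a' * (fps_const c * P))
          - fps_const s' * (series_op (c * \<alpha>) (c * \<kappa>) (fps_const c * Q) f + fps_const a * (fps_const c * P))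
          + fps_const (s * s' * (c * c * B)) * fps_X ^ (m - 1))"
      unfolding bracket op
      by (rule arg_cong4[where f = \<phi>]) (simp_all add: algebra_simps flip: fps_const_mult)
  qed (simp_all add: P0 Q0)
qed

text \<open>Translates z by u x + v e_2 + g. As [g, x] = t g and [x, f] has series part -t f, this
  adds t g to P and subtracts u t from Q, so all of P and the linear coefficient of Q can be
  removed.\<close>

lemma L2_model_shift_z:
  assumes "L2_model m V \<phi> br \<alpha> \<kappa> P Q p q \<sigma> \<tau> A B"
  shows "L2_model m V (\<lambda>s a b f. \<phi> s (a + s * u) (b + s * v) (f + fps_const s * g)) br \<alpha> \<kappa>
    (P + fps_X * g) (Q - fps_const u * fps_X) p (q + u) (\<sigma> + g $ 0) (\<tau> + u)
    (A + \<sigma> * u + (\<alpha> + \<kappa>) * v + \<tau> * g $ 0 + \<kappa> * g $ 1 + u * g $ 0) B"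
proof -
  interpret L2_model m V \<phi> br \<alpha> \<kappa> P Q p q \<sigma> \<tau> A B by fact
  have op: "series_op \<alpha> \<kappa> (Q - fps_const u * fps_X) f = series_op \<alpha> \<kappa> Q f - fps_const u * (fps_X * f)" for f
    by (simp add: series_op_def algebra_simps)
  interpret new: coords m V "\<lambda>s a b f. \<phi> s (a + s * u) (b + s * v) (f + fps_const s * g)"
  proof (rule coords_reparametrise[OF coords_axioms, where S = "\<lambda>s. s" and ?F1.0 = "\<lambda>s a. a + s * u"
          and ?F2.0 = "\<lambda>s a b f. b + s * v" and ?F3.0 = "\<lambda>s f. f + fps_const s * g"], goal_cases)
    case (10 s a b f)
    show ?case
      by (intro exI[of _ s] exI[of _ "a - s * u"] exI[of _ "b - s * v"] exI[of _ "f - fps_const s * g"]) simp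
  qed (auto simp: algebra_simps simp flip: fps_const_add fps_const_mult)
  show ?thesis
  proof
    fix s a b f s' a' b' f'
    show "br (\<phi> s (a + s * u) (b + s * v) (f + fps_const s * g))
        (\<phi> s' (a' + s' * u) (b' + s' * v) (f' + fps_const s' * g)) =
      \<phi> 0 (\<alpha> * (s * a' - s' * a) + 0 * u)
        (a * f' $ 0 + s * (p * a' + (\<alpha> + \<kappa>) * b' + (q + u) * f' $ 0)
          + s' * ((\<sigma> + g $ 0 - p) * a + (\<tau> + u - (q + u)) * f $ 0 + \<kappa> * f $ 1)
          + s * s' * (A + \<sigma> * u + (\<alpha> + \<kappa>) * v + \<tau> * g $ 0 + \<kappa> * g $ 1 + u * g $ 0) + 0 * v)
        (fps_X * (fps_const a' * f - fps_const a * f')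
          + fps_const s * (series_op \<alpha> \<kappa> (Q - fps_const u * fps_X) f' + fps_const a' * (P + fps_X * g))
          - fps_const s' * (series_op \<alpha> \<kappa> (Q - fps_const u * fps_X) f + fps_const a * (P + fps_X * g))
          + fps_const (s * s' * B) * fps_X ^ (m - 1) + fps_const 0 * g)"
      unfolding bracket op series_op_add series_op_scale
      by (rule arg_cong4[where f = \<phi>])
        (simp_all add: op series_op_add series_op_scale algebra_simps flip: fps_const_add fps_const_mult)
  qed (use P0 Q0 in simp_all)
qed

text \<open>Replaces x by x + c e_2 and y by h + d e_2. Conjugating the operator of z by the unit h
  adds \<alpha> times t h' / h to Q. The term \<kappa> h_1 appears because the coefficient of t in h
  f is f_1 + h_1 f_0.\<close>

lemma L2_model_change_xy:
  assumes "L2_model m V \<phi> br \<alpha> \<kappa> P Q p q \<sigma> \<tau> A B" and h: "h $ 0 = 1"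
  shows "L2_model m V (\<lambda>s a b f. \<phi> s a (b + c * a + d * f $ 0) (h * f)) br \<alpha> \<kappa>
    (P * inverse h) (Q + fps_const \<alpha> * (fps_X * fps_deriv h * inverse h)) (p + \<kappa> * c) (q + \<alpha> * d)
    (\<sigma> + (\<alpha> + \<kappa>) * c) (\<tau> + (\<alpha> + \<kappa>) * d + \<kappa> * h $ 1) A B"
proof -
  interpret L2_model m V \<phi> br \<alpha> \<kappa> P Q p q \<sigma> \<tau> A B by fact
  have hh: "h * inverse h = 1" using h by (simp add: inverse_mult_eq_1')
  have inv: "h * (inverse h * f) = f" for f by (simp add: hh flip: mult.assoc)
  interpret new: coords m V "\<lambda>s a b f. \<phi> s a (b + c * a + d * f $ 0) (h * f)"
  proof (rule coords_reparametrise[OF coords_axioms, where S = "\<lambda>s. s" and ?F1.0 = "\<lambda>s a. a"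
          and ?F2.0 = "\<lambda>s a b f. b + c * a + d * f $ 0" and ?F3.0 = "\<lambda>s f. h * f"], goal_cases)
    case (10 s a b f)
    show ?case
      by (intro exI[of _ s] exI[of _ a] exI[of _ "b - c * a - d * (inverse h * f) $ 0"] exI[of _ "inverse h * f"])
        (simp add: inv)
  next
    case (13 b f)
    then have "f $ 0 = 0" using m2 by (simp add: fps_X_power_dvd_iff)
    then show ?case by simp
  next
    case (14 f)
    show ?case
    proof
      assume "fps_X ^ m dvd h * f"
      then have "fps_X ^ m dvd inverse h * (h * f)" by (rule dvd_mult)
      also have "inverse h * (h * f) = f" using inv by (simp add: mult.left_commute)
      finally show "fps_X ^ m dvd f" .
    qed (rule dvd_mult)
  qed (auto simp: algebra_simps)
  have op: "series_op \<alpha> \<kappa> Q (h * f) = h * series_op \<alpha> \<kappa> (Q + fps_const \<alpha> * (fps_X * fps_deriv h * inverse h)) f" for f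
  proof -
    have "h * series_op \<alpha> \<kappa> (Q + fps_const \<alpha> * (fps_X * fps_deriv h * inverse h)) f =
      fps_const \<kappa> * (h * f) + fps_const \<alpha> * (fps_X * (h * fps_deriv f)) + Q * (h * f)
      + (h * inverse h) * (fps_const \<alpha> * (fps_X * fps_deriv h * f))"
      by (simp add: series_op_def algebra_simps)
    also have "\<dots> = series_op \<alpha> \<kappa> Q (h * f)"
      by (simp add: hh series_op_def algebra_simps)
    finally show ?thesis by simp
  qed
  have Pinv: "h * (P * inverse h) = P" using inv[of P] by (simp add: mult.commute)
  \<comment> \<open>The unit h is 1 modulo t, so it fixes t^(m-1) modulo t^m and leaves B
    unchanged.\<close>
  have top: "fps_X ^ m dvd fps_X ^ (m - 1) - h * fps_X ^ (m - 1)"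
    using h by (auto simp: fps_X_power_dvd_iff fps_X_power_mult_right_nth)
  let ?Q = "Q + fps_const \<alpha> * (fps_X * fps_deriv h * inverse h)"
  show ?thesis
  proof
    fix s a b f s' a' b' f'
    let ?f = "fps_X * (fps_const a' * f - fps_const a * f')
          + fps_const s * (series_op \<alpha> \<kappa> ?Q f' + fps_const a' * (P * inverse h))
          - fps_const s' * (series_op \<alpha> \<kappa> ?Q f + fps_const a * (P * inverse h))
          + fps_const (s * s' * B) * fps_X ^ (m - 1)"
    have f0: "?f $ 0 = \<kappa> * (s * f' $ 0 - s' * f $ 0)"
      using m2 P0 Q0 by (simp add: series_op_nth algebra_simps)
    have hf: "fps_X * (fps_const a' * (h * f) - fps_const a * (h * f'))
          + fps_const s * (series_op \<alpha> \<kappa> Q (h * f') + fps_const a' * P)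
          - fps_const s' * (series_op \<alpha> \<kappa> Q (h * f) + fps_const a * P)
          + fps_const (s * s' * B) * fps_X ^ (m - 1) - h * ?f
        = fps_const (s * s' * B) * (fps_X ^ (m - 1) - h * fps_X ^ (m - 1))"
      unfolding op by (subst (1 2) Pinv[symmetric]) (simp only: algebra_simps)
    show "br (\<phi> s a (b + c * a + d * f $ 0) (h * f)) (\<phi> s' a' (b' + c * a' + d * f' $ 0) (h * f')) =
      \<phi> 0 (\<alpha> * (s * a' - s' * a))
        (a * f' $ 0 + s * ((p + \<kappa> * c) * a' + (\<alpha> + \<kappa>) * b' + (q + \<alpha> * d) * f' $ 0)
          + s' * ((\<sigma> + (\<alpha> + \<kappa>) * c - (p + \<kappa> * c)) * a
            + (\<tau> + (\<alpha> + \<kappa>) * d + \<kappa> * h $ 1 - (q + \<alpha> * d)) * f $ 0 + \<kappa> * f $ 1)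
          + s * s' * A + c * (\<alpha> * (s * a' - s' * a)) + d * ?f $ 0) (h * ?f)"
      unfolding bracket eq_iff
    proof (intro conjI)
      show "fps_X ^ m dvd fps_X * (fps_const a' * (h * f) - fps_const a * (h * f'))
          + fps_const s * (series_op \<alpha> \<kappa> Q (h * f') + fps_const a' * P)
          - fps_const s' * (series_op \<alpha> \<kappa> Q (h * f) + fps_const a * P)
          + fps_const (s * s' * B) * fps_X ^ (m - 1) - h * ?f"
        unfolding hf by (rule dvd_mult[OF top])
    qed (simp_all only: f0, simp_all add: h fps_mult_nth_1 algebra_simps)
  qed (use P0 Q0 in simp_all)
qed

lemma L2_model_cong_P:
  assumes "L2_model m V \<phi> br \<alpha> \<kappa> P Q p q \<sigma> \<tau> A B" and P': "fps_X ^ m dvd P - P'"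
  shows "L2_model m V \<phi> br \<alpha> \<kappa> P' Q p q \<sigma> \<tau> A B"
proof -
  interpret L2_model m V \<phi> br \<alpha> \<kappa> P Q p q \<sigma> \<tau> A B by fact
  have nth: "P' $ k = P $ k" if "k < m" for k
    using P' that by (simp add: fps_X_power_dvd_iff)
  show ?thesis
    by unfold_locales (use nth[of 0] m2 P0 Q0 in \<open>simp_all add: bracket eq_nth_iff nth\<close>)
qed

text \<open>Scaling y forces the same scaling of e_2. The factor may have either sign, so a nonzero
  coefficient in B, or of t^2 in P, can be made 1.\<close>

lemma L2_model_scale_y:
  assumes "L2_model m V \<phi> br \<alpha> \<kappa> P Q 0 0 0 0 0 B" and t: "t \<noteq> 0"
  shows "L2_model m V (\<lambda>s a b f. \<phi> s a (t * b) (fps_const t * f)) br \<alpha> \<kappa>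
    (fps_const (1 / t) * P) Q 0 0 0 0 0 (B / t)"
proof -
  interpret L2_model m V \<phi> br \<alpha> \<kappa> P Q 0 0 0 0 0 B by fact
  have tt: "fps_const t * (fps_const (1 / t) * f) = f" for f
    using t by (simp flip: mult.assoc)
  interpret new: coords m V "\<lambda>s a b f. \<phi> s a (t * b) (fps_const t * f)"
  proof (rule coords_reparametrise[OF coords_axioms, where S = "\<lambda>s. s" and ?F1.0 = "\<lambda>s a. a"
          and ?F2.0 = "\<lambda>s a b f. t * b" and ?F3.0 = "\<lambda>s f. fps_const t * f"], goal_cases)
    case (10 s a b f)
    show ?case
      by (intro exI[of _ s] exI[of _ a] exI[of _ "b / t"] exI[of _ "fps_const (1 / t) * f"])
        (use t in \<open>simp add: tt\<close>)
  qed (use t in \<open>auto simp: algebra_simps fps_X_power_dvd_iff\<close>)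
  show ?thesis
  proof
    fix s a b f s' a' b' f'
    show "br (\<phi> s a (t * b) (fps_const t * f)) (\<phi> s' a' (t * b') (fps_const t * f')) =
      \<phi> 0 (\<alpha> * (s * a' - s' * a))
        (t * (a * f' $ 0 + s * (0 * a' + (\<alpha> + \<kappa>) * b' + 0 * f' $ 0)
          + s' * ((0 - 0) * a + (0 - 0) * f $ 0 + \<kappa> * f $ 1) + s * s' * 0))
        (fps_const t * (fps_X * (fps_const a' * f - fps_const a * f')
          + fps_const s * (series_op \<alpha> \<kappa> Q f' + fps_const a' * (fps_const (1 / t) * P))
          - fps_const s' * (series_op \<alpha> \<kappa> Q f + fps_const a * (fps_const (1 / t) * P))
          + fps_const (s * s' * (B / t)) * fps_X ^ (m - 1)))"
      unfolding bracket eq_nth_iff using t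
      by (simp add: series_op_scale series_op_scale' algebra_simps)
  qed (use P0 Q0 in simp_all)
qed

text \<open>Scaling x scales the variable of the series by the same factor, whence the substitution.
  The quadratic coefficient of Q is divided by the square of that factor.\<close>

lemma L2_model_scale_x:
  assumes "L2_model m V \<phi> br \<alpha> \<kappa> 0 Q 0 0 0 0 0 0" and t: "t \<noteq> 0"
  shows "L2_model m V (\<lambda>s a b f. \<phi> s (t * a) (t * b) (fps_compose f (fps_const t * fps_X))) br \<alpha> \<kappa>
    0 (fps_compose Q (fps_const (1 / t) * fps_X)) 0 0 0 0 0 0"
proof -
  interpret L2_model m V \<phi> br \<alpha> \<kappa> 0 Q 0 0 0 0 0 0 by fact
  define D :: "real \<Rightarrow> real fps \<Rightarrow> real fps" where "D t f = fps_compose f (fps_const t * fps_X)" for t f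
  have nth: "D t f $ k = t ^ k * f $ k" for t f k
    by (simp add: D_def)
  have inv: "D t (D (1 / t) f) = f" for f
    using t by (simp add: fps_eq_iff nth power_one_over)
  have op: "series_op \<alpha> \<kappa> Q (D t f) = D t (series_op \<alpha> \<kappa> (D (1 / t) Q) f)" for f
  proof -
    have "Q * D t f = D t (D (1 / t) Q * f)"
      using inv[of Q] by (simp add: D_def fps_compose_mult_distrib)
    then have "(Q * D t f) $ k = t ^ k * (D (1 / t) Q * f) $ k" for k
      by (simp only: nth)
    then show ?thesis
      by (intro fps_ext) (simp add: series_op_nth nth algebra_simps)
  qed
  interpret new: coords m V "\<lambda>s a b f. \<phi> s (t * a) (t * b) (D t f)"
  proof (rule coords_reparametrise[OF coords_axioms, where S = "\<lambda>s. s" and ?F1.0 = "\<lambda>s a. t * a"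
          and ?F2.0 = "\<lambda>s a b f. t * b" and ?F3.0 = "\<lambda>s f. D t f"], goal_cases)
    case (10 s a b f)
    show ?case
      by (intro exI[of _ s] exI[of _ "a / t"] exI[of _ "b / t"] exI[of _ "D (1 / t) f"])
        (use t inv in simp)
  qed (use t in \<open>auto simp: algebra_simps fps_X_power_dvd_iff nth fps_eq_iff\<close>)
  have "L2_model m V (\<lambda>s a b f. \<phi> s (t * a) (t * b) (D t f)) br \<alpha> \<kappa> 0 (D (1 / t) Q) 0 0 0 0 0 0"
  proof
    fix s a b f s' a' b' f'
    let ?f = "fps_X * (fps_const a' * f - fps_const a * f')
          + fps_const s * (series_op \<alpha> \<kappa> (D (1 / t) Q) f' + fps_const a' * 0)
          - fps_const s' * (series_op \<alpha> \<kappa> (D (1 / t) Q) f + fps_const a * 0)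
          + fps_const (s * s' * 0) * fps_X ^ (m - 1)"
    have "D t ?f = fps_const t * (fps_const a' * (fps_X * D t f) - fps_const a * (fps_X * D t f'))
        + fps_const s * series_op \<alpha> \<kappa> Q (D t f') - fps_const s' * series_op \<alpha> \<kappa> Q (D t f)"
      unfolding op by (simp add: fps_eq_iff nth algebra_simps) (auto simp: power_eq_if)
    then show "br (\<phi> s (t * a) (t * b) (D t f)) (\<phi> s' (t * a') (t * b') (D t f')) =
      \<phi> 0 (t * (\<alpha> * (s * a' - s' * a)))
        (t * (a * f' $ 0 + s * (0 * a' + (\<alpha> + \<kappa>) * b' + 0 * f' $ 0)
          + s' * ((0 - 0) * a + (0 - 0) * f $ 0 + \<kappa> * f $ 1) + s * s' * 0)) (D t ?f)"
      unfolding bracket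
      by (intro arg_cong4[where f = \<phi>]) (simp_all add: nth algebra_simps flip: fps_const_mult)
  qed (use P0 Q0 in \<open>simp_all add: nth\<close>)
  then show ?thesis by (simp only: D_def)
qed

section \<open>Standard forms for both types\<close>

lemma fps_linear_ode:
  obtains h :: "real fps" where "h $ 0 = 1" "fps_deriv h = g * h"
proof
  let ?h = "fps_compose (fps_exp 1) (fps_integral0 g)"
  show "?h $ 0 = 1" by simp
  show "fps_deriv ?h = g * ?h"
    by (simp add: fps_compose_deriv fps_deriv_fps_integral)
qed

definition L2_standard_form :: "nat \<Rightarrow> 'a::real_vector set \<Rightarrow> ('a \<Rightarrow> 'a \<Rightarrow> 'a) \<Rightarrow> real \<Rightarrow> real \<Rightarrow>
    real fps \<Rightarrow> real fps \<Rightarrow> real \<Rightarrow> bool" where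
  "L2_standard_form m V br \<alpha> \<kappa> P Q B \<longleftrightarrow> (\<exists>\<phi>. L2_model m V \<phi> br \<alpha> \<kappa> P Q 0 0 0 0 0 B)"

lemma standard_form_rank_one:
  assumes M: "L2_model m V \<phi> br \<alpha> \<kappa> P Q p q \<sigma> \<tau> A B" and V: "left_leibniz_algebra V br" and "\<alpha> \<noteq> 0"
  shows "(\<exists>a. L2_standard_form m V br (- 1) (1 - a) 0 0 0) \<or>
    3 \<le> m \<and> L2_standard_form m V br (- 1) 1 (- (fps_const 1 * fps_X ^ 2)) 0 0 \<or>
    3 \<le> m \<and> L2_standard_form m V br (- 1) (real m - 1) 0 0 1"
proof -
  obtain \<phi>0 \<kappa> P Q p q \<sigma> \<tau> A B where M0: "L2_model m V \<phi>0 br (- 1) \<kappa> P Q p q \<sigma> \<tau> A B"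
    using L2_model_scale_z[OF M, of "- 1 / \<alpha>"] \<open>\<alpha> \<noteq> 0\<close> by auto
  have "P + fps_X * (- fps_shift 1 P) = 0"
    using L2_model.P0[OF M0] by (simp add: fps_eq_iff)
  then obtain \<phi>1 \<sigma> A where M1: "L2_model m V \<phi>1 br (- 1) \<kappa> 0 Q p q \<sigma> \<tau> A B"
    using L2_model_shift_z[OF M0, of 0 0 "- fps_shift 1 P"] by auto
  note C = L2_model.constraints[OF M1 V]
  have m: "2 \<le> m" using M1 by (simp add: L2_model_def coords_def)
  obtain h where h: "h $ 0 = 1" "fps_deriv h = fps_shift 1 Q * h" by (rule fps_linear_ode)
  have h1: "h $ 1 = Q $ 1" using arg_cong[OF h(2), of "\<lambda>f. f $ 0"] h(1) by simp
  have "fps_X * fps_shift 1 Q = Q" using L2_model.Q0[OF M1] by (simp add: fps_eq_iff)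
  then have "fps_X * fps_deriv h * inverse h = Q * (h * inverse h)"
    unfolding h(2) by (metis mult.assoc)
  then have Qh: "fps_X * fps_deriv h * inverse h = Q" using h(1) by (simp add: inverse_mult_eq_1')
  \<comment> \<open>c has to remove p and \<sigma> at once. For \<kappa> \<noteq> 0 the first
    constraint makes -p / \<kappa> suit both; for \<kappa> = 0 it says p = 0, and c is free to
    remove \<sigma>. Likewise d = q removes \<tau> by the second constraint.\<close>
  define c where "c = (if \<kappa> = 0 then \<sigma> else - p / \<kappa>)"
  have "p + \<kappa> * c = 0" "\<sigma> + (- 1 + \<kappa>) * c = 0" "\<tau> + (- 1 + \<kappa>) * q + \<kappa> * h $ 1 = 0"
    using C(1,2) by (auto simp: c_def h1[simplified] field_simps)
  then obtain \<phi>2 where M2: "L2_model m V \<phi>2 br (- 1) \<kappa> 0 0 0 0 0 0 A B"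
    using L2_model_change_xy[OF M1 h(1), of c q] by (auto simp: Qh simp flip: fps_const_neg)
  show ?thesis
  proof (cases "\<kappa> = 1")
    case False
    then have "A + (- 1 + \<kappa>) * (- A / (- 1 + \<kappa>)) = 0" by simp
    then obtain \<phi>3 where M3: "L2_model m V \<phi>3 br (- 1) \<kappa> 0 0 0 0 0 0 0 B"
      using L2_model_shift_z[OF M2, of 0 "- A / (- 1 + \<kappa>)" 0] by auto
    show ?thesis
    proof (cases "B = 0")
      case True
      then have "L2_standard_form m V br (- 1) (1 - (1 - \<kappa>)) 0 0 0"
        using M3 by (auto simp: L2_standard_form_def)
      then show ?thesis by blast
    next
      case B: False
      then have \<kappa>: "\<kappa> = real m - 1" and "m \<noteq> 2" using C(3,4) by auto
      then have "3 \<le> m" using m by simp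
      moreover have "L2_standard_form m V br (- 1) (real m - 1) 0 0 1"
        using L2_model_scale_y[OF M3 B] B \<kappa> by (auto simp: L2_standard_form_def)
      ultimately show ?thesis by blast
    qed
  next
    case True
    \<comment> \<open>The weight of t^(m-1) is now 2 - m, so B can be nonzero only for m = 2, which
      the last constraint excludes.\<close>
    then have "B = 0" using C(3,4) m by auto
    \<comment> \<open>Since e_2 has weight zero, translation by e_2 leaves A unchanged. Translation
      by g = -A t removes A through the term \<kappa> g_1, at the price of t g = -A t^2 in
      P.\<close>
    then obtain \<phi>3 where M3: "L2_model m V \<phi>3 br (- 1) 1 (- (fps_const A * fps_X ^ 2)) 0 0 0 0 0 0 0"
      using L2_model_shift_z[OF M2, of 0 0 "- (fps_const A * fps_X)"] True
      by (auto simp: power2_eq_square mult.left_commute)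
    show ?thesis
    proof (cases "A = 0 \<or> m = 2")
      case True
      \<comment> \<open>Either A = 0 or t^2 is zero modulo t^m; both give the first family at a =
        0.\<close>
      then have "fps_X ^ m dvd - (fps_const A * fps_X ^ 2) - 0" by auto
      then have "L2_standard_form m V br (- 1) (1 - 0) 0 0 0"
        using L2_model_cong_P[OF M3, of 0] by (auto simp: L2_standard_form_def)
      then show ?thesis by blast
    next
      case False
      then have "L2_standard_form m V br (- 1) 1 (- (fps_const 1 * fps_X ^ 2)) 0 0"
        using L2_model_scale_y[OF M3, of A] by (auto simp: L2_standard_form_def simp flip: mult.assoc)
      then show ?thesis using False m by auto
    qed
  qed
qed

lemma standard_form_rank_zero:
  assumes M: "L2_model m V \<phi> br 0 \<kappa> P Q p q \<sigma> \<tau> A B" and V: "left_leibniz_algebra V br" and "\<kappa> \<noteq> 0"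
  shows "\<exists>\<epsilon> b. \<epsilon> \<in> {0, 1, - 1} \<and> L2_standard_form m V br 0 (- 1) (- ext4_series \<epsilon> b) (ext4_series \<epsilon> b) 0"
proof -
  obtain \<phi>0 P Q p q \<sigma> \<tau> A B where M0: "L2_model m V \<phi>0 br 0 (- 1) P Q p q \<sigma> \<tau> A B"
    using L2_model_scale_z[OF M, of "- 1 / \<kappa>"] \<open>\<kappa> \<noteq> 0\<close> by auto
  define g where "g = - fps_shift 1 P"
  have "P + fps_X * g = 0"
    using L2_model.P0[OF M0] by (simp add: fps_eq_iff g_def)
  \<comment> \<open>u = Q_1 removes the linear coefficient of Q. As \<alpha> + \<kappa> = -1,
    translation by v e_2 changes A by -v, so v is chosen as the sum of all other terms of the new
    A.\<close>
  then obtain \<phi>1 Q q \<sigma> \<tau> where M1: "L2_model m V \<phi>1 br 0 (- 1) 0 Q p q \<sigma> \<tau> 0 B" and Q1: "Q $ 1 = 0"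
    using L2_model_shift_z[OF M0, of "Q $ 1" "A + \<sigma> * Q $ 1 + \<tau> * g $ 0 - g $ 1 + Q $ 1 * g $ 0" g]
    by fastforce
  note C = L2_model.constraints[OF M1 V]
  have "\<sigma> = p" "q = 0" "B = 0" using C Q1 by auto
  \<comment> \<open>For \<alpha> = 0 a unit h has no influence on Q, so h = 1 is taken and only
    e_2-components are adjusted.\<close>
  then obtain \<phi>2 where M2: "L2_model m V \<phi>2 br 0 (- 1) 0 Q 0 0 0 0 0 0"
    using L2_model_change_xy[OF M1, of 1 p \<tau>] by auto
  \<comment> \<open>The quadratic coefficient is going to be divided by the square of this number,
    which turns it into 0, 1 or -1.\<close>
  define t where "t = (if Q $ 2 = 0 then 1 else sqrt \<bar>Q $ 2\<bar>)"
  define R where "R = fps_compose Q (fps_const (1 / t) * fps_X)"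
  have t: "t \<noteq> 0" by (simp add: t_def)
  have R: "R $ k = Q $ k / t ^ k" for k
    by (simp add: R_def fps_compose_linear power_one_over)
  obtain \<phi>3 where M3: "L2_model m V \<phi>3 br 0 (- 1) 0 R 0 0 0 0 0 0"
    using L2_model_scale_x[OF M2 t] by (auto simp: R_def)
  have R01: "R $ 0 = 0" "R $ 1 = 0" using L2_model.Q0[OF M1] Q1 by (simp_all add: R)
  \<comment> \<open>The table of the fourth family has P = -Q, so z is translated once more, by g
    with t g = -R. The accompanying translation by R_2 e_2 cancels the contribution \<kappa> g_1 =
    R_2 to A.\<close>
  have "fps_X * (- fps_shift 1 R) = - R" using R01 by (simp add: fps_eq_iff)
  then obtain \<phi>4 where M4: "L2_model m V \<phi>4 br 0 (- 1) (- R) R 0 0 0 0 0 0"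
    using L2_model_shift_z[OF M3, of 0 "R $ 2" "- fps_shift 1 R"] R01 by (auto simp: numeral_2_eq_2)
  have "R $ 2 \<in> {0, 1, - 1}"
    by (auto simp: R t_def abs_if divide_eq_eq)
  moreover have "ext4_series (- R $ 2) (\<lambda>i. - R $ (i + 2)) = R"
  proof (rule fps_ext)
    fix k
    show "ext4_series (- R $ 2) (\<lambda>i. - R $ (i + 2)) $ k = R $ k"
    proof (cases "k < 2")
      case True
      then show ?thesis using R01 by (auto simp: less_2_cases_iff)
    next
      case False
      then have "k - 2 + 2 = k" by simp
      then show ?thesis using False by (simp only: ext4_series_def fps_neg_nth fps_nth_Abs_fps) simp
    qed
  qed
  ultimately show ?thesis
    using M4 by (intro exI[of _ "- R $ 2"] exI[of _ "\<lambda>i. - R $ (i + 2)"]) (auto simp: L2_standard_form_def)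
qed

section \<open>Classification\<close>

text \<open>The formula is read off from a known extension by restricting it to its nilradical;
  \<open>ext1_bracket n 0\<close> is an arbitrary choice.\<close>

lemma L2_bracket_coord_vec:
  assumes n: "4 \<le> n"
  shows "L2_bracket n (coord_vec n 0 a b f) (coord_vec n 0 a' b' f') =
    coord_vec n 0 0 (a * f' $ 0) (fps_X * (fps_const a' * f - fps_const a * f'))"
proof -
  interpret L2_normal "n - 2" "coord_space (n + 1)" "coord_vec n" "ext1_bracket n 0" "- 1" "1 - 0" 0 0 0
    by (rule L2_normal_ext1[OF n])
  have "coord_vec n 0 a b f \<in> coord_space n" for a b f
    using N_mem coords_N_eq[OF n] by blast
  then have "L2_bracket n (coord_vec n 0 a b f) (coord_vec n 0 a' b' f')
      = ext1_bracket n 0 (coord_vec n 0 a b f) (coord_vec n 0 a' b' f')"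
    unfolding ext1_bracket_def by (subst table_bracket_restrict[of n]) (auto simp: ext1_table_def)
  then show ?thesis by (simp only: bracket_N)
qed

text \<open>Coordinates of V consist of the transported coordinates of \<open>N\<close> and of one
  vector z outside it; counting dimensions shows that z exists and is enough.\<close>

lemma L2_extension_coords:
  assumes n: "4 \<le> n" and V: "left_leibniz_algebra V br" "dim V = n + 1"
    and N: "leibniz_ideal V br N" and iso: "leibniz_isomorphic N br (coord_space n) (L2_bracket n)"
  obtains \<phi> where "L2_ideal_extension (n - 2) V \<phi> br" "V \<noteq> N"
proof -
  interpret c: coords "n - 2" "coord_space (n + 1)" "coord_vec n" by (rule coords_coord_vec[OF n])
  have subV: "subspace V" using V by (simp add: left_leibniz_algebra_def)
  have subN: "subspace N" and NV: "N \<subseteq> V"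
    and N_closed: "\<And>x y. x \<in> N \<Longrightarrow> y \<in> N \<Longrightarrow> br x y \<in> N"
    using N by (auto simp: leibniz_ideal_def)
  have subC: "subspace (coord_space n)" by (simp add: coord_space_def)
  have "left_leibniz_algebra N br"
  proof -
    have "\<exists>B. finite B \<and> V = span B" using V by (simp add: left_leibniz_algebra_def)
    then obtain B0 where B0: "finite B0" "V = span B0" by blast
    obtain B where B: "B \<subseteq> N" "independent B" "N \<subseteq> span B" by (rule basis_exists)
    then have "finite B" using independent_span_bound[OF B0(1), of B] B0(2) NV by blast
    moreover have "N = span B" using B subN by (simp add: span_minimal subset_antisym)
    ultimately have "\<exists>B. finite B \<and> N = span B" by blast
    then show ?thesis
      using V(1) NV subN N_closed unfolding left_leibniz_algebra_def by (auto simp: subset_iff)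
  qed
  then have "leibniz_isomorphic (coord_space n) (L2_bracket n) N br"
    using leibniz_isomorphic_sym iso by blast
  then obtain \<psi> where bij: "bij_betw \<psi> (coord_space n) N"
    and \<psi>_add: "\<And>x y. x \<in> coord_space n \<Longrightarrow> y \<in> coord_space n \<Longrightarrow> \<psi> (x + y) = \<psi> x + \<psi> y"
    and \<psi>_scale: "\<And>c x. x \<in> coord_space n \<Longrightarrow> \<psi> (c *\<^sub>R x) = c *\<^sub>R \<psi> x"
    and \<psi>_br: "\<And>x y. x \<in> coord_space n \<Longrightarrow> y \<in> coord_space n \<Longrightarrow> \<psi> (L2_bracket n x y) = br (\<psi> x) (\<psi> y)"
    unfolding leibniz_isomorphic_def by blast
  have \<psi>N: "\<psi> x \<in> N" if "x \<in> coord_space n" for x using bij that by (auto simp: bij_betw_def)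
  have \<psi>0: "\<psi> x = 0 \<longleftrightarrow> x = 0" if "x \<in> coord_space n" for x
  proof -
    have "\<psi> 0 = 0" using \<psi>_scale[of 0 0] subspace_0[OF subC] by simp
    then show ?thesis using bij that subspace_0[OF subC] by (metis bij_betw_imp_inj_on inj_onD)
  qed
  have ev_in: "ev i \<in> coord_space n" if "i \<in> {1..n}" for i
    using that by (auto simp: coord_space_def intro: span_base)
  have \<psi>_sum: "(\<Sum>i\<in>S. k i *\<^sub>R ev i) \<in> coord_space n \<and>
      \<psi> (\<Sum>i\<in>S. k i *\<^sub>R ev i) = (\<Sum>i\<in>S. k i *\<^sub>R \<psi> (ev i))" if "S \<subseteq> {1..n}" for S k
  proof -
    have "finite S" using that finite_subset by blast
    then show ?thesis using that
    proof (induction S)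
      case empty
      then show ?case using subspace_0[OF subC] \<psi>0 by simp
    next
      case (insert i S)
      then show ?case
        using ev_in by (simp add: \<psi>_add \<psi>_scale subspace_add[OF subC] subspace_scale[OF subC])
    qed
  qed
  define BN where "BN = \<psi> ` ev ` {1..n}"
  have inj: "inj_on \<psi> (ev ` {1..n})"
    using bij ev_in by (auto simp: bij_betw_def inj_on_def)
  have cardBN: "card BN = n"
    unfolding BN_def by (simp only: card_image[OF inj] card_image[OF inj_ev] card_atLeastAtMost add_diff_cancel_right' diff_Suc_1)
  have BN_N: "BN \<subseteq> N" using \<psi>N ev_in by (auto simp: BN_def)
  have spanBN: "span BN = N"
  proof
    show "span BN \<subseteq> N" using BN_N subN by (rule span_minimal)
    show "N \<subseteq> span BN"
    proof
      fix w assume "w \<in> N"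
      then obtain u where u: "u \<in> coord_space n" "w = \<psi> u" using bij by (auto simp: bij_betw_def)
      have "u = (\<Sum>i\<in>{1..n}. Poly_Mapping.lookup u i *\<^sub>R ev i)"
        using u by (intro ev_expansion) (auto simp: mem_coord_space)
      then have "w = (\<Sum>i\<in>{1..n}. Poly_Mapping.lookup u i *\<^sub>R \<psi> (ev i))"
        using \<psi>_sum[of "{1..n}" "Poly_Mapping.lookup u"] u by simp
      also have "\<dots> \<in> span BN" by (intro span_sum span_scale span_base) (auto simp: BN_def)
      finally show "w \<in> span BN" .
    qed
  qed
  have indep: "independent BN"
  proof (rule independent_if_scalars_zero)
    show "finite BN" by (simp add: BN_def)
    fix k w assume 0: "(\<Sum>w\<in>BN. k w *\<^sub>R w) = 0" and "w \<in> BN"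
    then obtain i where i: "i \<in> {1..n}" "w = \<psi> (ev i)" by (auto simp: BN_def)
    let ?u = "\<Sum>i\<in>{1..n}. k (\<psi> (ev i)) *\<^sub>R ev i"
    have u: "?u \<in> coord_space n" "\<psi> ?u = (\<Sum>i\<in>{1..n}. k (\<psi> (ev i)) *\<^sub>R \<psi> (ev i))"
      using \<psi>_sum[OF order_refl, of "\<lambda>i. k (\<psi> (ev i))"] by blast+
    have "(\<Sum>i\<in>{1..n}. k (\<psi> (ev i)) *\<^sub>R \<psi> (ev i)) = (\<Sum>w\<in>BN. k w *\<^sub>R w)"
      unfolding BN_def by (simp only: sum.reindex[OF inj] sum.reindex[OF inj_ev] o_def)
    then have "?u = 0" using 0 u \<psi>0[OF u(1)] by simp
    then have "Poly_Mapping.lookup ?u i = 0" by simp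
    then show "k w = 0" unfolding lookup_sum_ev using i by simp
  qed
  have VN: "V \<noteq> N"
  proof
    assume "V = N"
    then have "dim V \<le> card BN" using spanBN by (intro dim_le_card) (auto simp: BN_def)
    then show False using V(2) cardBN by simp
  qed
  then obtain z where z: "z \<in> V" "z \<notin> N" using NV by blast
  \<comment> \<open>Otherwise a basis of \<open>N\<close> together with z and v would be n + 2
    independent vectors.\<close>
  have decomp: "\<exists>s. v - s *\<^sub>R z \<in> N" if "v \<in> V" for v
  proof (rule ccontr)
    assume "\<not> ?thesis"
    then have v: "v \<notin> span (insert z BN)" by (simp add: span_insert spanBN)
    have "z \<notin> BN" using z spanBN by (metis span_base)
    have "independent (insert z BN)" using indep z spanBN by (simp add: independent_insert)
    then have "independent (insert v (insert z BN))" using v by (simp add: independent_insert span_base)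
    moreover obtain C where C: "C \<subseteq> V" "independent C" "V \<subseteq> span C" "card C = dim V" by (rule basis_exists)
    \<comment> \<open>An infinite set has \<open>card\<close> equal to 0, whereas the dimension is n
      + 1.\<close>
    moreover have "finite C" using C(4) V(2) card.infinite by fastforce
    moreover have "insert v (insert z BN) \<subseteq> span C" using that z BN_N NV C(3) by auto
    ultimately have "card (insert v (insert z BN)) \<le> card C" using independent_span_bound by blast
    moreover have "v \<notin> insert z BN" using span_base[of v "insert z BN"] v by blast
    moreover have "finite BN" by (simp add: BN_def)
    ultimately show False
      using \<open>z \<notin> BN\<close> cardBN C(4) V(2) by simp
  qed
  define \<phi> where "\<phi> s a b f = s *\<^sub>R z + \<psi> (coord_vec n 0 a b f)" for s a b f
  have cN: "coord_vec n 0 a b f \<in> coord_space n" for a b f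
    using c.N_mem coords_N_eq[OF n] by blast
  have co: "coords (n - 2) V \<phi>"
  proof
    show "V = {\<phi> s a b f | s a b f. True}"
    proof
      show "V \<subseteq> {\<phi> s a b f | s a b f. True}"
      proof
        fix v assume "v \<in> V"
        then obtain s where "v - s *\<^sub>R z \<in> N" using decomp by blast
        then obtain u where u: "u \<in> coord_space n" "v - s *\<^sub>R z = \<psi> u"
          using bij by (auto simp: bij_betw_def)
        then obtain a b f where "u = coord_vec n 0 a b f"
          using c.obtain_N[of u] coords_N_eq[OF n] by blast
        then have "v = \<phi> s a b f" using u by (simp add: \<phi>_def algebra_simps)
        then show "v \<in> {\<phi> s a b f | s a b f. True}" by blast
      qed
      show "{\<phi> s a b f | s a b f. True} \<subseteq> V"
        using z \<psi>N[OF cN] NV by (auto simp: \<phi>_def intro!: subspace_add[OF subV] subspace_scale[OF subV])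
    qed
    fix s a b f s' a' b' f' k
    show "\<phi> s a b f + \<phi> s' a' b' f' = \<phi> (s + s') (a + a') (b + b') (f + f')"
      using \<psi>_add[OF cN cN, of a b f a' b' f'] by (simp add: \<phi>_def c.add algebra_simps)
    show "k *\<^sub>R \<phi> s a b f = \<phi> (k * s) (k * a) (k * b) (fps_const k * f)"
      using \<psi>_scale[OF cN, of k a b f] by (simp add: \<phi>_def c.scale algebra_simps)
    show "\<phi> s a b f = 0 \<longleftrightarrow> s = 0 \<and> a = 0 \<and> b = 0 \<and> fps_X ^ (n - 2) dvd f"
    proof (cases "s = 0")
      case True
      then show ?thesis using \<psi>0[OF cN, of a b f] by (simp add: \<phi>_def c.ker)
    next
      case False
      have "\<phi> s a b f \<noteq> 0"
      proof
        assume "\<phi> s a b f = 0"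
        then have "s *\<^sub>R z = - \<psi> (coord_vec n 0 a b f)" by (simp add: \<phi>_def eq_neg_iff_add_eq_0)
        then have "s *\<^sub>R z \<in> N" using \<psi>N[OF cN] subN by (simp add: subspace_neg)
        then have "(1 / s) *\<^sub>R (s *\<^sub>R z) \<in> N" using subN subspace_scale by blast
        then show False using False z by simp
      qed
      then show ?thesis using False by simp
    qed
    show "2 \<le> n - 2" using n by simp
  qed
  interpret v: coords "n - 2" V \<phi> by (rule co)
  have vN: "v.N = N"
  proof -
    have "v.N = \<psi> ` c.N" by (auto simp: v.N_def c.N_def \<phi>_def)
    then show ?thesis using bij coords_N_eq[OF n] by (simp add: bij_betw_def)
  qed
  have "L2_ideal_extension (n - 2) V \<phi> br"
  proof
    show "left_leibniz_algebra V br" by (rule V)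
    show "leibniz_ideal V br v.N" unfolding vN by (rule N)
    show "br (\<phi> 0 a b f) (\<phi> 0 a' b' f') =
       \<phi> 0 0 (a * f' $ 0) (fps_X * (fps_const a' * f - fps_const a * f'))" for a b f a' b' f'
      by (simp add: \<phi>_def L2_bracket_coord_vec[OF n] flip: \<psi>_br[OF cN cN])
  qed
  then show ?thesis using that VN by blast
qed

lemma L2_extension_classification:
  assumes n: "4 \<le> n" and ext: "indecomposable_solvable_L2_extension n V br"
  shows "\<exists>br' \<in> ext1_family n \<union> ext2_family n \<union> ext3_family n \<union> ext4_family n.
           leibniz_isomorphic V br (coord_space (n + 1)) br'"
proof -
  obtain N where V: "left_leibniz_algebra V br" "dim V = n + 1"
    and N: "is_nilradical V br N" "leibniz_isomorphic N br (coord_space n) (L2_bracket n)"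
    using ext by (auto simp: indecomposable_solvable_L2_extension_def)
  have ideal: "leibniz_ideal V br N"
    and max: "\<And>M. leibniz_ideal V br M \<Longrightarrow> nilpotent_algebra M br \<Longrightarrow> N \<subseteq> M \<Longrightarrow> M = N"
    using N(1) by (auto simp: is_nilradical_def maximal_nilpotent_ideal_def)
  obtain \<phi> where \<phi>: "L2_ideal_extension (n - 2) V \<phi> br" and VN: "V \<noteq> N"
    using L2_extension_coords[OF n V ideal N(2)] by blast
  \<comment> \<open>Were V nilpotent, it would be a nilpotent ideal properly containing
    \<open>N\<close>, against maximality.\<close>
  have "leibniz_ideal V br V" using V(1) by (auto simp: leibniz_ideal_def left_leibniz_algebra_def)
  then have "\<not> nilpotent_algebra V br" using max[of V] ideal VN by (auto simp: leibniz_ideal_def)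
  then obtain \<alpha> \<kappa> P Q p q \<sigma> \<tau> A B where M: "L2_model (n - 2) V \<phi> br \<alpha> \<kappa> P Q p q \<sigma> \<tau> A B" "\<alpha> \<noteq> 0 \<or> \<kappa> \<noteq> 0"
    using L2_ideal_extension.model_or_nilpotent[OF \<phi>] by metis
  have iso: "leibniz_isomorphic V br (coord_space (n + 1)) br'"
    if "L2_standard_form (n - 2) V br \<alpha> \<kappa> P Q B"
      and "L2_normal (n - 2) (coord_space (n + 1)) (coord_vec n) br' \<alpha> \<kappa> P Q B" for br' \<alpha> \<kappa> P Q B
    using that L2_model_isomorphic unfolding L2_standard_form_def L2_normal_def by blast
  have n3: "3 \<le> n - 2 \<longleftrightarrow> 5 \<le> n" by linarith
  show ?thesis
  proof (cases "\<alpha> = 0")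
    case True
    then have "\<kappa> \<noteq> 0" using M(2) by simp
    then obtain \<epsilon> b where "\<epsilon> \<in> {0, 1, - 1}"
      "L2_standard_form (n - 2) V br 0 (- 1) (- ext4_series \<epsilon> b) (ext4_series \<epsilon> b) 0"
      using standard_form_rank_zero[OF M(1)[unfolded True] V(1)] by blast
    then have "leibniz_isomorphic V br (coord_space (n + 1)) (ext4_bracket n \<epsilon> b)" "ext4_bracket n \<epsilon> b \<in> ext4_family n"
      using iso[OF _ L2_normal_ext4[OF n]] by (auto simp: ext4_family_def)
    then show ?thesis by blast
  next
    case False
    from standard_form_rank_one[OF M(1) V(1) False] n
    consider a where "L2_standard_form (n - 2) V br (- 1) (1 - a) 0 0 0"
      | "5 \<le> n" "L2_standard_form (n - 2) V br (- 1) 1 (- (fps_const 1 * fps_X ^ 2)) 0 0"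
      | "5 \<le> n" "L2_standard_form (n - 2) V br (- 1) (real n - 3) 0 0 1"
      unfolding n3 by (auto simp: of_nat_diff)
    then show ?thesis
    proof cases
      case (1 a)
      then have "leibniz_isomorphic V br (coord_space (n + 1)) (ext1_bracket n a)" "ext1_bracket n a \<in> ext1_family n"
        using iso[OF _ L2_normal_ext1[OF n]] by (auto simp: ext1_family_def)
      then show ?thesis by blast
    next
      case 2
      then have "leibniz_isomorphic V br (coord_space (n + 1)) (ext2_bracket n 1)" "ext2_bracket n 1 \<in> ext2_family n"
        using iso[OF _ L2_normal_ext2] by (auto simp: ext2_family_def)
      then show ?thesis by blast
    next
      case 3
      then have "leibniz_isomorphic V br (coord_space (n + 1)) (ext3_bracket n 1)" "ext3_bracket n 1 \<in> ext3_family n"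
        using iso[OF _ L2_normal_ext3] by (auto simp: ext3_family_def)
      then show ?thesis by blast
    qed
  qed
qed

theorem theorem5p2p3:
  fixes n :: nat
  assumes "n \<ge> 4"
  shows
    "(\<forall>(V :: 'a::real_vector set) br. indecomposable_solvable_L2_extension n V br \<longrightarrow>
        (\<exists>br' \<in> ext1_family n \<union> ext2_family n \<union> ext3_family n \<union> ext4_family n.
           leibniz_isomorphic V br (coord_space (n + 1)) br')) \<and>
     (\<forall>br \<in> ext1_family n \<union> ext2_family n \<union> ext3_family n \<union> ext4_family n.
        indecomposable_solvable_L2_extension n (coord_space (n + 1)) br \<and>
        is_nilradical (coord_space (n + 1)) br (coord_space n) \<and>
        (\<forall>x\<in>coord_space n. \<forall>y\<in>coord_space n. br x y = L2_bracket n x y)) \<and>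
     (n \<ge> 5 \<longrightarrow>
        (\<forall>i<4. \<forall>j<4. i \<noteq> j \<longrightarrow>
           (\<forall>br \<in> [ext1_family n, ext2_family n, ext3_family n, ext4_family n] ! i.
            \<forall>br' \<in> [ext1_family n, ext2_family n, ext3_family n, ext4_family n] ! j.
              \<not> leibniz_isomorphic (coord_space (n + 1)) br (coord_space (n + 1)) br'))) \<and>
     (\<forall>a. a \<noteq> 1 \<longrightarrow>
        map (DS (coord_space (n + 1)) (ext1_bracket n a)) [0..<4] = [n + 1, n, n - 2, 0] \<and>
        LS (coord_space (n + 1)) (ext1_bracket n a) 0 = n + 1 \<and>
        (\<forall>k\<ge>1. LS (coord_space (n + 1)) (ext1_bracket n a) k = n)) \<and>
     (\<forall>br \<in> ext2_family n \<union> ext3_family n.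
        map (DS (coord_space (n + 1)) br) [0..<4] = [n + 1, n, n - 2, 0] \<and>
        LS (coord_space (n + 1)) br 0 = n + 1 \<and>
        (\<forall>k\<ge>1. LS (coord_space (n + 1)) br k = n)) \<and>
     (\<forall>br \<in> ext4_family n.
        map (DS (coord_space (n + 1)) br) [0..<3] = [n + 1, n - 1, 0] \<and>
        LS (coord_space (n + 1)) br 0 = n + 1 \<and>
        (\<forall>k\<ge>1. LS (coord_space (n + 1)) br k = n - 1))"
proof (intro conjI)
  show "\<forall>(V :: 'a set) br. indecomposable_solvable_L2_extension n V br \<longrightarrow>
        (\<exists>br' \<in> ext1_family n \<union> ext2_family n \<union> ext3_family n \<union> ext4_family n.
           leibniz_isomorphic V br (coord_space (n + 1)) br')"
    by (intro allI impI L2_extension_classification[OF assms])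
next
  show "\<forall>br \<in> ext1_family n \<union> ext2_family n \<union> ext3_family n \<union> ext4_family n.
        indecomposable_solvable_L2_extension n (coord_space (n + 1)) br \<and>
        is_nilradical (coord_space (n + 1)) br (coord_space n) \<and>
        (\<forall>x\<in>coord_space n. \<forall>y\<in>coord_space n. br x y = L2_bracket n x y)"
    by (intro ballI ext_families_extension[OF assms])
next
  show "n \<ge> 5 \<longrightarrow>
        (\<forall>i<4. \<forall>j<4. i \<noteq> j \<longrightarrow>
           (\<forall>br \<in> [ext1_family n, ext2_family n, ext3_family n, ext4_family n] ! i.
            \<forall>br' \<in> [ext1_family n, ext2_family n, ext3_family n, ext4_family n] ! j.
              \<not> leibniz_isomorphic (coord_space (n + 1)) br (coord_space (n + 1)) br'))"
  proof (intro impI allI ballI)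
    fix i j br br'
    assume "5 \<le> n" "i < 4" "j < 4" "i \<noteq> j"
      "br \<in> [ext1_family n, ext2_family n, ext3_family n, ext4_family n] ! i"
      "br' \<in> [ext1_family n, ext2_family n, ext3_family n, ext4_family n] ! j"
    then show "\<not> leibniz_isomorphic (coord_space (n + 1)) br (coord_space (n + 1)) br'"
      by (rule ext_families_not_isomorphic)
  qed
qed (intro allI ballI impI ext_families_series[OF assms]; assumption)+

end
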